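(* Let $n\ge1$, $s\in\{0,1,\ldots,n-1\}$, and $f\in C^2(\mathbb{R}^n,\mathbb{R})$. Assume that the restriction $f_{|\mathbb{R}^{n,s}}$ is proper, i.e. $f^{-1}(K)\cap\mathbb{R}^{n,s}$ is compact for any compact set $K\subset\mathbb{R}$. Let $a<b$ be real numbers such that $M^b_a$ contains exactly one M-stationary point $\bar x$ for SCNO, and let $\bar x$ be nondegenerate with $\|\bar x\|_0=k$, quadratic index $QI$, and hence M-index equal to $s-k+QI$. If $a<f(\bar x)<b$, then $M^b$ is homotopy-equivalent to $M^a$ with $\binom{n-k-1}{s-k}$ cells of dimension $s-k+QI$ attached, namely: $$\bigcup_{\substack{J\subset\{1,\ldots,n-k\}\\ 1\in J,\ |J|=s-k+1}}\mathrm{conv}(e_j,\ j\in J)\times[0,1]^{QI}.$$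
   Context: For $x\in\mathbb{R}^n$, $\|x\|_0$ is the number of non-zero entries of $x$, and $\mathbb{R}^{n,s}=\{x\in\mathbb{R}^n : \|x\|_0\le s\}$. SCNO is the problem $\min f(x)$ s.t. $x\in\mathbb{R}^{n,s}$. For $x\in\mathbb{R}^{n,s}$ put $I_0(x)=\{i: x_i=0\}$ and $I_1(x)=\{i: x_i\neq 0\}$. The coordinates are ordered so that at the point of interest $I_0(\bar x)=\{1,\ldots,n-k\}$ and $I_1(\bar x)=\{n-k+1,\ldots,n\}$. A point $\bar x\in\mathbb{R}^{n,s}$ is M-stationary if $\frac{\partial f}{\partial x_i}(\bar x)=0$ for all $i\in I_1(\bar x)$. An M-stationary point $\bar x$ with $\|\bar x\|_0=k$ is nondegenerate if: (ND1) if $k<s$ then $\frac{\partial f}{\partial x_i}(\bar x)\ne0$ for all $i\in I_0(\bar x)$; and (ND2) the matrix $\left(\frac{\partial^2 f}{\partial x_i\partial x_j}(\bar x)\right)_{i,j\in I_1(\bar x)}$ is nonsingular. The quadratic index $QI$ of a nondegenerate M-stationary point is the number of negative eigenvalues of the matrix in ND2, and its M-index is $s-k+QI$. For $a<b$: $M^a=\{x\in\mathbb{R}^{n,s}: f(x)\le a\}$ and $M^b_a=\{x\in\mathbb{R}^{n,s}: a\le f(x)\le b\}$. The $e_j$ are coordinate (unit) vectors, and $\mathrm{conv}(e_j, j\in J)$ is the simplex of convex combinations of the $e_j$, $j\in J$, of dimension $|J|-1$. "$Y$ with $m$ cells of dimension $d$ attached" means a space obtained by gluing $m$ closed $d$-balls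 (here the listed products of simplices and cubes) to $Y$ along continuous maps from their boundary spheres to $Y$; for $d=0$ this is the disjoint union of $Y$ with $m$ points. *)

theory Defs
  imports
    "HOL-Analysis.Analysis"
    "Jordan_Normal_Form.Char_Poly"
begin

definition I0 :: "real ^ 'n \<Rightarrow> 'n set" where
  "I0 x = {i. x $ i = 0}"

definition I1 :: "real ^ 'n \<Rightarrow> 'n set" where
  "I1 x = {i. x $ i \<noteq> 0}"

definition norm0 :: "real ^ 'n \<Rightarrow> nat" where
  "norm0 x = card {i. x $ i \<noteq> 0}"

definition sparse_vectors :: "nat \<Rightarrow> (real ^ 'n) set" where
  "sparse_vectors s = {x. norm0 x \<le> s}"

definition lower_level :: "nat \<Rightarrow> (real ^ 'n \<Rightarrow> real) \<Rightarrow> real \<Rightarrow> (real ^ 'n) set" where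
  "lower_level s f a = {x \<in> sparse_vectors s. f x \<le> a}"

definition level_band :: "nat \<Rightarrow> (real ^ 'n \<Rightarrow> real) \<Rightarrow> real \<Rightarrow> real \<Rightarrow> (real ^ 'n) set" where
  "level_band s f a b = {x \<in> sparse_vectors s. a \<le> f x \<and> f x \<le> b}"

definition partial :: "'n::finite \<Rightarrow> (real ^ 'n \<Rightarrow> real) \<Rightarrow> real ^ 'n \<Rightarrow> real" where
  "partial i f x = deriv (\<lambda>t. f (x + t *\<^sub>R axis i 1)) 0"

definition C1 :: "(real ^ 'n::finite \<Rightarrow> real) \<Rightarrow> bool" where
  "C1 f \<longleftrightarrow> (\<forall>x. f differentiable (at x)) \<and> (\<forall>i. continuous_on UNIV (partial i f))"

definition C2 :: "(real ^ 'n::finite \<Rightarrow> real) \<Rightarrow> bool" where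
  "C2 f \<longleftrightarrow> C1 f \<and> (\<forall>i. C1 (partial i f))"

definition M_stationary :: "nat \<Rightarrow> (real ^ 'n::finite \<Rightarrow> real) \<Rightarrow> real ^ 'n \<Rightarrow> bool" where
  "M_stationary s f x \<longleftrightarrow> x \<in> sparse_vectors s \<and> (\<forall>i\<in>I1 x. partial i f x = 0)"

text \<open>
  The Hessian restricted to the coordinates in \<open>I1 x\<close>, as a square matrix of size \<open>norm0 x\<close>.
  The coordinates are listed in the order given by \<^const>\<open>from_nat_into\<close>;
  another order conjugates the matrix by a permutation.
\<close>

definition reduced_hessian :: "(real ^ 'n::finite \<Rightarrow> real) \<Rightarrow> real ^ 'n \<Rightarrow> real mat" where
  "reduced_hessian f x = Matrix.mat (norm0 x) (norm0 x)
     (\<lambda>(p, q). partial (from_nat_into (I1 x) p) (partial (from_nat_into (I1 x) q) f) x)"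

definition nondegenerate :: "nat \<Rightarrow> (real ^ 'n::finite \<Rightarrow> real) \<Rightarrow> real ^ 'n \<Rightarrow> bool" where
  "nondegenerate s f x \<longleftrightarrow>
     (norm0 x < s \<longrightarrow> (\<forall>i\<in>I0 x. partial i f x \<noteq> 0)) \<and>
     invertible_mat (reduced_hessian f x)"

text \<open>Eigenvalues are counted with their multiplicity.\<close>

definition negative_eigenvalue_count :: "real mat \<Rightarrow> nat" where
  "negative_eigenvalue_count A =
     (\<Sum>\<mu> \<in> {\<mu>. eigenvalue A \<mu> \<and> \<mu> < 0}. order \<mu> (char_poly A))"

definition quadratic_index :: "(real ^ 'n::finite \<Rightarrow> real) \<Rightarrow> real ^ 'n \<Rightarrow> nat" where
  "quadratic_index f x = negative_eigenvalue_count (reduced_hessian f x)"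

definition M_index :: "nat \<Rightarrow> (real ^ 'n::finite \<Rightarrow> real) \<Rightarrow> real ^ 'n \<Rightarrow> nat" where
  "M_index s f x = s - norm0 x + quadratic_index f x"

text \<open>
  The pair \<open>(X, B)\<close> is homeomorphic to the closed unit ball of dimension \<open>d\<close> together with its
  boundary sphere, which is empty for \<open>d = 0\<close>.
\<close>

definition closed_cell :: "nat \<Rightarrow> 'c topology \<Rightarrow> 'c set \<Rightarrow> bool" where
  "closed_cell d X B \<longleftrightarrow>
     B \<subseteq> topspace X \<and>
     (\<exists>h. homeomorphic_map X (subtopology (Euclidean_space d) {y. (\<Sum>i<d. y i ^ 2) \<le> 1}) h \<and>
          h ` B = {y \<in> topspace (Euclidean_space d). (\<Sum>i<d. y i ^ 2) = 1})"

text \<open>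
  The space obtained from \<open>Y\<close> by gluing each \<open>C j\<close>, for \<open>j \<in> J\<close>, along \<open>\<phi> j\<close> on \<open>B j\<close>. It is the
  quotient of the disjoint union of \<open>Y\<close> and the \<open>C j\<close> that identifies every \<open>c \<in> B j\<close> with \<open>\<phi> j c\<close>;
  each class is represented by its point of \<open>Y\<close> if it has one, and otherwise by its only element.
  \<open>glue_map B \<phi> j\<close> is the quotient map on \<open>C j\<close>; on \<open>Y\<close> the quotient map is \<open>Inl\<close>.
\<close>

definition glue_map ::
    "('j \<Rightarrow> 'c set) \<Rightarrow> ('j \<Rightarrow> 'c \<Rightarrow> 'y) \<Rightarrow> 'j \<Rightarrow> 'c \<Rightarrow> 'y + 'j \<times> 'c" where
  "glue_map B \<phi> j c = (if c \<in> B j then Inl (\<phi> j c) else Inr (j, c))"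

definition glued_carrier ::
    "'y topology \<Rightarrow> 'j set \<Rightarrow> ('j \<Rightarrow> 'c topology) \<Rightarrow> ('j \<Rightarrow> 'c set) \<Rightarrow> ('y + 'j \<times> 'c) set" where
  "glued_carrier Y J C B = Inl ` topspace Y \<union> Inr ` (SIGMA j:J. topspace (C j) - B j)"

definition glued_space ::
    "'y topology \<Rightarrow> 'j set \<Rightarrow> ('j \<Rightarrow> 'c topology) \<Rightarrow> ('j \<Rightarrow> 'c set) \<Rightarrow> ('j \<Rightarrow> 'c \<Rightarrow> 'y) \<Rightarrow>
      ('y + 'j \<times> 'c) topology" where
  "glued_space Y J C B \<phi> = topology (\<lambda>U.
     U \<subseteq> glued_carrier Y J C B \<and>
     openin Y {y \<in> topspace Y. Inl y \<in> U} \<and>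
     (\<forall>j\<in>J. openin (C j) {c \<in> topspace (C j). glue_map B \<phi> j c \<in> U}))"

lemma openin_glued_space:
  "openin (glued_space Y J C B \<phi>) U \<longleftrightarrow>
     U \<subseteq> glued_carrier Y J C B \<and>
     openin Y {y \<in> topspace Y. Inl y \<in> U} \<and>
     (\<forall>j\<in>J. openin (C j) {c \<in> topspace (C j). glue_map B \<phi> j c \<in> U})"
proof -
  let ?P = "\<lambda>U. U \<subseteq> glued_carrier Y J C B \<and>
     openin Y {y \<in> topspace Y. Inl y \<in> U} \<and>
     (\<forall>j\<in>J. openin (C j) {c \<in> topspace (C j). glue_map B \<phi> j c \<in> U})"
  have inter: "{z \<in> A. g z \<in> S \<inter> T} = {z \<in> A. g z \<in> S} \<inter> {z \<in> A. g z \<in> T}"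
    for A :: "'z set" and g :: "'z \<Rightarrow> 'w" and S T by blast
  have union: "{z \<in> A. g z \<in> \<Union>K} = \<Union>((\<lambda>S. {z \<in> A. g z \<in> S}) ` K)"
    for A :: "'z set" and g :: "'z \<Rightarrow> 'w" and K by blast
  have "?P (S \<inter> T)" if "?P S" "?P T" for S T
    using that unfolding inter by (blast intro: openin_Int)
  moreover have "?P (\<Union>K)" if "\<forall>S\<in>K. ?P S" for K
  proof (intro conjI ballI)
    show "\<Union>K \<subseteq> glued_carrier Y J C B"
      using that by blast
    show "openin Y {y \<in> topspace Y. Inl y \<in> \<Union>K}"
      unfolding union by (rule openin_Union) (use that in blast)
    show "openin (C j) {c \<in> topspace (C j). glue_map B \<phi> j c \<in> \<Union>K}" if "j \<in> J" for j
      unfolding union by (rule openin_Union) (use \<open>\<forall>S\<in>K. ?P S\<close> that in blast)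
  qed
  ultimately have "istopology ?P"
    unfolding istopology_def by blast
  then show ?thesis
    unfolding glued_space_def by (simp add: topology_inverse')
qed

lemma topspace_glued_space:
  assumes "\<And>j. j \<in> J \<Longrightarrow> \<phi> j \<in> topspace (C j) \<inter> B j \<rightarrow> topspace Y"
  shows "topspace (glued_space Y J C B \<phi>) = glued_carrier Y J C B"
proof
  show "topspace (glued_space Y J C B \<phi>) \<subseteq> glued_carrier Y J C B"
    using openin_glued_space[of Y J C B \<phi> "topspace (glued_space Y J C B \<phi>)"] by simp
  have "{y \<in> topspace Y. (Inl y :: _ + _ \<times> _) \<in> glued_carrier Y J C B} = topspace Y"
    by (auto simp: glued_carrier_def)
  moreover have "{c \<in> topspace (C j). glue_map B \<phi> j c \<in> glued_carrier Y J C B} = topspace (C j)"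
    if "j \<in> J" for j
    using assms[OF that] that by (fastforce simp: glued_carrier_def glue_map_def)
  ultimately have "openin (glued_space Y J C B \<phi>) (glued_carrier Y J C B)"
    by (simp add: openin_glued_space)
  then show "glued_carrier Y J C B \<subseteq> topspace (glued_space Y J C B \<phi>)"
    by (rule openin_subset)
qed

definition coord_simplex :: "'n::finite set \<Rightarrow> (real ^ 'n) set" where
  "coord_simplex J = convex hull ((\<lambda>j. axis j 1) ` J)"

definition cube :: "nat \<Rightarrow> (nat \<Rightarrow> real) set" where
  "cube q = (\<Pi>\<^sub>E i\<in>{..<q}. {0..1})"

definition simplex_cube :: "nat \<Rightarrow> 'n::finite set \<Rightarrow> ((real ^ 'n) \<times> (nat \<Rightarrow> real)) topology" where
  "simplex_cube q J =
     prod_topology (top_of_set (coord_simplex J))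
       (product_topology (\<lambda>i. top_of_set {0..1}) {..<q})"

text \<open>
  The cube is a subset of a function type, on which \<^const>\<open>rel_frontier\<close> is not available, so the
  boundary is written out as \<open>\<partial>S \<times> Q \<union> S \<times> \<partial>Q\<close>.
\<close>

definition simplex_cube_boundary :: "nat \<Rightarrow> 'n::finite set \<Rightarrow> ((real ^ 'n) \<times> (nat \<Rightarrow> real)) set" where
  "simplex_cube_boundary q J =
     rel_frontier (coord_simplex J) \<times> cube q \<union>
     coord_simplex J \<times> {y \<in> cube q. \<exists>i<q. y i = 0 \<or> y i = 1}"

end

theory Submission
  imports Defs
begin

text \<open>
  Adding a multiple of the field with components \<open>- x\<^sub>i\<^sup>2 \<partial>\<^sub>i f\<close> to \<open>x\<close> creates no new nonzero coordinate, and it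
  decreases \<open>f\<close> at a definite rate on compact sets of non-stationary points; finitely many such Euler steps
  replace the gradient flow between regular levels. Near the stationary point \<open>f\<close> is first replaced by its
  model \<open>f x\<^sub>0 - \<Sum>u - |w|\<^sup>2 + |v|\<^sup>2\<close>, where \<open>u\<close> are rescaled coordinates of \<open>I0\<close>; one Euler step followed by
  killing \<open>v\<close> and the negative \<open>u\<^sub>i\<close> pushes \<open>f \<le> f x\<^sub>0 + \<epsilon>\<close> into \<open>f \<le> f x\<^sub>0 - \<epsilon>\<close> together with the core
  \<open>{u \<ge> 0, |u|\<^sub>0 \<le> s - k, \<Sum>u + |w|\<^sup>2 \<le> \<epsilon>}\<close>. Relative to its boundary \<open>\<Sum>u + |w|\<^sup>2 = \<epsilon>\<close>, the core is homotopy equivalent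
  to the union of the pieces of the paraboloid \<open>\<Sum>u + |w|\<^sup>2 = \<epsilon>\<close> supported on a set \<open>J\<close> of \<open>s - k + 1\<close> indices containing \<open>p\<close>:
  in one direction increase \<open>u\<^sub>p\<close> until the equation holds, in the other subtract the minimum of \<open>u\<close> over \<open>J\<close>.
  Each piece is a cell, a simplex times a cube up to homeomorphism.
\<close>

text \<open>The sparse vectors do not form a manifold, and a flow would have to respect all
  coordinate strata at once. The squared factor in the field lets each Euler step do this, and
  continuity of the gradient suffices for it, which is what the modified function offers. The price
  is that a step also moves points of the target sublevel set, so deformations preserve a set
  without fixing it. Attaching maps found just below the critical level therefore change with every
  further step down to \<open>a\<close>, and the homotopy type of a gluing has to be shown to
  survive this.

  Why the pieces through \<open>p\<close> can replace the core: apart from the negative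
  eigendirections, the core is a cone with apex \<open>xbar\<close> over the skeleton of dimension
  \<open>s - k - 1\<close> of a simplex on \<open>I0 xbar\<close>. The faces of dimension
  \<open>s - k\<close> through \<open>p\<close> contain the same skeleton and form a cone with apex
  \<open>p\<close>, over the corresponding skeleton of the opposite face. One contractible filling
  of the skeleton is exchanged for another, and the latter consists of cells.\<close>

no_notation Matrix.vec_index (infixl "$" 100)
no_notation scalar_prod (infix "\<bullet>" 70)

section \<open>Glued spaces\<close>

text \<open>Weaker than a deformation retraction: points of \<open>A\<close> may move, but only
  inside \<open>A\<close>. An Euler step does move the points of the lower sublevel set.\<close>

definition weak_deformation :: "'a topology \<Rightarrow> 'a set \<Rightarrow> (real \<times> 'a \<Rightarrow> 'a) \<Rightarrow> bool" where
  "weak_deformation X A H \<longleftrightarrow>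
     A \<subseteq> topspace X \<and> continuous_map (prod_topology (top_of_set {0..1}) X) X H \<and>
     (\<forall>x\<in>topspace X. H (0, x) = x \<and> H (1, x) \<in> A) \<and>
     (\<forall>t\<in>{0..1}. \<forall>x\<in>A. H (t, x) \<in> A)"

text \<open>The end map \<open>H (1, _)\<close> is a homotopy inverse of the inclusion of
  \<open>A\<close>: \<open>H\<close> is the homotopy on \<open>X\<close>, and its restriction, which
  stays in \<open>A\<close>, is the homotopy on \<open>A\<close>.\<close>

lemma homotopy_equivalent_weak_deformation:
  assumes "weak_deformation X A H"
  shows "subtopology X A homotopy_equivalent_space X"
proof -
  let ?I = "top_of_set {0..1::real}"
  have AX: "A \<subseteq> topspace X" and H: "continuous_map (prod_topology ?I X) X H"
    and H0: "\<And>x. x \<in> topspace X \<Longrightarrow> H (0, x) = x"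
    and H1: "\<And>x. x \<in> topspace X \<Longrightarrow> H (1, x) \<in> A"
    and HA: "\<And>t x. t \<in> {0..1} \<Longrightarrow> x \<in> A \<Longrightarrow> H (t, x) \<in> A"
    using assms by (auto simp: weak_deformation_def)
  have Pair1: "continuous_map X (prod_topology ?I X) (\<lambda>x. (1, x))"
    by (intro continuous_map_pairedI) auto
  have g: "continuous_map X (subtopology X A) (\<lambda>x. H (1, x))"
    using continuous_map_compose[OF Pair1 H] H1
    by (auto simp: continuous_map_in_subtopology o_def)
  have i: "continuous_map (subtopology X A) X id"
    by (simp add: continuous_map_from_subtopology)
  have HA': "continuous_map (prod_topology ?I (subtopology X A)) (subtopology X A) H"
    unfolding continuous_map_in_subtopology
  proof
    have "prod_topology ?I (subtopology X A) = subtopology (prod_topology ?I X) (topspace ?I \<times> A)"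
      by (rule prod_topology_subtopology)
    then show "continuous_map (prod_topology ?I (subtopology X A)) X H"
      using H by (simp add: continuous_map_from_subtopology)
  qed (use HA AX in auto)
  have "homotopic_with (\<lambda>x. True) X X id (id \<circ> (\<lambda>x. H (1, x)))"
    by (subst homotopic_with) (use H H0 in auto)
  moreover have "homotopic_with (\<lambda>x. True) (subtopology X A) (subtopology X A) id ((\<lambda>x. H (1, x)) \<circ> id)"
    by (subst homotopic_with) (use HA' H0 in auto)
  ultimately show ?thesis
    unfolding homotopy_equivalent_space_def using i g homotopic_with_symD by blast
qed

lemma continuous_map_Inl_glued_space:
  "continuous_map Y (glued_space Y J C B \<phi>) Inl" if "\<And>j. j \<in> J \<Longrightarrow> \<phi> j \<in> topspace (C j) \<inter> B j \<rightarrow> topspace Y"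
  using that by (auto simp: continuous_map_def openin_glued_space topspace_glued_space glued_carrier_def)

lemma continuous_map_glue_map:
  assumes "\<And>j. j \<in> J \<Longrightarrow> \<phi> j \<in> topspace (C j) \<inter> B j \<rightarrow> topspace Y" and "j \<in> J"
  shows "continuous_map (C j) (glued_space Y J C B \<phi>) (glue_map B \<phi> j)"
  using assms
  by (fastforce simp: continuous_map_def openin_glued_space topspace_glued_space glued_carrier_def glue_map_def)

text \<open>The universal property of the gluing. Openness there is tested on \<open>Y\<close> and
  on every cell separately, so a preimage can be tested piece by piece.\<close>

lemma continuous_map_from_glued_space:
  assumes \<phi>: "\<And>j. j \<in> J \<Longrightarrow> \<phi> j \<in> topspace (C j) \<inter> B j \<rightarrow> topspace Y"
    and Y: "continuous_map Y W (\<lambda>y. h (Inl y))"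
    and C: "\<And>j. j \<in> J \<Longrightarrow> continuous_map (C j) W (\<lambda>c. h (glue_map B \<phi> j c))"
  shows "continuous_map (glued_space Y J C B \<phi>) W h"
  unfolding continuous_map_def
proof (intro conjI allI impI)
  have tsZ: "topspace (glued_space Y J C B \<phi>) = glued_carrier Y J C B"
    by (rule topspace_glued_space) (rule \<phi>)
  show "h \<in> topspace (glued_space Y J C B \<phi>) \<rightarrow> topspace W"
  proof
    fix z assume "z \<in> topspace (glued_space Y J C B \<phi>)"
    then have z: "z \<in> glued_carrier Y J C B" using tsZ by auto
    show "h z \<in> topspace W"
    proof (cases z)
      case (Inl y) then show ?thesis using z Y by (auto simp: glued_carrier_def continuous_map_def)
    next
      case (Inr w)
      then obtain j c where w: "w = (j, c)" "j \<in> J" "c \<in> topspace (C j)" "c \<notin> B j"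
        using z by (auto simp: glued_carrier_def)
      then show ?thesis using continuous_map_funspace[OF C[OF w(2)]] Inr
        by (auto simp: glue_map_def Pi_iff dest!: bspec[where x=c])
    qed
  qed
next
  fix U assume U: "openin W U"
  have tsZ: "topspace (glued_space Y J C B \<phi>) = glued_carrier Y J C B"
    by (rule topspace_glued_space) (rule \<phi>)
  have [simp]: "{y \<in> topspace Y. Inl y \<in> glued_carrier Y J C B \<and> h (Inl y) \<in> U} = {y \<in> topspace Y. h (Inl y) \<in> U}"
    by (auto simp: glued_carrier_def)
  have [simp]: "{c \<in> topspace (C j). glue_map B \<phi> j c \<in> glued_carrier Y J C B \<and> h (glue_map B \<phi> j c) \<in> U}
      = {c \<in> topspace (C j). h (glue_map B \<phi> j c) \<in> U}" if "j \<in> J" for j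
    using \<phi>[OF that] that by (fastforce simp: glued_carrier_def glue_map_def)
  show "openin (glued_space Y J C B \<phi>) {x \<in> topspace (glued_space Y J C B \<phi>). h x \<in> U}"
    unfolding openin_glued_space tsZ
    using openin_continuous_map_preimage[OF Y U] openin_continuous_map_preimage[OF C U]
    by auto
qed

text \<open>The unit interval is compact, so its product with a quotient map is again a quotient map;
  the tube lemma shows this directly.\<close>

lemma continuous_map_from_interval_glued_space:
  fixes h :: "real \<times> ('y + 'j \<times> 'c) \<Rightarrow> 'w"
  defines "I \<equiv> top_of_set {0..1::real}"
  assumes \<phi>: "\<And>j. j \<in> J \<Longrightarrow> \<phi> j \<in> topspace (C j) \<inter> B j \<rightarrow> topspace Y"
    and Y: "continuous_map (prod_topology I Y) W (\<lambda>(t, y). h (t, Inl y))"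
    and C: "\<And>j. j \<in> J \<Longrightarrow> continuous_map (prod_topology I (C j)) W (\<lambda>(t, c). h (t, glue_map B \<phi> j c))"
  shows "continuous_map (prod_topology I (glued_space Y J C B \<phi>)) W h"
proof -
  let ?Z = "glued_space Y J C B \<phi>"
  have tsZ: "topspace ?Z = glued_carrier Y J C B" by (rule topspace_glued_space) (rule \<phi>)
  have tsI: "topspace I = {0..1}" by (simp add: I_def)
  \<comment> \<open>The tube lemma: compactness of \<open>N\<close> makes the set of all
    \<open>x\<close> whose whole slice over \<open>N\<close> is mapped into \<open>U\<close>
    open.\<close>
  have slice: "openin X {x \<in> topspace X. \<forall>t\<in>N. g (t, x) \<in> U}"
    if g: "continuous_map (prod_topology I X) W g" and N: "compactin I N" and U: "openin W U" for X :: "'z topology" and g N U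
  proof (subst openin_subopen, intro ballI)
    fix x assume x: "x \<in> {x \<in> topspace X. \<forall>t\<in>N. g (t, x) \<in> U}"
    let ?P = "{z \<in> topspace (prod_topology I X). g z \<in> U}"
    have P: "openin (prod_topology I X) ?P" using g U by (rule openin_continuous_map_preimage)
    have "N \<subseteq> topspace I" using N compactin_subset_topspace by blast
    then have sub: "N \<times> {x} \<subseteq> ?P" using x by auto
    obtain U' V where "openin I U'" "openin X V" "N \<subseteq> U'" "{x} \<subseteq> V" "U' \<times> V \<subseteq> ?P"
      using Wallace_theorem_prod_topology[OF N _ P sub] x by auto
    then show "\<exists>T. openin X T \<and> x \<in> T \<and> T \<subseteq> {x \<in> topspace X. \<forall>t\<in>N. g (t, x) \<in> U}"
      by (intro exI[of _ V]) (auto dest: openin_subset)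
  qed
  have slices: "continuous_map I W (\<lambda>t. h (t, z))" if z: "z \<in> glued_carrier Y J C B" for z
  proof (cases z)
    case (Inl y)
    then have "continuous_map I (prod_topology I Y) (\<lambda>t. (t, y))"
      using z by (intro continuous_map_pairedI) (auto simp: glued_carrier_def)
    from continuous_map_compose[OF this Y] show ?thesis using Inl by (simp add: o_def)
  next
    case (Inr w)
    then obtain j c where w: "w = (j, c)" "j \<in> J" "c \<in> topspace (C j)" "c \<notin> B j"
      using z by (auto simp: glued_carrier_def)
    then have "continuous_map I (prod_topology I (C j)) (\<lambda>t. (t, c))"
      by (intro continuous_map_pairedI) auto
    from continuous_map_compose[OF this C[OF w(2)]] show ?thesis
      using Inr w by (simp add: o_def glue_map_def)
  qed
  show ?thesis
    unfolding continuous_map_def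
  proof (intro conjI allI impI)
    show "h \<in> topspace (prod_topology I ?Z) \<rightarrow> topspace W"
      using continuous_map_funspace[OF slices] by (auto simp: tsZ Pi_iff)
  next
    fix U assume U: "openin W U"
    let ?P = "{x \<in> topspace (prod_topology I ?Z). h x \<in> U}"
    show "openin (prod_topology I ?Z) ?P"
      unfolding openin_prod_topology_alt
    proof (intro allI impI)
      fix t z assume "(t, z) \<in> ?P"
      then have t: "t \<in> {0..1}" and z: "z \<in> glued_carrier Y J C B" and hU: "h (t, z) \<in> U"
        by (auto simp: tsZ tsI)
      have "openin I {t \<in> topspace I. h (t, z) \<in> U}"
        using slices[OF z] U by (rule openin_continuous_map_preimage)
      then obtain e where e: "e > 0" "\<And>t'. t' \<in> {0..1} \<Longrightarrow> dist t' t < e \<Longrightarrow> h (t', z) \<in> U"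
        using t hU unfolding I_def openin_euclidean_subtopology_iff topspace_euclidean_subtopology
        by blast
      \<comment> \<open>Half the radius gives a closed, hence compact, interval on which
        \<open>h\<close> stays in \<open>U\<close> at \<open>z\<close>; the open interval of the
        same radius is the neighbourhood of \<open>t\<close>.\<close>
      define N where "N = {0..1} \<inter> cball t (e/2)"
      have cN: "compactin I N"
        unfolding I_def N_def by (simp add: compactin_subtopology compact_Int)
      define O' where "O' = {z \<in> glued_carrier Y J C B. \<forall>t\<in>N. h (t, z) \<in> U}"
      have N: "openin I ({0..1} \<inter> ball t (e/2))" unfolding I_def by (simp add: openin_open_Int)
      have "z \<in> O'" using z e by (auto simp: O'_def N_def dist_commute)
      moreover have "openin ?Z O'"
        unfolding openin_glued_space
      proof (intro conjI ballI)
        show "O' \<subseteq> glued_carrier Y J C B" by (auto simp: O'_def)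
        have "{y \<in> topspace Y. Inl y \<in> O'} = {y \<in> topspace Y. \<forall>t\<in>N. (\<lambda>(t, y). h (t, Inl y)) (t, y) \<in> U}"
          by (auto simp: O'_def glued_carrier_def)
        then show "openin Y {y \<in> topspace Y. Inl y \<in> O'}"
          using slice[OF Y cN U] by simp
        fix j assume j: "j \<in> J"
        have "{c \<in> topspace (C j). glue_map B \<phi> j c \<in> O'}
            = {c \<in> topspace (C j). \<forall>t\<in>N. (\<lambda>(t, c). h (t, glue_map B \<phi> j c)) (t, c) \<in> U}"
          using \<phi>[OF j] j by (fastforce simp: O'_def glued_carrier_def glue_map_def)
        then show "openin (C j) {c \<in> topspace (C j). glue_map B \<phi> j c \<in> O'}"
          using slice[OF C[OF j] cN U] by simp
      qed
      moreover have "({0..1} \<inter> ball t (e/2)) \<times> O' \<subseteq> ?P"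
        by (auto simp: O'_def N_def tsZ tsI)
      moreover have "t \<in> {0..1} \<inter> ball t (e/2)" using t e by auto
      ultimately show "\<exists>U V. openin I U \<and> openin ?Z V \<and> t \<in> U \<and> z \<in> V \<and> U \<times> V \<subseteq> ?P"
        using N by blast
    qed
  qed
qed

section \<open>Radial structure of a cell\<close>

lemma continuous_map_mem: "continuous_map X Y f \<Longrightarrow> x \<in> topspace X \<Longrightarrow> f x \<in> topspace Y"
  using continuous_map_funspace by blast

text \<open>The polar structure of a ball carried over to \<open>C\<close>: \<open>rad\<close> is
  the norm and \<open>sc l\<close> the dilation by \<open>l\<close>, defined as long as the image
  stays in the ball. Deformations of a gluing can then be written as formulas in the radius.\<close>

definition cell_collar :: "'c topology \<Rightarrow> 'c set \<Rightarrow> ('c \<Rightarrow> real) \<Rightarrow> (real \<Rightarrow> 'c \<Rightarrow> 'c) \<Rightarrow> bool" where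
  "cell_collar C B rad sc \<longleftrightarrow>
     B \<subseteq> topspace C \<and> continuous_map C euclideanreal rad \<and>
     (\<forall>c\<in>topspace C. 0 \<le> rad c \<and> rad c \<le> 1 \<and> (rad c = 1 \<longleftrightarrow> c \<in> B) \<and> sc 1 c = c) \<and>
     continuous_map (subtopology (prod_topology euclideanreal C) {(l, c). 0 \<le> l \<and> l * rad c \<le> 1}) C
       (\<lambda>(l, c). sc l c) \<and>
     (\<forall>c\<in>topspace C. \<forall>l\<ge>0. l * rad c \<le> 1 \<longrightarrow>
        rad (sc l c) = l * rad c \<and> (\<forall>m. sc m (sc l c) = sc (m * l) c))"

lemma closed_cell_collar:
  assumes "closed_cell d C B"
  obtains rad sc where "cell_collar C B rad sc"
proof -
  let ?E = "Euclidean_space d"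
  let ?Bl = "subtopology ?E {y. (\<Sum>i<d. y i ^ 2) \<le> 1}"
  obtain h where BC: "B \<subseteq> topspace C" and h: "homeomorphic_map C ?Bl h"
    and hB: "h ` B = {y \<in> topspace ?E. (\<Sum>i<d. y i ^ 2) = 1}"
    using assms by (auto simp: closed_cell_def)
  obtain k where hk: "homeomorphic_maps C ?Bl h k"
    using h homeomorphic_map_maps by blast
  have ch: "continuous_map C ?Bl h" and ck: "continuous_map ?Bl C k"
    and kh: "\<And>c. c \<in> topspace C \<Longrightarrow> k (h c) = c"
    and hk': "\<And>y. y \<in> topspace ?Bl \<Longrightarrow> h (k y) = y"
    using hk by (auto simp: homeomorphic_maps_def)
  have ch_i: "continuous_map C euclideanreal (\<lambda>c. h c i)" for i
    using ch unfolding continuous_map_in_subtopology Euclidean_space_def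
    by (simp add: continuous_map_componentwise_UNIV)
  define N where "N y = sqrt (\<Sum>i<d. y i ^ 2)" for y :: "nat \<Rightarrow> real"
  define rad where "rad = N \<circ> h"
  define sc where "sc l c = k (\<lambda>i. l * h c i)" for l c
  have hc: "h c \<in> topspace ?Bl" if "c \<in> topspace C" for c
    using continuous_map_funspace[OF ch] that by auto
  have Nscale: "N (\<lambda>i. l * y i) = \<bar>l\<bar> * N y" for l y
    by (simp add: N_def power_mult_distrib flip: sum_distrib_left)
       (simp add: real_sqrt_mult)
  have in_Bl: "(\<lambda>i. l * h c i) \<in> topspace ?Bl" if "c \<in> topspace C" "0 \<le> l" "l * rad c \<le> 1" for l c
  proof -
    have "N (\<lambda>i. l * h c i) \<le> 1" using Nscale that by (simp add: rad_def)
    then have "(\<Sum>i<d. (l * h c i) ^ 2) \<le> 1" by (simp add: N_def)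
    then show ?thesis using hc[OF that(1)] by (auto simp: topspace_Euclidean_space)
  qed
  have "cell_collar C B rad sc"
    unfolding cell_collar_def
  proof (intro conjI ballI allI impI BC)
    show "continuous_map C euclideanreal rad"
      unfolding rad_def N_def o_def by (intro continuous_intros ch_i finite_lessThan)
    fix c assume c: "c \<in> topspace C"
    show "0 \<le> rad c" by (simp add: rad_def N_def sum_nonneg)
    show "rad c \<le> 1" using hc[OF c] by (auto simp: rad_def N_def)
    show "rad c = 1 \<longleftrightarrow> c \<in> B"
    proof
      assume "rad c = 1"
      then have "h c \<in> h ` B" using hc[OF c] unfolding hB by (auto simp: rad_def N_def)
      then show "c \<in> B" using kh c BC by (metis imageE subsetD)
    next
      assume "c \<in> B" then show "rad c = 1" using hB by (auto simp: rad_def N_def)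
    qed
    show "sc 1 c = c" using kh c by (simp add: sc_def)
    fix l :: real assume l: "0 \<le> l" "l * rad c \<le> 1"
    show "rad (sc l c) = l * rad c"
      using hk'[OF in_Bl[OF c l]] Nscale[of l "h c"] l by (simp add: rad_def sc_def)
    show "sc m (sc l c) = sc (m * l) c" for m
      using hk'[OF in_Bl[OF c l]] by (simp add: sc_def mult.assoc)
  next
    let ?R = "{(l, c). 0 \<le> l \<and> l * rad c \<le> 1}"
    let ?T = "subtopology (prod_topology euclideanreal C) ?R"
    have "continuous_map ?T ?Bl (\<lambda>(l, c) i. l * h c i)"
      unfolding continuous_map_in_subtopology Euclidean_space_def
    proof (intro conjI)
      show "continuous_map ?T (powertop_real UNIV) (\<lambda>(l, c) i. l * h c i)"
        unfolding continuous_map_componentwise_UNIV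
      proof
        fix i
        have "continuous_map (prod_topology euclideanreal C) euclideanreal (\<lambda>x. fst x * h (snd x) i)"
          by (intro continuous_intros continuous_map_fst continuous_map_compose[OF continuous_map_snd ch_i, unfolded o_def])
        then show "continuous_map ?T euclideanreal (\<lambda>x. (case x of (l, c) \<Rightarrow> \<lambda>i. l * h c i) i)"
          by (auto intro!: continuous_map_from_subtopology simp: split_beta)
      qed
    qed (use in_Bl in \<open>auto simp: Euclidean_space_def\<close>)
    from continuous_map_compose[OF this ck]
    show "continuous_map ?T C (\<lambda>(l, c). sc l c)"
      by (simp add: o_def split_beta' sc_def)
  qed
  then show ?thesis using that by blast
qed

text \<open>At parameter \<open>t\<close> the cell is stretched by the factor \<open>a t\<close>,
  and the part that would leave the ball is sent to \<open>Y\<close> by \<open>K\<close>. The two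
  formulas agree where \<open>a t * rad c = 1\<close>, since the stretched point is then on the
  boundary and is glued to its image under \<open>\<phi> j\<close>.\<close>

lemma continuous_map_collar_glued:
  assumes \<phi>: "\<And>j. j \<in> J \<Longrightarrow> \<phi> j \<in> topspace (C j) \<inter> B j \<rightarrow> topspace Y"
    and j: "j \<in> J" and cc: "cell_collar (C j) (B j) rad sc"
    and a: "continuous_map T euclideanreal a" and a0: "\<And>t. t \<in> topspace T \<Longrightarrow> a t \<ge> 0"
    and K: "continuous_map (subtopology (prod_topology T (C j)) {(t, c). 1 \<le> a t * rad c}) Y K"
    and eq: "\<And>t c. t \<in> topspace T \<Longrightarrow> c \<in> topspace (C j) \<Longrightarrow> a t * rad c = 1 \<Longrightarrow> K (t, c) = \<phi> j (sc (a t) c)"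
  shows "continuous_map (prod_topology T (C j)) (glued_space Y J C B \<phi>)
           (\<lambda>(t, c). if a t * rad c \<le> 1 then glue_map B \<phi> j (sc (a t) c) else Inl (K (t, c)))"
proof -
  let ?P = "prod_topology T (C j)" and ?Z = "glued_space Y J C B \<phi>"
  have rad: "continuous_map (C j) euclideanreal rad"
    and sc: "continuous_map (subtopology (prod_topology euclideanreal (C j)) {(l, c). 0 \<le> l \<and> l * rad c \<le> 1}) (C j)
       (\<lambda>(l, c). sc l c)"
    using cc by (auto simp: cell_collar_def)
  have ca: "continuous_map ?P euclideanreal (\<lambda>x. a (fst x))"
    using continuous_map_compose[OF continuous_map_fst a] by (simp add: o_def)
  have cr: "continuous_map ?P euclideanreal (\<lambda>x. rad (snd x))"
    using continuous_map_compose[OF continuous_map_snd rad] by (simp add: o_def)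
  have p: "continuous_map ?P euclideanreal (\<lambda>x. a (fst x) * rad (snd x))"
    by (intro continuous_intros ca cr)
  have "continuous_map ?P ?Z (\<lambda>x. if a (fst x) * rad (snd x) \<le> 1
      then glue_map B \<phi> j (sc (a (fst x)) (snd x)) else Inl (K x))"
  proof (rule continuous_map_cases_le[OF p])
    show "continuous_map ?P euclideanreal (\<lambda>x. 1)" by simp
    let ?L = "{x \<in> topspace ?P. a (fst x) * rad (snd x) \<le> 1}"
    have "continuous_map (subtopology ?P ?L)
       (subtopology (prod_topology euclideanreal (C j)) {(l, c). 0 \<le> l \<and> l * rad c \<le> 1}) (\<lambda>x. (a (fst x), snd x))"
      unfolding continuous_map_in_subtopology
      by (auto intro!: continuous_map_pairedI continuous_map_from_subtopology ca continuous_map_snd a0)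
    from continuous_map_compose[OF continuous_map_compose[OF this sc] continuous_map_glue_map[where B=B and \<phi>=\<phi>, OF \<phi> j]]
    show "continuous_map (subtopology ?P ?L) ?Z (\<lambda>x. glue_map B \<phi> j (sc (a (fst x)) (snd x)))"
      by (simp add: o_def)
    have "subtopology ?P {(t, c). 1 \<le> a t * rad c} = subtopology ?P {x \<in> topspace ?P. 1 \<le> a (fst x) * rad (snd x)}"
      by (subst (1 2) subtopology_restrict[symmetric]) (rule arg_cong[where f="subtopology ?P"], auto)
    with continuous_map_compose[OF K continuous_map_Inl_glued_space[OF \<phi>]]
    show "continuous_map (subtopology ?P {x \<in> topspace ?P. 1 \<le> a (fst x) * rad (snd x)}) ?Z (\<lambda>x. Inl (K x))"
      by (simp add: o_def)
    fix x assume x: "x \<in> topspace ?P" "a (fst x) * rad (snd x) = 1"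
    obtain t c where tc: "x = (t, c)" by force
    have "rad (sc (a t) c) = 1" "a t \<ge> 0" using cc x tc a0 by (auto simp: cell_collar_def)
    moreover have "sc (a t) c \<in> topspace (C j)"
    proof -
      have "(\<lambda>(l, c). sc l c) (a t, c) \<in> topspace (C j)"
        using continuous_map_mem[OF sc, of "(a t, c)"] x tc a0 by auto
      then show ?thesis by simp
    qed
    ultimately have "sc (a t) c \<in> B j" using cc by (auto simp: cell_collar_def)
    then show "glue_map B \<phi> j (sc (a (fst x)) (snd x)) = Inl (K x)"
      using eq x tc by (auto simp: glue_map_def)
  qed
  then show ?thesis by (simp add: split_beta' cong: if_cong)
qed

text \<open>Radial projection to the boundary sphere, defined off the centre of the ball.\<close>

lemma continuous_map_collar_direction:
  assumes cc: "cell_collar C B rad sc" and a0: "\<And>t c. (t, c) \<in> S \<Longrightarrow> t \<in> topspace T \<Longrightarrow> c \<in> topspace C \<Longrightarrow> rad c > 0"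
  shows "continuous_map (subtopology (prod_topology T C) S) (subtopology C B) (\<lambda>x. sc (1 / rad (snd x)) (snd x))"
proof -
  have rad: "continuous_map C euclideanreal rad"
    and sc: "continuous_map (subtopology (prod_topology euclideanreal C) {(l, c). 0 \<le> l \<and> l * rad c \<le> 1}) C
       (\<lambda>(l, c). sc l c)"
    using cc by (auto simp: cell_collar_def)
  let ?P = "prod_topology T C"
  have cr: "continuous_map (subtopology ?P S) euclideanreal (\<lambda>x. rad (snd x))"
    using continuous_map_from_subtopology[OF continuous_map_compose[OF continuous_map_snd rad]] by (simp add: o_def)
  have "continuous_map (subtopology ?P S) euclideanreal (\<lambda>x. 1 / rad (snd x))"
    by (intro continuous_map_real_divide cr) (use a0 in force)+
  then have "continuous_map (subtopology ?P S)
     (subtopology (prod_topology euclideanreal C) {(l, c). 0 \<le> l \<and> l * rad c \<le> 1}) (\<lambda>x. (1 / rad (snd x), snd x))"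
    unfolding continuous_map_in_subtopology
    using a0 by (auto intro!: continuous_map_pairedI continuous_map_from_subtopology[OF continuous_map_snd] simp: less_imp_le dest: order.strict_implies_not_eq)
  from continuous_map_compose[OF this sc]
  have c: "continuous_map (subtopology ?P S) C (\<lambda>x. sc (1 / rad (snd x)) (snd x))" by (simp add: o_def)
  have "sc (1 / rad c) c \<in> B" if "(t, c) \<in> S" "t \<in> topspace T" "c \<in> topspace C" for t c
  proof -
    have "sc (1 / rad c) c \<in> topspace C"
      using continuous_map_mem[OF c, of "(t, c)"] that by auto
    moreover have "rad (sc (1 / rad c) c) = 1"
      using cc a0[OF that] that by (auto simp: cell_collar_def)
    ultimately show ?thesis using cc by (auto simp: cell_collar_def)
  qed
  then show ?thesis using c by (auto simp: continuous_map_in_subtopology)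
qed

section \<open>Homotopic attaching maps\<close>

text \<open>The inner half of a cell is stretched over the whole cell attached at time 1. The shell
  of radii from 1/2 to 1 traces the homotopy back, from time 1 at radius 1/2 to time 0 at radius
  1.\<close>

definition slide_map ::
    "('j \<Rightarrow> 'c \<Rightarrow> real) \<Rightarrow> ('j \<Rightarrow> real \<Rightarrow> 'c \<Rightarrow> 'c) \<Rightarrow> ('j \<Rightarrow> 'c set) \<Rightarrow> ('j \<Rightarrow> real \<times> 'c \<Rightarrow> 'y) \<Rightarrow>
      'y + 'j \<times> 'c \<Rightarrow> 'y + 'j \<times> 'c" where
  "slide_map rad sc B \<Phi> z = (case z of Inl y \<Rightarrow> Inl y | Inr (j, c) \<Rightarrow>
     if 2 * rad j c \<le> 1 then glue_map B (\<lambda>j c. \<Phi> j (1, c)) j (sc j 2 c)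
     else Inl (\<Phi> j (2 - 2 * rad j c, sc j (1 / rad j c) c)))"

context
  fixes Y :: "'y topology" and J :: "'j set" and C :: "'j \<Rightarrow> 'c topology" and B :: "'j \<Rightarrow> 'c set"
    and \<Phi> :: "'j \<Rightarrow> real \<times> 'c \<Rightarrow> 'y" and rad :: "'j \<Rightarrow> 'c \<Rightarrow> real" and sc
  assumes cc: "\<And>j. j \<in> J \<Longrightarrow> cell_collar (C j) (B j) (rad j) (sc j)"
    and \<Phi>: "\<And>j. j \<in> J \<Longrightarrow>
      continuous_map (prod_topology (top_of_set {0..1}) (subtopology (C j) (B j))) Y (\<Phi> j)"
begin

lemma slide_attaching: "t \<in> {0..1} \<Longrightarrow> j \<in> J \<Longrightarrow> (\<lambda>c. \<Phi> j (t, c)) \<in> topspace (C j) \<inter> B j \<rightarrow> topspace Y"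
  using continuous_map_mem[OF \<Phi>] by fastforce

text \<open>The continuity argument shared by the slide and by its homotopy. Beyond radius
  \<open>1 / a t\<close> the direction is kept and \<open>g\<close> selects the time of the
  homotopy; it has to start with \<open>u\<close>, the time of the attaching map, where that region
  begins.\<close>

lemma slide_collar:
  assumes j: "j \<in> J" and u: "u \<in> {0..1}"
    and a: "continuous_map T euclideanreal a" and a0: "\<And>t. t \<in> topspace T \<Longrightarrow> a t \<ge> 0"
    and g: "continuous_map (subtopology (prod_topology T (C j)) {(t, c). 1 \<le> a t * rad j c}) (top_of_set {0..1}) g"
    and g0: "\<And>t c. t \<in> topspace T \<Longrightarrow> c \<in> topspace (C j) \<Longrightarrow> a t * rad j c = 1 \<Longrightarrow> g (t, c) = u"
  shows "continuous_map (prod_topology T (C j)) (glued_space Y J C B (\<lambda>j c. \<Phi> j (u, c)))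
           (\<lambda>(t, c). if a t * rad j c \<le> 1 then glue_map B (\<lambda>j c. \<Phi> j (u, c)) j (sc j (a t) c)
              else Inl (\<Phi> j (g (t, c), sc j (1 / rad j c) c)))"
proof -
  let ?S = "{(t, c). 1 \<le> a t * rad j c}"
  let ?T = "subtopology (prod_topology T (C j)) ?S"
  have r0: "rad j c \<ge> 0" if "c \<in> topspace (C j)" for c
    using cc[OF j] that by (auto simp: cell_collar_def)
  have "continuous_map ?T (subtopology (C j) (B j)) (\<lambda>x. sc j (1 / rad j (snd x)) (snd x))"
  proof (rule continuous_map_collar_direction[OF cc[OF j]])
    fix t c assume "(t, c) \<in> ?S" "t \<in> topspace T" "c \<in> topspace (C j)"
    then show "rad j c > 0" using r0[of c] by (cases "rad j c = 0") auto
  qed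
  then have "continuous_map ?T (prod_topology (top_of_set {0..1}) (subtopology (C j) (B j)))
      (\<lambda>x. (g x, sc j (1 / rad j (snd x)) (snd x)))"
    using g by (intro continuous_map_pairedI)
  from continuous_map_compose[OF this \<Phi>[OF j]]
  have K: "continuous_map ?T Y (\<lambda>(t, c). \<Phi> j (g (t, c), sc j (1 / rad j c) c))"
    by (simp add: o_def split_beta')
  have eq: "(\<lambda>(t, c). \<Phi> j (g (t, c), sc j (1 / rad j c) c)) (t, c) = \<Phi> j (u, sc j (a t) c)"
    if "t \<in> topspace T" "c \<in> topspace (C j)" "a t * rad j c = 1" for t c
  proof -
    have "1 / rad j c = a t" using that by (metis divide_eq_eq mult_zero_right zero_neq_one)
    then show ?thesis using g0[OF that] by simp
  qed
  show ?thesis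
    using continuous_map_collar_glued[where \<phi>="\<lambda>j c. \<Phi> j (u, c)" and J=J, OF slide_attaching[OF u] j cc[OF j] a a0 K eq]
    unfolding case_prod_conv .
qed

text \<open>On the boundary of a cell, where the glued point lies in \<open>Y\<close>, the shell
  formula has time 0 and returns this very point.\<close>

lemma slide_map_glue_map:
  assumes "j \<in> J" "c \<in> topspace (C j)"
  shows "slide_map rad sc B \<Phi> (glue_map B (\<lambda>j c. \<Phi> j (0, c)) j c) =
    (if 2 * rad j c \<le> 1 then glue_map B (\<lambda>j c. \<Phi> j (1, c)) j (sc j 2 c)
     else Inl (\<Phi> j (2 - 2 * rad j c, sc j (1 / rad j c) c)))"
  using cc[OF assms(1)] assms(2) by (auto simp: slide_map_def glue_map_def cell_collar_def)

lemma continuous_map_rad_snd: "j \<in> J \<Longrightarrow> continuous_map (prod_topology T (C j)) euclideanreal (\<lambda>x. rad j (snd x))"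
  using continuous_map_compose[OF continuous_map_snd, of "C j" _ "rad j"] cc by (auto simp: o_def cell_collar_def)

lemma continuous_map_slide_map:
  "continuous_map (glued_space Y J C B (\<lambda>j c. \<Phi> j (0, c))) (glued_space Y J C B (\<lambda>j c. \<Phi> j (1, c)))
     (slide_map rad sc B \<Phi>)"
proof (rule continuous_map_from_glued_space[OF slide_attaching])
  have "continuous_map Y (glued_space Y J C B (\<lambda>j c. \<Phi> j (1, c))) Inl"
    by (intro continuous_map_Inl_glued_space slide_attaching) auto
  then show "continuous_map Y (glued_space Y J C B (\<lambda>j c. \<Phi> j (1, c))) (\<lambda>y. slide_map rad sc B \<Phi> (Inl y))"
    by (simp add: slide_map_def)
next
  fix j assume j: "j \<in> J"
  let ?T = "top_of_set {0..1::real}"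
  have 1: "continuous_map (C j) (prod_topology ?T (C j)) (\<lambda>c. (0, c))"
    by (intro continuous_map_pairedI) auto
  have 2: "continuous_map (prod_topology ?T (C j)) (glued_space Y J C B (\<lambda>j c. \<Phi> j (1, c)))
     (\<lambda>(t, c). if 2 * rad j c \<le> 1 then glue_map B (\<lambda>j c. \<Phi> j (1, c)) j (sc j 2 c)
              else Inl (\<Phi> j ((\<lambda>(t,c). 2 - 2 * rad j c) (t, c), sc j (1 / rad j c) c)))"
  proof (rule slide_collar[OF j, where a="\<lambda>_. 2"])
    show "continuous_map (subtopology (prod_topology ?T (C j)) {(t, c). 1 \<le> 2 * rad j c}) (top_of_set {0..1})
        (\<lambda>(t, c). 2 - 2 * rad j c)"
      unfolding continuous_map_in_subtopology split_beta
    proof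
      show "continuous_map (subtopology (prod_topology ?T (C j)) {x. 1 \<le> 2 * rad j (snd x)}) euclideanreal
        (\<lambda>x. 2 - 2 * rad j (snd x))"
        by (intro continuous_map_from_subtopology continuous_intros continuous_map_rad_snd j)
    qed (use cc[OF j] in \<open>auto simp: cell_collar_def\<close>)
  qed auto
  have "continuous_map (C j) (glued_space Y J C B (\<lambda>j c. \<Phi> j (1, c)))
     (\<lambda>c. if 2 * rad j c \<le> 1 then glue_map B (\<lambda>j c. \<Phi> j (1, c)) j (sc j 2 c)
              else Inl (\<Phi> j (2 - 2 * rad j c, sc j (1 / rad j c) c)))"
    using continuous_map_compose[OF 1 2] by (simp add: o_def cong: if_cong)
  then show "continuous_map (C j) (glued_space Y J C B (\<lambda>j c. \<Phi> j (1, c)))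
      (\<lambda>c. slide_map rad sc B \<Phi> (glue_map B (\<lambda>j c. \<Phi> j (0, c)) j c))"
    by (rule continuous_map_eq) (simp add: slide_map_glue_map[OF j])
qed auto

lemma homotopic_slide_map_back:
  defines "Z \<equiv> glued_space Y J C B (\<lambda>j c. \<Phi> j (0, c))"
  shows "homotopic_with (\<lambda>_. True) Z Z id (slide_map rad sc B (\<lambda>j (t, c). \<Phi> j (1 - t, c)) \<circ> slide_map rad sc B \<Phi>)"
proof -
  let ?I = "top_of_set {0..1::real}"
  \<comment> \<open>The composite stretches by 4 and then runs through the homotopy up to time 1 and
    back. Stretching by \<open>1 + 3 * t\<close> only, and following this path no further than the
    minimum allows, interpolates between the identity and the composite. At
    \<open>rad j c = 1\<close> the time is 0, as the gluing demands.\<close>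
  define R where "R = (\<lambda>(t, z). case z of Inl y \<Rightarrow> Inl y | Inr (j, c) \<Rightarrow>
     if (1 + 3 * t) * rad j c \<le> 1 then glue_map B (\<lambda>j c. \<Phi> j (0, c)) j (sc j (1 + 3 * t) c)
     else Inl (\<Phi> j (min ((1 + 3 * t) * rad j c - 1) (2 - 2 * rad j c), sc j (1 / rad j c) c)))"
  have Z: "topspace Z = glued_carrier Y J C B"
    unfolding Z_def by (intro topspace_glued_space slide_attaching) auto
  have R_glue: "R (t, glue_map B (\<lambda>j c. \<Phi> j (0, c)) j c) =
     (if (1 + 3 * t) * rad j c \<le> 1 then glue_map B (\<lambda>j c. \<Phi> j (0, c)) j (sc j (1 + 3 * t) c)
     else Inl (\<Phi> j (min ((1 + 3 * t) * rad j c - 1) (2 - 2 * rad j c), sc j (1 / rad j c) c)))"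
    if "j \<in> J" "c \<in> topspace (C j)" "t \<in> {0..1}" for t j c
    using cc[OF that(1)] that(2,3) by (auto simp: R_def glue_map_def cell_collar_def min_def)
  have "continuous_map (prod_topology ?I Z) Z R"
    unfolding Z_def
  proof (rule continuous_map_from_interval_glued_space[OF slide_attaching])
    have "continuous_map Y (glued_space Y J C B (\<lambda>j c. \<Phi> j (0, c))) Inl"
      by (intro continuous_map_Inl_glued_space slide_attaching) auto
    from continuous_map_compose[OF continuous_map_snd this]
    show "continuous_map (prod_topology ?I Y) (glued_space Y J C B (\<lambda>j c. \<Phi> j (0, c))) (\<lambda>(t, y). R (t, Inl y))"
      by (simp add: R_def o_def split_beta')
  next
    fix j assume j: "j \<in> J"
    let ?g = "\<lambda>(t, c). min ((1 + 3 * t) * rad j c - 1) (2 - 2 * rad j c)"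
    have "continuous_map (prod_topology ?I (C j)) (glued_space Y J C B (\<lambda>j c. \<Phi> j (0, c)))
     (\<lambda>(t, c). if (1 + 3 * t) * rad j c \<le> 1 then glue_map B (\<lambda>j c. \<Phi> j (0, c)) j (sc j (1 + 3 * t) c)
              else Inl (\<Phi> j (?g (t, c), sc j (1 / rad j c) c)))"
    proof (rule slide_collar[OF j])
      have "continuous_map (subtopology (prod_topology ?I (C j)) {x. 1 \<le> (1 + 3 * fst x) * rad j (snd x)}) euclideanreal
          (\<lambda>x. min ((1 + 3 * fst x) * rad j (snd x) - 1) (2 - 2 * rad j (snd x)))"
        by (intro continuous_map_from_subtopology continuous_intros continuous_map_rad_snd j
              continuous_map_fst[THEN continuous_map_into_fulltopology])
      moreover have "min ((1 + 3 * t) * rad j c - 1) (2 - 2 * rad j c) \<in> {0..1}"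
        if "t \<in> {0..1}" "c \<in> topspace (C j)" "1 \<le> (1 + 3 * t) * rad j c" for t c
      proof -
        have "0 \<le> rad j c" "rad j c \<le> 1" using cc[OF j] that by (auto simp: cell_collar_def)
        moreover have "(1 + 3 * t) * rad j c \<le> 4 * rad j c"
          using \<open>0 \<le> rad j c\<close> that by (intro mult_right_mono) auto
        ultimately show ?thesis using that by (auto simp: min_le_iff_disj)
      qed
      ultimately show "continuous_map (subtopology (prod_topology ?I (C j)) {(t, c). 1 \<le> (1 + 3 * t) * rad j c})
         (top_of_set {0..1}) ?g"
        unfolding continuous_map_in_subtopology split_beta by auto
      show "?g (t, c) = 0" if "t \<in> topspace ?I" "c \<in> topspace (C j)" "(1 + 3 * t) * rad j c = 1" for t c
        using cc[OF j] that by (auto simp: cell_collar_def)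
      show "continuous_map ?I euclideanreal (\<lambda>t. 1 + 3 * t)"
        by (auto intro!: continuous_intros)
    qed auto
    then show "continuous_map (prod_topology ?I (C j)) (glued_space Y J C B (\<lambda>j c. \<Phi> j (0, c)))
        (\<lambda>(t, c). R (t, glue_map B (\<lambda>j c. \<Phi> j (0, c)) j c))"
      by (rule continuous_map_eq) (auto simp: R_glue[OF j])
  qed auto
  moreover have "R (0, z) = z" if z: "z \<in> topspace Z" for z
  proof (cases z)
    case (Inr w)
    then obtain j c where w: "w = (j, c)" "j \<in> J" "c \<in> topspace (C j)" "c \<notin> B j"
      using z by (auto simp: Z glued_carrier_def)
    then show ?thesis
      using Inr cc[OF w(2)] by (auto simp: R_def glue_map_def cell_collar_def)
  qed (simp add: R_def)
  moreover have "R (1, z) = (slide_map rad sc B (\<lambda>j (t, c). \<Phi> j (1 - t, c)) \<circ> slide_map rad sc B \<Phi>) z"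
    if z: "z \<in> topspace Z" for z
  proof (cases z)
    case (Inr w)
    then obtain j c where w: "w = (j, c)" "j \<in> J" "c \<in> topspace (C j)" "c \<notin> B j"
      using z by (auto simp: Z glued_carrier_def)
    show ?thesis
    proof (cases "2 * rad j c \<le> 1")
      case True
      have r2: "rad j (sc j 2 c) = 2 * rad j c" and s2: "\<And>m. sc j m (sc j 2 c) = sc j (m * 2) c"
        using cc[OF w(2)] w(3) True by (auto simp: cell_collar_def)
      have cont: "continuous_map (subtopology (prod_topology euclideanreal (C j)) {(l, c). 0 \<le> l \<and> l * rad j c \<le> 1}) (C j) (\<lambda>(l, c). sc j l c)"
        using cc[OF w(2)] by (auto simp: cell_collar_def)
      have in2: "sc j 2 c \<in> topspace (C j)"
        using continuous_map_mem[OF cont, of "(2, c)"] True w by simp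
      have B2: "sc j 2 c \<in> B j \<longleftrightarrow> 2 * rad j c = 1"
        using cc[OF w(2)] in2 r2 by (auto simp: cell_collar_def)
      show ?thesis
      \<comment> \<open>At radius exactly 1/2 the stretched point lies on the boundary and is
        already glued to \<open>Y\<close>, so the second slide leaves it alone.\<close>
      proof (cases "2 * rad j c = 1")
        case e: True
        then have "rad j c = 1/2" by simp
        then have "1 / rad j c = 2" by (simp only:) simp
        then have "sc j (1 / rad j c) c = sc j 2 c" by (simp only:)
        moreover have "\<Phi> j (4 * rad j c - 1, x) = \<Phi> j (1, x)" for x
          using \<open>rad j c = 1/2\<close> by (simp only:) simp
        ultimately show ?thesis using Inr w B2 e by (simp add: R_def slide_map_def glue_map_def)
      next
        case False
        then show ?thesis
          using Inr w B2 True r2 s2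
          by (auto simp: R_def slide_map_def glue_map_def min_def)
      qed
    next
      case False
      then show ?thesis using Inr w by (auto simp: R_def slide_map_def min_def)
    qed
  qed (simp add: R_def slide_map_def)
  ultimately show ?thesis
    by (subst homotopic_with) auto
qed

end

lemma glued_space_homotopic_attaching:
  fixes \<Phi> :: "'j \<Rightarrow> real \<times> 'c \<Rightarrow> 'y"
  assumes cell: "\<And>j. j \<in> J \<Longrightarrow> closed_cell d (C j) (B j)"
    and \<Phi>: "\<And>j. j \<in> J \<Longrightarrow>
      continuous_map (prod_topology (top_of_set {0..1}) (subtopology (C j) (B j))) Y (\<Phi> j)"
  shows "glued_space Y J C B (\<lambda>j c. \<Phi> j (0, c)) homotopy_equivalent_space
         glued_space Y J C B (\<lambda>j c. \<Phi> j (1, c))"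
proof -
  have "\<exists>rad sc. cell_collar (C j) (B j) rad sc" if "j \<in> J" for j
    using closed_cell_collar[OF cell[OF that]] by blast
  then obtain rad sc where cc: "\<And>j. j \<in> J \<Longrightarrow> cell_collar (C j) (B j) (rad j) (sc j)"
    by metis
  let ?\<Psi> = "\<lambda>j (t, c). \<Phi> j (1 - t, c)"
  have \<Psi>: "continuous_map (prod_topology (top_of_set {0..1}) (subtopology (C j) (B j))) Y (?\<Psi> j)"
    if j: "j \<in> J" for j
  proof -
    let ?P = "prod_topology (top_of_set {0..1::real}) (subtopology (C j) (B j))"
    have "continuous_map ?P ?P (\<lambda>x. (1 - fst x, snd x))"
      by (intro continuous_map_pairedI continuous_map_snd)
        (auto simp: continuous_map_in_subtopology intro!: continuous_intros continuous_map_fst[THEN continuous_map_into_fulltopology])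
    from continuous_map_compose[OF this \<Phi>[OF j]] show ?thesis by (simp add: o_def split_beta')
  qed
  \<comment> \<open>Reversing the homotopy twice gives it back, so the second composite is an
    instance of the first.\<close>
  have rev: "(\<lambda>j (t, c). ?\<Psi> j (1 - t, c)) = \<Phi>" by (auto simp: fun_eq_iff)
  show ?thesis
    unfolding homotopy_equivalent_space_def
  proof (intro exI conjI)
    show "continuous_map (glued_space Y J C B (\<lambda>j c. \<Phi> j (0, c))) (glued_space Y J C B (\<lambda>j c. \<Phi> j (1, c)))
      (slide_map rad sc B \<Phi>)"
      by (rule continuous_map_slide_map[OF cc \<Phi>])
    show "continuous_map (glued_space Y J C B (\<lambda>j c. \<Phi> j (1, c))) (glued_space Y J C B (\<lambda>j c. \<Phi> j (0, c)))
      (slide_map rad sc B ?\<Psi>)"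
      using continuous_map_slide_map[OF cc \<Psi>] by simp
    show "homotopic_with (\<lambda>_. True) (glued_space Y J C B (\<lambda>j c. \<Phi> j (0, c)))
       (glued_space Y J C B (\<lambda>j c. \<Phi> j (0, c))) (slide_map rad sc B ?\<Psi> \<circ> slide_map rad sc B \<Phi>) id"
      by (rule homotopic_with_symD[OF homotopic_slide_map_back[where J=J, OF cc \<Phi>]])
    show "homotopic_with (\<lambda>_. True) (glued_space Y J C B (\<lambda>j c. \<Phi> j (1, c)))
       (glued_space Y J C B (\<lambda>j c. \<Phi> j (1, c))) (slide_map rad sc B \<Phi> \<circ> slide_map rad sc B ?\<Psi>) id"
      using homotopic_with_symD[OF homotopic_slide_map_back[where J=J, OF cc \<Psi>]] unfolding rev by simp
  qed
qed

section \<open>Deforming the base of a gluing\<close>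

lemma glued_space_cong:
  assumes "\<And>j c. j \<in> J \<Longrightarrow> c \<in> topspace (C j) \<inter> B j \<Longrightarrow> \<phi> j c = \<psi> j c"
  shows "glued_space Y J C B \<phi> = glued_space Y J C B \<psi>"
  unfolding topology_eq
proof
  fix U
  have "{c \<in> topspace (C j). glue_map B \<phi> j c \<in> U} = {c \<in> topspace (C j). glue_map B \<psi> j c \<in> U}"
    if "j \<in> J" for j using assms[OF that] by (auto simp: glue_map_def)
  then show "openin (glued_space Y J C B \<phi>) U = openin (glued_space Y J C B \<psi>) U"
    by (simp add: openin_glued_space)
qed

text \<open>An open set of the smaller gluing is enlarged by everything of \<open>Y\<close> outside
  \<open>A\<close>. The result is open because \<open>A\<close> is closed, and the cells do not
  notice the enlargement because they are attached inside \<open>A\<close>.\<close>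

lemma glued_space_subtopology:
  assumes A: "closedin Y A" and \<phi>: "\<And>j. j \<in> J \<Longrightarrow> \<phi> j \<in> topspace (C j) \<inter> B j \<rightarrow> A"
  shows "glued_space (subtopology Y A) J C B \<phi> =
         subtopology (glued_space Y J C B \<phi>) (glued_carrier (subtopology Y A) J C B)"
  unfolding topology_eq
proof (intro allI iffI)
  let ?Z = "glued_space Y J C B \<phi>" and ?cA = "glued_carrier (subtopology Y A) J C B"
  have AY: "A \<subseteq> topspace Y" using A closedin_subset by auto
  then have \<phi>Y: "\<And>j. j \<in> J \<Longrightarrow> \<phi> j \<in> topspace (C j) \<inter> B j \<rightarrow> topspace Y" using \<phi> by blast
  have Z: "topspace ?Z = glued_carrier Y J C B" by (rule topspace_glued_space) (rule \<phi>Y)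
  have cA: "?cA \<subseteq> glued_carrier Y J C B" using AY by (auto simp: glued_carrier_def)
  have g: "glue_map B \<phi> j c \<in> ?cA" if "j \<in> J" "c \<in> topspace (C j)" for j c
    using \<phi>[OF that(1)] that AY by (auto simp: glue_map_def glued_carrier_def)
  have Inl: "Inl y \<in> ?cA \<longleftrightarrow> y \<in> A" for y using AY by (auto simp: glued_carrier_def)
  fix U
  {
    assume U: "openin (glued_space (subtopology Y A) J C B \<phi>) U"
    then have UA: "U \<subseteq> ?cA" and U1: "openin (subtopology Y A) {y \<in> A. Inl y \<in> U}"
      and U2: "\<And>j. j \<in> J \<Longrightarrow> openin (C j) {c \<in> topspace (C j). glue_map B \<phi> j c \<in> U}"
      using AY by (auto simp: openin_glued_space Int_absorb1 topspace_subtopology_subset)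
    define V where "V = glued_carrier Y J C B - (?cA - U)"
    have "closedin Y (A - {y \<in> A. Inl y \<in> U})"
      using U1 A AY closedin_trans_full[of Y A] closedin_diff openin_closedin_eq
      by (metis topspace_subtopology_subset)
    then have "openin Y (topspace Y - (A - {y \<in> A. Inl y \<in> U}))" by blast
    moreover have "topspace Y - (A - {y \<in> A. Inl y \<in> U}) = {y \<in> topspace Y. Inl y \<in> V}"
      using AY UA Inl by (auto simp: V_def glued_carrier_def)
    moreover have "{c \<in> topspace (C j). glue_map B \<phi> j c \<in> V} = {c \<in> topspace (C j). glue_map B \<phi> j c \<in> U}"
      if "j \<in> J" for j
      using g[OF that] UA cA by (auto simp: V_def)
    ultimately have "openin ?Z V" using U2 by (auto simp: openin_glued_space V_def)
    moreover have "U = V \<inter> ?cA" using UA cA by (auto simp: V_def)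
    ultimately show "openin (subtopology ?Z ?cA) U" by (auto simp: openin_subtopology)
  }
  {
    assume "openin (subtopology ?Z ?cA) U"
    then obtain V where V: "openin ?Z V" "U = V \<inter> ?cA" by (auto simp: openin_subtopology)
    have "{y \<in> topspace (subtopology Y A). Inl y \<in> U} = {y \<in> topspace Y. Inl y \<in> V} \<inter> A"
      using V Inl by auto
    then have "openin (subtopology Y A) {y \<in> topspace (subtopology Y A). Inl y \<in> U}"
      using V by (auto simp: openin_glued_space openin_subtopology)
    moreover have "{c \<in> topspace (C j). glue_map B \<phi> j c \<in> V} = {c \<in> topspace (C j). glue_map B \<phi> j c \<in> U}"
      if "j \<in> J" for j
      using g[OF that] V by auto
    ultimately show "openin (glued_space (subtopology Y A) J C B \<phi>) U"
      using V by (auto simp: openin_glued_space)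
  }
qed

text \<open>The deformation of the base extends over the cells, whose collars absorb its
  motion.\<close>

lemma glued_space_weak_deformation:
  fixes H :: "real \<times> 'y \<Rightarrow> 'y" and \<phi> :: "'j \<Rightarrow> 'c \<Rightarrow> 'y"
  assumes cell: "\<And>j. j \<in> J \<Longrightarrow> closed_cell d (C j) (B j)"
    and wd: "weak_deformation Y A H" and A: "closedin Y A"
    and \<phi>: "\<And>j. j \<in> J \<Longrightarrow> continuous_map (subtopology (C j) (B j)) (subtopology Y A) (\<phi> j)"
  shows "glued_space (subtopology Y A) J C B \<phi> homotopy_equivalent_space glued_space Y J C B \<phi>"
proof -
  let ?I = "top_of_set {0..1::real}"
  define Z where "Z = glued_space Y J C B \<phi>"
  have "\<exists>rad sc. cell_collar (C j) (B j) rad sc" if "j \<in> J" for j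
    using closed_cell_collar[OF cell[OF that]] by blast
  then obtain rad sc where cc: "\<And>j. j \<in> J \<Longrightarrow> cell_collar (C j) (B j) (rad j) (sc j)"
    by metis
  have AY: "A \<subseteq> topspace Y" using A closedin_subset by auto
  have \<phi>A: "\<phi> j \<in> topspace (C j) \<inter> B j \<rightarrow> A" if "j \<in> J" for j
    using continuous_map_mem[OF \<phi>[OF that]] by auto
  then have \<phi>Y: "\<phi> j \<in> topspace (C j) \<inter> B j \<rightarrow> topspace Y" if "j \<in> J" for j
    using that AY by blast
  have \<phi>c: "continuous_map (subtopology (C j) (B j)) Y (\<phi> j)" if "j \<in> J" for j
    using \<phi>[OF that] continuous_map_in_subtopology by blast
  have H: "continuous_map (prod_topology ?I Y) Y H"
    and H0: "\<And>x. x \<in> topspace Y \<Longrightarrow> H (0, x) = x"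
    and H1: "\<And>x. x \<in> topspace Y \<Longrightarrow> H (1, x) \<in> A"
    and HA: "\<And>t x. t \<in> {0..1} \<Longrightarrow> x \<in> A \<Longrightarrow> H (t, x) \<in> A"
    using wd by (auto simp: weak_deformation_def)
  \<comment> \<open>Each cell is stretched by \<open>1 + t\<close>, and the shell pushed out of it
    lands on the track of its attaching point under \<open>H\<close>: time 0 where the shell begins,
    time \<open>t\<close> at the boundary of the cell, where it has to match \<open>H\<close> on
    \<open>Y\<close>.\<close>
  define R where "R = (\<lambda>(t, z). case z of Inl y \<Rightarrow> Inl (H (t, y)) | Inr (j, c) \<Rightarrow>
     if (1 + t) * rad j c \<le> 1 then glue_map B \<phi> j (sc j (1 + t) c)
     else Inl (H ((1 + t) * rad j c - 1, \<phi> j (sc j (1 / rad j c) c))))"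
  have R_glue: "R (t, glue_map B \<phi> j c) =
     (if (1 + t) * rad j c \<le> 1 then glue_map B \<phi> j (sc j (1 + t) c)
     else Inl (H ((1 + t) * rad j c - 1, \<phi> j (sc j (1 / rad j c) c))))"
    if j: "j \<in> J" and c: "c \<in> topspace (C j)" and t: "t \<in> {0..1}" for t j c
  proof (cases "c \<in> B j")
    case True
    then have "rad j c = 1" "sc j 1 c = c" "\<phi> j c \<in> topspace Y"
      using cc[OF j] c \<phi>Y[OF j] by (auto simp: cell_collar_def)
    then show ?thesis using True t H0 by (cases "t = 0") (auto simp: R_def glue_map_def)
  qed (simp add: R_def glue_map_def)
  have Z: "topspace Z = glued_carrier Y J C B" unfolding Z_def by (rule topspace_glued_space) (rule \<phi>Y)
  have dir: "sc j (1 / rad j c) c \<in> topspace (C j) \<inter> B j" and scin: "\<And>l. 0 \<le> l \<Longrightarrow> l * rad j c \<le> 1 \<Longrightarrow> sc j l c \<in> topspace (C j)"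
    if "j \<in> J" "c \<in> topspace (C j)" "rad j c > 0" for j c
  proof -
    have cont: "continuous_map (subtopology (prod_topology euclideanreal (C j)) {(l, c). 0 \<le> l \<and> l * rad j c \<le> 1}) (C j) (\<lambda>(l, c). sc j l c)"
      using cc[OF that(1)] by (auto simp: cell_collar_def)
    show 1: "\<And>l. 0 \<le> l \<Longrightarrow> l * rad j c \<le> 1 \<Longrightarrow> sc j l c \<in> topspace (C j)"
      using continuous_map_mem[OF cont] that by fastforce
    have "sc j (1 / rad j c) c \<in> topspace (C j)" using 1[of "1 / rad j c"] that by simp
    moreover have "rad j (sc j (1 / rad j c) c) = 1"
      using cc[OF that(1)] that by (auto simp: cell_collar_def)
    ultimately show "sc j (1 / rad j c) c \<in> topspace (C j) \<inter> B j"
      using cc[OF that(1)] by (auto simp: cell_collar_def)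
  qed
  have "continuous_map (prod_topology ?I Z) Z R"
    unfolding Z_def
  proof (rule continuous_map_from_interval_glued_space[OF \<phi>Y])
    have "continuous_map Y (glued_space Y J C B \<phi>) Inl"
      by (intro continuous_map_Inl_glued_space \<phi>Y)
    from continuous_map_compose[OF H this]
    show "continuous_map (prod_topology ?I Y) (glued_space Y J C B \<phi>) (\<lambda>(t, y). R (t, Inl y))"
      by (simp add: R_def o_def split_beta')
  next
    fix j assume j: "j \<in> J"
    let ?P = "prod_topology ?I (C j)"
    let ?S = "{(t, c). 1 \<le> (1 + t) * rad j c}"
    have r0: "rad j c > 0" if "(t, c) \<in> ?S" "t \<in> topspace ?I" "c \<in> topspace (C j)" for t c
      using cc[OF j] that by (cases "rad j c = 0") (auto simp: cell_collar_def dual_order.order_iff_strict)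
    have d: "continuous_map (subtopology ?P ?S) (subtopology (C j) (B j)) (\<lambda>x. sc j (1 / rad j (snd x)) (snd x))"
      by (rule continuous_map_collar_direction[OF cc[OF j] r0])
    have rc: "continuous_map ?P euclideanreal (\<lambda>x. rad j (snd x))"
      using continuous_map_compose[OF continuous_map_snd, of "C j" _ "rad j"] cc[OF j] by (auto simp: o_def cell_collar_def)
    have "continuous_map (subtopology ?P ?S) euclideanreal (\<lambda>x. (1 + fst x) * rad j (snd x) - 1)"
      by (intro continuous_map_from_subtopology continuous_intros rc
              continuous_map_fst[THEN continuous_map_into_fulltopology])
    moreover have "(1 + t) * rad j c - 1 \<in> {0..1}" if "(t, c) \<in> ?S" "t \<in> topspace ?I" "c \<in> topspace (C j)" for t c
    proof -
      have "(1 + t) * rad j c \<le> 2 * 1"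
        using cc[OF j] that by (intro mult_mono) (auto simp: cell_collar_def)
      then show ?thesis using that by auto
    qed
    ultimately have g: "continuous_map (subtopology ?P ?S) ?I (\<lambda>x. (1 + fst x) * rad j (snd x) - 1)"
      by (auto simp: continuous_map_in_subtopology)
    have "continuous_map (subtopology ?P ?S) Y (\<lambda>x. \<phi> j (sc j (1 / rad j (snd x)) (snd x)))"
      using continuous_map_compose[OF d \<phi>c[OF j]] by (simp add: o_def)
    from continuous_map_compose[OF continuous_map_pairedI[OF g this] H]
    have K: "continuous_map (subtopology ?P ?S) Y
      (\<lambda>(t, c). H ((1 + t) * rad j c - 1, \<phi> j (sc j (1 / rad j c) c)))"
      by (simp add: o_def split_beta')
    have "continuous_map ?P (glued_space Y J C B \<phi>)
     (\<lambda>(t, c). if (1 + t) * rad j c \<le> 1 then glue_map B \<phi> j (sc j (1 + t) c)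
              else Inl ((\<lambda>(t, c). H ((1 + t) * rad j c - 1, \<phi> j (sc j (1 / rad j c) c))) (t, c)))"
    proof (rule continuous_map_collar_glued[where J=J and \<phi>=\<phi> and C=C and B=B and Y=Y and j=j and a="\<lambda>t. 1 + t", OF \<phi>Y j cc[OF j] _ _ K])
      show "continuous_map ?I euclideanreal (\<lambda>t. 1 + t)" by (auto intro!: continuous_intros)
      fix t c assume tc: "t \<in> topspace ?I" "c \<in> topspace (C j)" "(1 + t) * rad j c = 1"
      then have "1 / rad j c = 1 + t" by (metis divide_eq_eq mult_zero_right zero_neq_one)
      moreover have "rad j c > 0" using r0[of t c] tc by auto
      ultimately have "\<phi> j (sc j (1 + t) c) \<in> topspace Y" using dir[OF j tc(2)] \<phi>Y[OF j] by auto
      then show "(\<lambda>(t, c). H ((1 + t) * rad j c - 1, \<phi> j (sc j (1 / rad j c) c))) (t, c) = \<phi> j (sc j (1 + t) c)"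
        using H0 tc(3) \<open>1 / rad j c = 1 + t\<close> by simp
    qed auto
    then show "continuous_map ?P (glued_space Y J C B \<phi>) (\<lambda>(t, c). R (t, glue_map B \<phi> j c))"
      by (rule continuous_map_eq) (auto simp: R_glue[OF j])
  qed
  moreover have R0: "R (0, z) = z" if z: "z \<in> topspace Z" for z
  proof (cases z)
    case (Inr w)
    then obtain j c where w: "w = (j, c)" "j \<in> J" "c \<in> topspace (C j)" "c \<notin> B j"
      using z by (auto simp: Z glued_carrier_def)
    then show ?thesis
      using Inr cc[OF w(2)] by (auto simp: R_def glue_map_def cell_collar_def)
  qed (use z H0 in \<open>auto simp: R_def Z glued_carrier_def\<close>)
  moreover have RA: "R (t, z) \<in> glued_carrier (subtopology Y A) J C B"
    if z: "z \<in> topspace Z" and t: "t \<in> {0..1}" and disj: "t = 1 \<or> z \<in> glued_carrier (subtopology Y A) J C B" for t z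
  proof (cases z)
    case (Inl y)
    then have "H (t, y) \<in> A" using H1 HA t disj z by (auto simp: Z glued_carrier_def)
    then show ?thesis using Inl AY by (auto simp: R_def glued_carrier_def)
  next
    case (Inr w)
    then obtain j c where w: "w = (j, c)" "j \<in> J" "c \<in> topspace (C j)" "c \<notin> B j"
      using z by (auto simp: Z glued_carrier_def)
    have rad: "0 \<le> rad j c" "rad j c \<le> 1" using cc[OF w(2)] w(3) by (auto simp: cell_collar_def)
    show ?thesis
    proof (cases "(1 + t) * rad j c \<le> 1")
      case True
      have "sc j (1 + t) c \<in> topspace (C j)"
      proof -
        have cont: "continuous_map (subtopology (prod_topology euclideanreal (C j)) {(l, c). 0 \<le> l \<and> l * rad j c \<le> 1}) (C j) (\<lambda>(l, c). sc j l c)"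
          using cc[OF w(2)] by (auto simp: cell_collar_def)
        show ?thesis using continuous_map_mem[OF cont, of "(1 + t, c)"] True w t by simp
      qed
      then show ?thesis using Inr w True \<phi>A[OF w(2)] AY
        by (auto simp: R_def glued_carrier_def glue_map_def)
    next
      case False
      then have "rad j c > 0" using rad by (cases "rad j c = 0") auto
      then have "\<phi> j (sc j (1 / rad j c) c) \<in> A" using dir[OF w(2,3)] \<phi>A[OF w(2)] by blast
      moreover have "(1 + t) * rad j c \<le> 2 * 1" using rad t by (intro mult_mono) auto
      ultimately have "H ((1 + t) * rad j c - 1, \<phi> j (sc j (1 / rad j c) c)) \<in> A"
        using False by (intro HA) auto
      then show ?thesis using Inr w False AY by (auto simp: R_def glued_carrier_def)
    qed
  qed
  moreover have "glued_carrier (subtopology Y A) J C B \<subseteq> topspace Z"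
    using AY by (auto simp: Z glued_carrier_def)
  ultimately have "weak_deformation Z (glued_carrier (subtopology Y A) J C B) R"
    by (auto simp: weak_deformation_def)
  from homotopy_equivalent_weak_deformation[OF this]
  show ?thesis unfolding Z_def
    using glued_space_subtopology[OF A, of J \<phi> C B] \<phi>A by metis
qed

text \<open>\<open>H\<close> moves the attaching maps homotopically into \<open>A\<close>, after
  which the base can shrink to \<open>A\<close>. The second conclusion restores the hypothesis on
  the attaching maps, so that the step can be repeated.\<close>

lemma glued_space_push:
  fixes H :: "real \<times> 'y \<Rightarrow> 'y" and \<phi> :: "'j \<Rightarrow> 'c \<Rightarrow> 'y"
  assumes cell: "\<And>j. j \<in> J \<Longrightarrow> closed_cell d (C j) (B j)"
    and wd: "weak_deformation Y A H" and A: "closedin Y A"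
    and \<phi>: "\<And>j. j \<in> J \<Longrightarrow> continuous_map (subtopology (C j) (B j)) Y (\<phi> j)"
  shows "glued_space Y J C B \<phi> homotopy_equivalent_space
         glued_space (subtopology Y A) J C B (\<lambda>j c. H (1, \<phi> j c))"
    and "\<And>j. j \<in> J \<Longrightarrow> continuous_map (subtopology (C j) (B j)) (subtopology Y A) (\<lambda>c. H (1, \<phi> j c))"
proof -
  let ?I = "top_of_set {0..1::real}"
  have H: "continuous_map (prod_topology ?I Y) Y H"
    and H0: "\<And>x. x \<in> topspace Y \<Longrightarrow> H (0, x) = x"
    and H1: "\<And>x. x \<in> topspace Y \<Longrightarrow> H (1, x) \<in> A"
    using wd by (auto simp: weak_deformation_def)
  have \<Phi>: "continuous_map (prod_topology ?I (subtopology (C j) (B j))) Y (\<lambda>(t, c). H (t, \<phi> j c))" if j: "j \<in> J" for j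
    using continuous_map_compose[OF continuous_map_pairedI[OF continuous_map_fst
       continuous_map_compose[OF continuous_map_snd \<phi>[OF j]]] H]
    by (simp add: o_def split_beta')
  show 1: "continuous_map (subtopology (C j) (B j)) (subtopology Y A) (\<lambda>c. H (1, \<phi> j c))" if j: "j \<in> J" for j
  proof -
    have "continuous_map (subtopology (C j) (B j)) ?I (\<lambda>_. 1)" by auto
    from continuous_map_compose[OF continuous_map_pairedI[OF this \<phi>[OF j]] H]
    show ?thesis using H1 continuous_map_mem[OF \<phi>[OF j]]
      by (auto simp: o_def continuous_map_in_subtopology)
  qed
  have "glued_space Y J C B \<phi> = glued_space Y J C B (\<lambda>j c. H (0, \<phi> j c))"
    by (rule glued_space_cong) (use H0 continuous_map_mem[OF \<phi>] in force)
  also have "\<dots> homotopy_equivalent_space glued_space Y J C B (\<lambda>j c. H (1, \<phi> j c))"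
    using glued_space_homotopic_attaching[where \<Phi>="\<lambda>j (t, c). H (t, \<phi> j c)" and J=J and C=C and B=B, OF cell \<Phi>]
    by simp
  also have "\<dots> homotopy_equivalent_space glued_space (subtopology Y A) J C B (\<lambda>j c. H (1, \<phi> j c))"
    using glued_space_weak_deformation[where J=J and C=C and B=B, OF cell wd A 1] homotopy_equivalent_space_sym by blast
  finally show "glued_space Y J C B \<phi> homotopy_equivalent_space
         glued_space (subtopology Y A) J C B (\<lambda>j c. H (1, \<phi> j c))" .
qed

section \<open>Simplex times cube\<close>

text \<open>The gauge of a bounded body that is star-shaped about 0, described by its properties.
  Vectors of dimension \<open>d\<close> are sequences that vanish from \<open>d\<close> on, as in
  \<open>Euclidean_space\<close>.\<close>

definition gauge_on :: "nat \<Rightarrow> real \<Rightarrow> ((nat \<Rightarrow> real) \<Rightarrow> real) \<Rightarrow> bool" where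
  "gauge_on d \<kappa> g \<longleftrightarrow> \<kappa> > 0 \<and> continuous_on {y. \<forall>i\<ge>d. y i = 0} g \<and>
     (\<forall>y l. (\<forall>i\<ge>d. y i = 0) \<longrightarrow> l \<ge> 0 \<longrightarrow> g (\<lambda>i. l * y i) = l * g y) \<and>
     (\<forall>y i. (\<forall>i\<ge>d. y i = 0) \<longrightarrow> \<kappa> * \<bar>y i\<bar> \<le> g y)"

text \<open>On each ray this rescales so that \<open>h\<close> of the image equals \<open>g\<close>
  of the argument, which carries the unit body of \<open>g\<close> to that of \<open>h\<close>. At 0
  the division by zero yields 0, the right value.\<close>

definition radial_map :: "((nat \<Rightarrow> real) \<Rightarrow> real) \<Rightarrow> ((nat \<Rightarrow> real) \<Rightarrow> real) \<Rightarrow> (nat \<Rightarrow> real) \<Rightarrow> nat \<Rightarrow> real" where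
  "radial_map g h y = (\<lambda>i. g y / h y * y i)"

lemma Euclidean_space_eq_top_of_set: "Euclidean_space d = top_of_set {y. \<forall>i\<ge>d. y i = 0}"
  unfolding Euclidean_space_def euclidean_product_topology ..

lemma gauge_onD:
  assumes "gauge_on d \<kappa> g"
  shows "\<kappa> > 0" "continuous_on {y. \<forall>i\<ge>d. y i = 0} g"
    and gauge_on_scale: "\<forall>i\<ge>d. y i = 0 \<Longrightarrow> l \<ge> 0 \<Longrightarrow> g (\<lambda>i. l * y i) = l * g y"
    and gauge_on_bound: "\<forall>i\<ge>d. y i = 0 \<Longrightarrow> \<kappa> * \<bar>y i\<bar> \<le> g y"
proof -
  note * = assms[unfolded gauge_on_def, THEN conjunct2, THEN conjunct2]
  show "\<kappa> > 0" "continuous_on {y. \<forall>i\<ge>d. y i = 0} g"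
    by (rule assms[unfolded gauge_on_def, THEN conjunct1],
        rule assms[unfolded gauge_on_def, THEN conjunct2, THEN conjunct1])
  show "g (\<lambda>i. l * y i) = l * g y" if "\<forall>i\<ge>d. y i = 0" "l \<ge> 0"
    by (rule *[THEN conjunct1, THEN spec, THEN spec, THEN mp, THEN mp, OF that])
  show "\<kappa> * \<bar>y i\<bar> \<le> g y" if "\<forall>i\<ge>d. y i = 0"
    by (rule *[THEN conjunct2, THEN spec, THEN spec, THEN mp, OF that])
qed

lemma gauge_on_nonneg: "0 \<le> g y" if g: "gauge_on d \<kappa> g" and y: "\<forall>i\<ge>d. y i = 0"
proof -
  have "0 \<le> \<kappa> * \<bar>y 0\<bar>" using gauge_onD(1)[OF g] by simp
  also have "\<dots> \<le> g y" using gauge_on_bound[OF g y] .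
  finally show ?thesis .
qed

lemma gauge_on_eq_0: "gauge_on d \<kappa> g \<Longrightarrow> \<forall>i\<ge>d. y i = 0 \<Longrightarrow> g y = 0 \<longleftrightarrow> y = (\<lambda>_. 0)"
proof
  assume g: "gauge_on d \<kappa> g" and y: "\<forall>i\<ge>d. y i = 0" and "g y = 0"
  then have "\<kappa> * \<bar>y i\<bar> \<le> 0" "\<kappa> > 0" for i using gauge_on_bound[OF g y, of i] gauge_onD(1)[OF g] by simp_all
  then show "y = (\<lambda>_. 0)" by (auto simp: fun_eq_iff mult_le_0_iff)
next
  assume g: "gauge_on d \<kappa> g" and "\<forall>i\<ge>d. y i = 0" and y: "y = (\<lambda>_. 0)"
  have "g (\<lambda>i. 0 * y i) = 0 * g y"
    using gauge_on_scale[OF g, of y 0] y by simp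
  then show "g y = 0" using y by simp
qed

text \<open>The critical point is the origin: the lower bound on \<open>h\<close> bounds the
  component \<open>i\<close> by \<open>g z / \<eta>\<close>, which tends to 0 there.\<close>

lemma continuous_on_radial_map:
  assumes g: "gauge_on d \<kappa> g" and h: "gauge_on d \<eta> h"
  shows "continuous_on {y. \<forall>i\<ge>d. y i = 0} (radial_map g h)"
proof (rule continuous_on_coordinatewise_then_product)
  let ?S = "{y :: nat \<Rightarrow> real. \<forall>i\<ge>d. y i = 0}"
  fix i
  have cg: "continuous_on ?S g" and ch: "continuous_on ?S h" using gauge_onD(2)[OF g] gauge_onD(2)[OF h] .
  have ci: "continuous_on ?S (\<lambda>y. y i)"
    by (rule continuous_on_product_then_coordinatewise[OF continuous_on_id])
  show "continuous_on ?S (\<lambda>y. radial_map g h y i)"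
    unfolding continuous_on_def
  proof
    fix y assume y: "y \<in> ?S"
    show "((\<lambda>y. radial_map g h y i) \<longlongrightarrow> radial_map g h y i) (at y within ?S)"
    proof (cases "y = (\<lambda>_. 0)")
      case False
      then have "h y \<noteq> 0" using gauge_on_eq_0[OF h] y by auto
      then show ?thesis unfolding radial_map_def
        using cg ch ci y unfolding continuous_on_def by (intro tendsto_intros) auto
    next
      case True
      have "(g \<longlongrightarrow> g y) (at y within ?S)" using cg y by (auto simp: continuous_on_def)
      then have lim: "((\<lambda>y. g y / \<eta>) \<longlongrightarrow> 0) (at y within ?S)"
        using gauge_on_eq_0[OF g, of y] y True by (intro tendsto_divide_zero) simp
      have "norm (radial_map g h z i) \<le> g z / \<eta>" if z: "z \<in> ?S" for z
      proof (cases "h z = 0")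
        case True
        then show ?thesis using gauge_on_nonneg[OF g] z gauge_onD(1)[OF h] by (auto simp: radial_map_def)
      next
        case False
        then have hz: "h z > 0" using gauge_on_nonneg[OF h] z by (simp add: order_less_le)
        have "\<eta> > 0" "\<eta> * \<bar>z i\<bar> \<le> h z" using gauge_onD(1)[OF h] gauge_on_bound[OF h, of z] z by auto
        then have "\<bar>z i\<bar> / h z \<le> 1 / \<eta>" using hz by (simp add: field_simps)
        then have "g z * (\<bar>z i\<bar> / h z) \<le> g z * (1 / \<eta>)"
          using gauge_on_nonneg[OF g] z by (intro mult_left_mono) auto
        then show ?thesis using hz gauge_on_nonneg[OF g] z by (simp add: radial_map_def abs_mult)
      qed
      then have ev: "\<forall>\<^sub>F z in at y within ?S. norm (radial_map g h z i) \<le> g z / \<eta>"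
        unfolding eventually_at_filter by (intro always_eventually) blast
      have "((\<lambda>y. radial_map g h y i) \<longlongrightarrow> 0) (at y within ?S)"
        by (rule Lim_null_comparison[OF ev lim])
      then show ?thesis using True by (simp add: radial_map_def)
    qed
  qed
qed

lemma radial_map:
  assumes g: "gauge_on d \<kappa> g" and h: "gauge_on d \<eta> h" and y: "\<forall>i\<ge>d. y i = 0"
  shows "\<forall>i\<ge>d. radial_map g h y i = 0" "h (radial_map g h y) = g y" "radial_map h g (radial_map g h y) = y"
proof -
  show z: "\<forall>i\<ge>d. radial_map g h y i = 0" using y by (simp add: radial_map_def)
  have nn: "0 \<le> g y" "0 \<le> h y" using gauge_on_nonneg[OF g y] gauge_on_nonneg[OF h y] .
  show hz: "h (radial_map g h y) = g y"
  proof (cases "y = (\<lambda>_. 0)")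
    case True
    then have "radial_map g h y = (\<lambda>_. 0)" by (simp add: radial_map_def)
    then show ?thesis using gauge_on_eq_0[OF g y] gauge_on_eq_0[OF h y] True by simp
  next
    case False
    then have "h y \<noteq> 0" using gauge_on_eq_0[OF h y] by simp
    moreover have "h (radial_map g h y) = g y / h y * h y"
      unfolding radial_map_def using gauge_on_scale[OF h y, of "g y / h y"] nn by simp
    ultimately show ?thesis by simp
  qed
  have gz: "g (radial_map g h y) = g y / h y * g y"
    unfolding radial_map_def using gauge_on_scale[OF g y, of "g y / h y"] nn by simp
  show "radial_map h g (radial_map g h y) = y"
  proof (cases "y = (\<lambda>_. 0)")
    case True
    then show ?thesis by (simp add: radial_map_def)
  next
    case False
    then have "h y \<noteq> 0" "g y \<noteq> 0" using gauge_on_eq_0[OF h y] gauge_on_eq_0[OF g y] by simp_all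
    then show ?thesis unfolding radial_map_def[of h g] hz gz by (simp add: radial_map_def fun_eq_iff)
  qed
qed

lemma homeomorphic_maps_radial_map:
  assumes g: "gauge_on d \<kappa> g" and h: "gauge_on d \<eta> h"
  shows "homeomorphic_maps (top_of_set {y. (\<forall>i\<ge>d. y i = 0) \<and> g y \<le> 1}) (top_of_set {y. (\<forall>i\<ge>d. y i = 0) \<and> h y \<le> 1})
    (radial_map g h) (radial_map h g)"
  unfolding homeomorphic_maps_def continuous_map_subtopology_eu
  using radial_map[OF g h] radial_map[OF h g] continuous_on_radial_map[OF g h] continuous_on_radial_map[OF h g]
  by (auto intro: continuous_on_subset)

lemma gauge_on_norm: "gauge_on d 1 (\<lambda>y. sqrt (\<Sum>i<d. y i ^ 2))"
  unfolding gauge_on_def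
proof (intro conjI allI impI)
  show "continuous_on {y :: nat \<Rightarrow> real. \<forall>i\<ge>d. y i = 0} (\<lambda>y. sqrt (\<Sum>i<d. y i ^ 2))"
    by (intro continuous_intros continuous_on_product_then_coordinatewise[OF continuous_on_id])
  fix y :: "nat \<Rightarrow> real"
  show "sqrt (\<Sum>i<d. (l * y i) ^ 2) = l * sqrt (\<Sum>i<d. y i ^ 2)" if "0 \<le> l" for l
    using that by (simp add: power_mult_distrib flip: sum_distrib_left) (simp add: real_sqrt_mult)
  fix i assume y: "\<forall>i\<ge>d. y i = 0"
  show "1 * \<bar>y i\<bar> \<le> sqrt (\<Sum>i<d. y i ^ 2)"
  proof (cases "i < d")
    case True
    then have "y i ^ 2 \<le> (\<Sum>i<d. y i ^ 2)"
      by (intro member_le_sum) auto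
    then have "sqrt (y i ^ 2) \<le> sqrt (\<Sum>i<d. y i ^ 2)" by (rule real_sqrt_le_mono)
    then show ?thesis by simp
  qed (use y in \<open>simp add: sum_nonneg\<close>)
qed simp

section \<open>Finite maxima and the coordinate simplex\<close>

lemma continuous_on_Max_image:
  fixes f :: "'i \<Rightarrow> 'a::topological_space \<Rightarrow> real"
  assumes "finite I" "I \<noteq> {}" "\<And>i. i \<in> I \<Longrightarrow> continuous_on S (f i)"
  shows "continuous_on S (\<lambda>x. Max ((\<lambda>i. f i x) ` I))"
  using assms
proof (induction I rule: finite_ne_induct)
  case (insert i I)
  then have "continuous_on S (\<lambda>x. max (f i x) (Max ((\<lambda>i. f i x) ` I)))"
    by (intro continuous_on_max) auto
  then show ?case using insert by simp
qed simp

lemma Max_image_scale: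
  fixes f :: "'i \<Rightarrow> real"
  assumes "finite I" "I \<noteq> {}" "0 \<le> l"
  shows "Max ((\<lambda>i. l * f i) ` I) = l * Max (f ` I)"
  using mono_Max_commute[of "\<lambda>x. l * x" "f ` I"] assms
  by (simp add: image_image mono_def mult_left_mono)

text \<open>Unit vectors are affinely independent, so the weights of a point are its coordinates,
  and the relative interior is where all coordinates on \<open>J\<close> are positive.\<close>

lemma coord_simplex_eq:
  fixes J :: "'n::finite set"
  shows "coord_simplex J = {x. (\<forall>i. 0 \<le> x $ i) \<and> (\<forall>i. i \<notin> J \<longrightarrow> x $ i = 0) \<and> (\<Sum>i\<in>J. x $ i) = 1}"
  and rel_frontier_coord_simplex:
  "rel_frontier (coord_simplex J) = {x \<in> coord_simplex J. \<exists>j\<in>J. x $ j = 0}"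
proof -
  have inj: "inj_on (\<lambda>j. axis j (1::real)) J" by (auto simp: inj_on_def axis_eq_axis)
  have fin: "finite ((\<lambda>j. axis j (1::real)) ` J)" by simp
  have comp: "(\<Sum>v\<in>(\<lambda>j. axis j (1::real)) ` J. u v *\<^sub>R v) $ i = (if i \<in> J then u (axis i 1) else 0)" for u :: "real ^ 'n \<Rightarrow> real" and i
    by (subst sum.reindex[OF inj]) (simp add: axis_def sum.delta if_distrib[of "(*) _"] if_distribR cong: if_cong)
  have su: "(\<Sum>v\<in>(\<lambda>j. axis j (1::real)) ` J. u v) = (\<Sum>j\<in>J. u (axis j 1))" for u :: "real ^ 'n \<Rightarrow> real"
    by (subst sum.reindex[OF inj]) simp
  \<comment> \<open>The inner product with \<open>x\<close> serves as the weight function, since its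
    value at the unit vector of \<open>j\<close> is \<open>x $ j\<close>.\<close>
  have ex: "\<exists>u. (\<forall>j\<in>J. u (axis j (1::real)) = x $ j)" for x :: "real ^ 'n"
    by (rule exI[of _ "\<lambda>v. \<Sum>i\<in>UNIV. v $ i * x $ i"]) (simp add: axis_def if_distribR if_distrib[of "\<lambda>x. x * _"] cong: if_cong)
  show eq: "coord_simplex J = {x. (\<forall>i. 0 \<le> x $ i) \<and> (\<forall>i. i \<notin> J \<longrightarrow> x $ i = 0) \<and> (\<Sum>i\<in>J. x $ i) = 1}"
    unfolding coord_simplex_def convex_hull_finite[OF fin]
  proof (intro subset_antisym subsetI)
    fix x :: "real ^ 'n" assume "x \<in> {x. (\<forall>i. 0 \<le> x $ i) \<and> (\<forall>i. i \<notin> J \<longrightarrow> x $ i = 0) \<and> (\<Sum>i\<in>J. x $ i) = 1}"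
    moreover obtain u where u: "\<forall>j\<in>J. u (axis j (1::real)) = x $ j" using ex[of x] by (elim exE)
    moreover from calculation have xeq: "(\<Sum>v\<in>(\<lambda>j. axis j 1) ` J. u v *\<^sub>R v) = x"
      unfolding Finite_Cartesian_Product.vec_eq_iff comp by auto
    ultimately show "x \<in> {y. \<exists>u. (\<forall>v\<in>(\<lambda>j. axis j 1) ` J. 0 \<le> u v) \<and> sum u ((\<lambda>j. axis j 1) ` J) = 1 \<and> (\<Sum>v\<in>(\<lambda>j. axis j 1) ` J. u v *\<^sub>R v) = y}"
      by (intro CollectI exI[of _ u]) (simp add: su xeq order_less_imp_le)
  qed (auto simp: su comp simp del: sum_component)
  have indep: "\<not> affine_dependent ((\<lambda>j. axis j (1::real)) ` J)"
    using affine_dependent_imp_dependent independent_mono[OF independent_Basis]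
    by (metis (mono_tags, lifting) axis_in_Basis_iff Basis_real_def image_subsetI insertI1)
  have "rel_interior (coord_simplex J) = {x \<in> coord_simplex J. \<forall>j\<in>J. 0 < x $ j}"
    unfolding coord_simplex_def[of J] rel_interior_convex_hull_explicit[OF indep]
    unfolding coord_simplex_def[of J, symmetric] eq
  proof (intro subset_antisym subsetI)
    fix x :: "real ^ 'n" assume "x \<in> {x \<in> {x. (\<forall>i. 0 \<le> x $ i) \<and> (\<forall>i. i \<notin> J \<longrightarrow> x $ i = 0) \<and> (\<Sum>i\<in>J. x $ i) = 1}. \<forall>j\<in>J. 0 < x $ j}"
    moreover obtain u where u: "\<forall>j\<in>J. u (axis j (1::real)) = x $ j" using ex[of x] by (elim exE)
    moreover from calculation have xeq: "(\<Sum>v\<in>(\<lambda>j. axis j 1) ` J. u v *\<^sub>R v) = x"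
      unfolding Finite_Cartesian_Product.vec_eq_iff comp by auto
    ultimately show "x \<in> {y. \<exists>u. (\<forall>x\<in>(\<lambda>j. axis j 1) ` J. 0 < u x) \<and> sum u ((\<lambda>j. axis j 1) ` J) = 1 \<and> (\<Sum>x\<in>(\<lambda>j. axis j 1) ` J. u x *\<^sub>R x) = y}"
      by (intro CollectI exI[of _ u]) (simp add: su xeq order_less_imp_le)
  next
    fix y assume "y \<in> {y. \<exists>u. (\<forall>x\<in>(\<lambda>j. axis j 1) ` J. 0 < u x) \<and> sum u ((\<lambda>j. axis j 1) ` J) = 1 \<and> (\<Sum>x\<in>(\<lambda>j. axis j (1::real)) ` J. u x *\<^sub>R x) = y}"
    then obtain u where "\<forall>j\<in>J. 0 < u (axis j (1::real))" "(\<Sum>j\<in>J. u (axis j 1)) = 1" "(\<Sum>x\<in>(\<lambda>j. axis j (1::real)) ` J. u x *\<^sub>R x) = y"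
      by (auto simp: su)
    then show "y \<in> {x \<in> {x. (\<forall>i. 0 \<le> x $ i) \<and> (\<forall>i. i \<notin> J \<longrightarrow> x $ i = 0) \<and> (\<Sum>i\<in>J. x $ i) = 1}. \<forall>j\<in>J. 0 < x $ j}"
      by (auto simp: comp order_less_imp_le simp del: sum_component)
  qed
  moreover have "closed (coord_simplex J)"
    unfolding coord_simplex_def by (intro compact_imp_closed finite_imp_compact_convex_hull fin)
  moreover have "\<forall>x\<in>coord_simplex J. \<forall>j. 0 \<le> x $ j" unfolding eq by auto
  ultimately show "rel_frontier (coord_simplex J) = {x \<in> coord_simplex J. \<exists>j\<in>J. x $ j = 0}"
    unfolding rel_frontier_def by (auto simp: order_less_le)
qed

lemma nonneg_add_divide: "0 \<le> x + a / real (r + 1)" if "- real (r + 1) * x \<le> a"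
proof -
  have "- a \<le> real (r + 1) * x" using that by (simp add: algebra_simps)
  then have "- a / real (r + 1) \<le> x" by (subst pos_divide_le_eq) (auto simp: mult.commute)
  then show ?thesis by simp
qed

text \<open>The pieces \<open>u \<ge> 0\<close>, \<open>supp u \<subseteq> J\<close>, of the paraboloid \<open>\<Sum>u + |w|\<^sup>2 = \<epsilon>\<close> are the cells of the local model.\<close>

definition paraboloid_cell :: "real \<Rightarrow> nat \<Rightarrow> 'n::finite set \<Rightarrow> ((real ^ 'n) \<times> (nat \<Rightarrow> real)) set" where
  "paraboloid_cell \<epsilon> q J = {(u, w). (\<forall>i. 0 \<le> u $ i) \<and> (\<forall>i. i \<notin> J \<longrightarrow> u $ i = 0) \<and> (\<forall>l\<ge>q. w l = 0) \<and>
     (\<Sum>i\<in>J. u $ i) + (\<Sum>l<q. w l ^ 2) = \<epsilon>}"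

section \<open>Simplex-cubes and paraboloid pieces as unit bodies in common coordinates\<close>

context
  fixes J :: "'n::finite set" and e :: "nat \<Rightarrow> 'n" and r q :: nat
  assumes e: "bij_betw e {..r} J"
begin

text \<open>A linear chart of the vectors supported on \<open>J\<close> with coordinate sum 0: the
  coordinates at \<open>e 0\<close>, ..., \<open>e (r - 1)\<close> are free, and the one at
  \<open>e r\<close> is determined by them.\<close>

definition simplex_direction :: "(nat \<Rightarrow> real) \<Rightarrow> real ^ 'n" where
  "simplex_direction y = (\<chi> k. if k \<in> J then
     (if inv_into {..r} e k < r then y (inv_into {..r} e k) else - (\<Sum>i<r. y i)) else 0)"

text \<open>The inverse of this chart, with the \<open>q\<close> coordinates of the second component
  appended from place \<open>r\<close> on.\<close>

definition cell_coords :: "(real ^ 'n) \<times> (nat \<Rightarrow> real) \<Rightarrow> nat \<Rightarrow> real" where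
  "cell_coords x i = (if i < r then fst x $ e i else if i < r + q then snd x (i - r) else 0)"

lemma simplex_direction_e: "i \<le> r \<Longrightarrow> simplex_direction y $ e i = (if i < r then y i else - (\<Sum>i<r. y i))"
  using e by (auto simp: simplex_direction_def bij_betw_def inv_into_f_f)

lemma sum_J: "(\<Sum>j\<in>J. g j) = (\<Sum>i<r. g (e i)) + g (e r)" for g :: "'n \<Rightarrow> real"
proof -
  have "(\<Sum>j\<in>J. g j) = (\<Sum>i\<le>r. g (e i))" using sum.reindex_bij_betw[OF e, of g] by simp
  then show ?thesis by (simp add: lessThan_Suc_atMost[symmetric])
qed

lemma sum_simplex_direction: "(\<Sum>j\<in>J. simplex_direction y $ j) = 0"
  by (simp add: sum_J simplex_direction_e)

lemma simplex_direction_outside: "j \<notin> J \<Longrightarrow> simplex_direction y $ j = 0"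
  by (simp add: simplex_direction_def)

lemma J_elim: "j \<in> J \<Longrightarrow> (\<And>i. i \<le> r \<Longrightarrow> j = e i \<Longrightarrow> P) \<Longrightarrow> P"
  using e by (auto simp: bij_betw_def)

lemma card_J: "card J = r + 1" and J_nonempty: "J \<noteq> {}" and e_in: "i \<le> r \<Longrightarrow> e i \<in> J"
  using e bij_betw_same_card[OF e] by (auto simp: bij_betw_def)

lemma simplex_direction_cell_coords:
  assumes "\<forall>j. j \<notin> J \<longrightarrow> v $ j = 0" "(\<Sum>j\<in>J. v $ j) = 0"
  shows "simplex_direction (cell_coords (v, w)) = v"
  unfolding Finite_Cartesian_Product.vec_eq_iff
proof
  fix j
  show "simplex_direction (cell_coords (v, w)) $ j = v $ j"
  proof (cases "j \<in> J")
    case True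
    then show ?thesis
      using assms(2) by (elim J_elim) (auto simp: simplex_direction_e cell_coords_def sum_J)
  qed (use assms in \<open>simp add: simplex_direction_outside\<close>)
qed

lemma continuous_simplex_direction: "continuous_on S (\<lambda>y. simplex_direction y $ j)"
proof -
  have c: "continuous_on S (\<lambda>y :: nat \<Rightarrow> real. y i)" for i
    by (rule continuous_on_product_then_coordinatewise[OF continuous_on_id])
  have "continuous_on S (\<lambda>y :: nat \<Rightarrow> real. - (\<Sum>i<r. y i))"
    by (intro continuous_on_minus continuous_on_sum c)
  then show ?thesis
    unfolding simplex_direction_def
    by (cases "j \<in> J"; cases "inv_into {..r} e j < r") (simp_all add: c)
qed

lemma simplex_direction_scale: "simplex_direction (\<lambda>i. l * y i) $ j = l * simplex_direction y $ j"
  by (simp add: simplex_direction_def sum_distrib_left)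

text \<open>The gauge of the simplex seen from its barycentre: a direction with coordinate
  \<open>t\<close> at \<open>j\<close> keeps \<open>t + 1 / (r + 1)\<close> nonnegative exactly if
  \<open>- (r + 1) * t\<close> is at most 1.\<close>

definition simplex_gauge :: "(nat \<Rightarrow> real) \<Rightarrow> real" where
  "simplex_gauge y = Max ((\<lambda>j. - real (r + 1) * simplex_direction y $ j) ` J)"

text \<open>The gauge of the cube with sides from -1 to 1. The inserted 0 keeps the argument of
  \<open>Max\<close> nonempty when \<open>q = 0\<close>.\<close>

definition cube_gauge :: "(nat \<Rightarrow> real) \<Rightarrow> real" where
  "cube_gauge y = Max (insert 0 ((\<lambda>l. \<bar>y (r + l)\<bar>) ` {..<q}))"

definition fiber_norm :: "(nat \<Rightarrow> real) \<Rightarrow> real" where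
  "fiber_norm y = (\<Sum>l<q. y (r + l) ^ 2)"

text \<open>Let \<open>s\<close> and \<open>n\<close> be the values of \<open>simplex_gauge\<close>
  and \<open>fiber_norm\<close>. Shrinking by the factor \<open>l\<close> divides \<open>s\<close>
  by \<open>l\<close> and \<open>n\<close> by \<open>l^2\<close>, so the gauge of the body
  \<open>s + n \<le> \<epsilon>\<close> is the nonnegative root \<open>l\<close> of
  \<open>\<epsilon> * l^2 - s * l - n = 0\<close>.\<close>

definition parab_gauge :: "real \<Rightarrow> (nat \<Rightarrow> real) \<Rightarrow> real" where
  "parab_gauge \<epsilon> y = (simplex_gauge y + sqrt (simplex_gauge y ^ 2 + 4 * \<epsilon> * fiber_norm y)) / (2 * \<epsilon>)"

lemma simplex_gauge_le: "simplex_gauge y \<le> a \<longleftrightarrow> (\<forall>j\<in>J. - real (r + 1) * simplex_direction y $ j \<le> a)"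
  unfolding simplex_gauge_def using J_nonempty by simp

lemma simplex_gauge_ge: "a \<le> simplex_gauge y \<longleftrightarrow> (\<exists>j\<in>J. a \<le> - real (r + 1) * simplex_direction y $ j)"
  unfolding simplex_gauge_def using J_nonempty by (simp add: Max_ge_iff)

lemma simplex_gauge_nonneg: "0 \<le> simplex_gauge y"
proof (rule ccontr)
  assume "\<not> 0 \<le> simplex_gauge y"
  then have "\<forall>j\<in>J. - real (r + 1) * simplex_direction y $ j < 0"
    using simplex_gauge_ge[of 0 y] by auto
  then have "\<forall>j\<in>J. 0 < simplex_direction y $ j" by (simp add: mult_less_0_iff)
  then have "0 < (\<Sum>j\<in>J. simplex_direction y $ j)" using J_nonempty by (intro sum_pos) auto
  then show False by (simp add: sum_simplex_direction)
qed

text \<open>The gauge only bounds how negative a coordinate can be. As the coordinates on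
  \<open>J\<close> sum to 0, a positive one is the sum of the negatives of the \<open>r\<close>
  others, each of which is at most the gauge divided by \<open>r + 1\<close>.\<close>

lemma simplex_gauge_bound: "j \<in> J \<Longrightarrow> \<bar>simplex_direction y $ j\<bar> \<le> simplex_gauge y"
proof -
  assume j: "j \<in> J"
  let ?M = "simplex_gauge y" and ?t = "\<lambda>j. simplex_direction y $ j"
  have M: "- ?t k \<le> ?M / real (r + 1)" if "k \<in> J" for k
  proof -
    have "- real (r + 1) * ?t k \<le> ?M" using simplex_gauge_le that by blast
    then have "real (r + 1) * (- ?t k) \<le> ?M" by (simp add: algebra_simps)
    then show ?thesis by (simp add: pos_le_divide_eq mult.commute)
  qed
  have "?M / real (r + 1) \<le> ?M / 1" using simplex_gauge_nonneg by (intro divide_left_mono) auto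
  moreover have "?t j = (\<Sum>k\<in>J - {j}. - ?t k)"
    using sum_simplex_direction[of y] j by (simp add: sum.remove[of J j] sum_negf)
  moreover have "(\<Sum>k\<in>J - {j}. - ?t k) \<le> of_nat (card (J - {j})) * (?M / real (r + 1))"
    by (intro sum_bounded_above M) auto
  moreover have "of_nat (card (J - {j})) * (?M / real (r + 1)) \<le> ?M"
    using j card_J simplex_gauge_nonneg[of y] by (simp add: field_simps)
  ultimately show ?thesis using M[OF j] by (simp add: abs_le_iff)
qed

lemma cube_gauge_le: "0 \<le> a \<Longrightarrow> cube_gauge y \<le> a \<longleftrightarrow> (\<forall>l<q. \<bar>y (r + l)\<bar> \<le> a)"
  unfolding cube_gauge_def by auto

lemma cube_gauge_ge: "0 < a \<Longrightarrow> a \<le> cube_gauge y \<longleftrightarrow> (\<exists>l<q. a \<le> \<bar>y (r + l)\<bar>)"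
  unfolding cube_gauge_def by (auto simp: Max_ge_iff)

lemma coord_bound:
  assumes y: "\<forall>i\<ge>r + q. y i = 0"
  shows "\<bar>y i\<bar> \<le> max (simplex_gauge y) (cube_gauge y)"
proof -
  consider "i < r" | l where "i = r + l" "l < q" | "i \<ge> r + q"
    by (metis add_diff_inverse_nat nat_add_left_cancel_less not_le)
  then show ?thesis
  proof cases
    case 1
    then show ?thesis using simplex_gauge_bound[OF e_in, of i y] simplex_direction_e[of i y] by simp
  next
    case 2
    have "\<bar>y (r + l)\<bar> \<le> cube_gauge y" unfolding cube_gauge_def using 2 by (intro Max_ge) auto
    then show ?thesis using 2 by simp
  next
    case 3
    then show ?thesis using y simplex_gauge_nonneg[of y] by simp
  qed
qed

lemma continuous_simplex_gauge: "continuous_on S simplex_gauge"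
  unfolding simplex_gauge_def
  by (intro continuous_on_Max_image continuous_intros continuous_simplex_direction J_nonempty) auto

lemma continuous_cube_gauge: "continuous_on S cube_gauge"
proof -
  \<comment> \<open>Indexing by options turns the inserted 0 into one more function under the
    maximum.\<close>
  have "continuous_on S (\<lambda>y. Max ((\<lambda>i. (case i of None \<Rightarrow> 0 | Some l \<Rightarrow> \<bar>y (r + l)\<bar>)) ` insert None (Some ` {..<q})))"
    by (intro continuous_on_Max_image)
      (auto split: option.splits intro!: continuous_intros continuous_on_product_then_coordinatewise[OF continuous_on_id])
  then show ?thesis by (simp add: cube_gauge_def[abs_def] image_image)
qed

lemma simplex_gauge_scale: "0 \<le> l \<Longrightarrow> simplex_gauge (\<lambda>i. l * y i) = l * simplex_gauge y"
  unfolding simplex_gauge_def using Max_image_scale[of J l "\<lambda>j. - real (r + 1) * simplex_direction y $ j"] J_nonempty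
  by (simp add: simplex_direction_scale mult.left_commute)

lemma cube_gauge_scale: "0 \<le> l \<Longrightarrow> cube_gauge (\<lambda>i. l * y i) = l * cube_gauge y"
  unfolding cube_gauge_def
  using Max_image_scale[of "insert None (Some ` {..<q})" l "\<lambda>i. (case i of None \<Rightarrow> 0 | Some l \<Rightarrow> \<bar>y (r + l)\<bar>)"]
  by (simp add: abs_mult image_image)

lemma gauge_on_max: "gauge_on (r + q) 1 (\<lambda>y. max (simplex_gauge y) (cube_gauge y))"
  unfolding gauge_on_def using coord_bound
  by (auto intro!: continuous_on_max continuous_simplex_gauge continuous_cube_gauge
      simp: simplex_gauge_scale cube_gauge_scale max_mult_distrib_left)

lemma fiber_norm_nonneg: "0 \<le> fiber_norm y"
  by (simp add: fiber_norm_def sum_nonneg)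

text \<open>The constant has two sources: dropping \<open>fiber_norm\<close> under the root leaves
  \<open>simplex_gauge y / \<epsilon>\<close>, and dropping the simplex part leaves
  \<open>\<bar>y (r + l)\<bar> / sqrt \<epsilon>\<close>.\<close>

lemma gauge_on_parab:
  assumes "\<epsilon> > 0"
  shows "gauge_on (r + q) (min (1 / \<epsilon>) (1 / sqrt \<epsilon>)) (parab_gauge \<epsilon>)"
  unfolding gauge_on_def
proof (intro conjI allI impI)
  show "min (1 / \<epsilon>) (1 / sqrt \<epsilon>) > 0" using assms by simp
  show "continuous_on {y. \<forall>i\<ge>r + q. y i = 0} (parab_gauge \<epsilon>)"
    unfolding parab_gauge_def fiber_norm_def using assms
    by (intro continuous_intros continuous_simplex_gauge continuous_on_product_then_coordinatewise[OF continuous_on_id]) auto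
  fix y :: "nat \<Rightarrow> real" assume y: "\<forall>i\<ge>r + q. y i = 0"
  let ?s = "simplex_gauge y" and ?n = "fiber_norm y"
  show "parab_gauge \<epsilon> (\<lambda>i. l * y i) = l * parab_gauge \<epsilon> y" if l: "0 \<le> l" for l
  proof -
    have "fiber_norm (\<lambda>i. l * y i) = l\<^sup>2 * ?n"
      by (simp add: fiber_norm_def power_mult_distrib sum_distrib_left)
    then have "sqrt (simplex_gauge (\<lambda>i. l * y i) ^ 2 + 4 * \<epsilon> * fiber_norm (\<lambda>i. l * y i)) = sqrt (l\<^sup>2 * (?s\<^sup>2 + 4 * \<epsilon> * ?n))"
      using l by (simp add: simplex_gauge_scale power_mult_distrib algebra_simps)
    also have "\<dots> = l * sqrt (?s\<^sup>2 + 4 * \<epsilon> * ?n)" using l by (simp add: real_sqrt_mult)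
    finally show ?thesis using l by (simp add: parab_gauge_def simplex_gauge_scale algebra_simps add_divide_distrib)
  qed
  fix i
  have s: "?s / \<epsilon> \<le> parab_gauge \<epsilon> y"
  proof -
    have "?s = sqrt (?s\<^sup>2)" using simplex_gauge_nonneg[of y] by simp
    also have "\<dots> \<le> sqrt (?s\<^sup>2 + 4 * \<epsilon> * ?n)" using assms fiber_norm_nonneg[of y] by (intro real_sqrt_le_mono) simp
    finally show ?thesis using assms by (simp add: parab_gauge_def field_simps)
  qed
  have n: "\<bar>y (r + l)\<bar> / sqrt \<epsilon> \<le> parab_gauge \<epsilon> y" if "l < q" for l
  proof -
    have "y (r + l) ^ 2 \<le> ?n" unfolding fiber_norm_def using that by (intro member_le_sum[of _ _ "\<lambda>l. y (r + l) ^ 2"]) auto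
    then have "4 * \<epsilon> * y (r + l) ^ 2 \<le> ?s\<^sup>2 + 4 * \<epsilon> * ?n" using assms by (simp add: add_increasing)
    then have "sqrt (4 * \<epsilon> * y (r + l) ^ 2) \<le> sqrt (?s\<^sup>2 + 4 * \<epsilon> * ?n)" by (rule real_sqrt_le_mono)
    moreover have "sqrt (4 * \<epsilon> * y (r + l) ^ 2) = 2 * sqrt \<epsilon> * \<bar>y (r + l)\<bar>"
      by (simp add: real_sqrt_mult)
    ultimately have "2 * sqrt \<epsilon> * \<bar>y (r + l)\<bar> / (2 * \<epsilon>) \<le> parab_gauge \<epsilon> y"
      unfolding parab_gauge_def using assms simplex_gauge_nonneg[of y] by (intro divide_right_mono) auto
    moreover have "2 * sqrt \<epsilon> * \<bar>y (r + l)\<bar> / (2 * \<epsilon>) = \<bar>y (r + l)\<bar> / sqrt \<epsilon>"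
      using assms by (simp add: field_simps flip: power2_eq_square)
    ultimately show ?thesis by simp
  qed
  consider "i < r" | l where "i = r + l" "l < q" | "i \<ge> r + q"
    by (metis add_diff_inverse_nat nat_add_left_cancel_less not_le)
  then show "min (1 / \<epsilon>) (1 / sqrt \<epsilon>) * \<bar>y i\<bar> \<le> parab_gauge \<epsilon> y"
  proof cases
    case 1
    then have "\<bar>y i\<bar> \<le> ?s" using simplex_gauge_bound[OF e_in, of i y] simplex_direction_e[of i y] by simp
    then have "\<bar>y i\<bar> / \<epsilon> \<le> ?s / \<epsilon>" using assms by (intro divide_right_mono) auto
    moreover have "min (1 / \<epsilon>) (1 / sqrt \<epsilon>) * \<bar>y i\<bar> \<le> 1 / \<epsilon> * \<bar>y i\<bar>" by (intro mult_right_mono) auto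
    ultimately show ?thesis using s by simp
  next
    case 2
    have "min (1 / \<epsilon>) (1 / sqrt \<epsilon>) * \<bar>y i\<bar> \<le> 1 / sqrt \<epsilon> * \<bar>y i\<bar>" by (intro mult_right_mono) auto
    then show ?thesis using n[OF 2(2)] 2 by simp
  next
    case 3
    have "0 \<le> ?s / \<epsilon>" using assms simplex_gauge_nonneg by simp
    then show ?thesis using 3 y s by simp
  qed
qed

lemma parab_gauge_compare:
  assumes "\<epsilon> > 0"
  shows "parab_gauge \<epsilon> y \<le> 1 \<longleftrightarrow> simplex_gauge y + fiber_norm y \<le> \<epsilon>"
    and "parab_gauge \<epsilon> y = 1 \<longleftrightarrow> simplex_gauge y + fiber_norm y = \<epsilon>"
proof -
  let ?s = "simplex_gauge y" and ?n = "fiber_norm y"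
  have s: "0 \<le> ?s" "0 \<le> ?n" using simplex_gauge_nonneg fiber_norm_nonneg by auto
  have le: "parab_gauge \<epsilon> y \<le> 1 \<longleftrightarrow> sqrt (?s\<^sup>2 + 4 * \<epsilon> * ?n) \<le> 2 * \<epsilon> - ?s"
    and eq: "parab_gauge \<epsilon> y = 1 \<longleftrightarrow> sqrt (?s\<^sup>2 + 4 * \<epsilon> * ?n) = 2 * \<epsilon> - ?s"
    using assms by (auto simp: parab_gauge_def field_simps)
  \<comment> \<open>Comparing the squares leaves the defect \<open>\<epsilon> - ?s - ?n\<close>.
    Squaring is legitimate once \<open>?s \<le> 2 * \<epsilon>\<close>, which either side of the
    claimed equivalences implies.\<close>
  have sq: "(2 * \<epsilon> - ?s)\<^sup>2 - (?s\<^sup>2 + 4 * \<epsilon> * ?n) = 4 * \<epsilon> * (\<epsilon> - ?s - ?n)"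
    by (simp add: power2_eq_square algebra_simps)
  have "?s \<le> 2 * \<epsilon>" if "?s + ?n \<le> \<epsilon>" using that s assms by linarith
  moreover have "?s \<le> 2 * \<epsilon>" if "sqrt (?s\<^sup>2 + 4 * \<epsilon> * ?n) \<le> 2 * \<epsilon> - ?s"
  proof -
    have "0 \<le> sqrt (?s\<^sup>2 + 4 * \<epsilon> * ?n)" using s assms by simp
    then show ?thesis using that by linarith
  qed
  moreover have "sqrt (?s\<^sup>2 + 4 * \<epsilon> * ?n) \<le> 2 * \<epsilon> - ?s \<longleftrightarrow> ?s + ?n \<le> \<epsilon>"
      "sqrt (?s\<^sup>2 + 4 * \<epsilon> * ?n) = 2 * \<epsilon> - ?s \<longleftrightarrow> ?s + ?n = \<epsilon>" if "?s \<le> 2 * \<epsilon>"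
  proof -
    have "sqrt (?s\<^sup>2 + 4 * \<epsilon> * ?n) \<le> 2 * \<epsilon> - ?s \<longleftrightarrow> ?s\<^sup>2 + 4 * \<epsilon> * ?n \<le> (2 * \<epsilon> - ?s)\<^sup>2"
      using that by (metis diff_ge_0_iff_ge real_sqrt_le_iff real_sqrt_unique)
    also have "\<dots> \<longleftrightarrow> 0 \<le> 4 * \<epsilon> * (\<epsilon> - ?s - ?n)" using sq by linarith
    finally show "sqrt (?s\<^sup>2 + 4 * \<epsilon> * ?n) \<le> 2 * \<epsilon> - ?s \<longleftrightarrow> ?s + ?n \<le> \<epsilon>"
      using assms by (simp add: zero_le_mult_iff) linarith
    have "sqrt (?s\<^sup>2 + 4 * \<epsilon> * ?n) = 2 * \<epsilon> - ?s \<longleftrightarrow> ?s\<^sup>2 + 4 * \<epsilon> * ?n = (2 * \<epsilon> - ?s)\<^sup>2"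
      using that by (metis diff_ge_0_iff_ge real_sqrt_eq_iff real_sqrt_unique)
    also have "\<dots> \<longleftrightarrow> 0 = 4 * \<epsilon> * (\<epsilon> - ?s - ?n)" using sq by linarith
    finally show "sqrt (?s\<^sup>2 + 4 * \<epsilon> * ?n) = 2 * \<epsilon> - ?s \<longleftrightarrow> ?s + ?n = \<epsilon>"
      using assms by auto
  qed
  ultimately show "parab_gauge \<epsilon> y \<le> 1 \<longleftrightarrow> ?s + ?n \<le> \<epsilon>" "parab_gauge \<epsilon> y = 1 \<longleftrightarrow> ?s + ?n = \<epsilon>"
    unfolding le eq by (metis order_refl)+
qed

lemma topspace_simplex_cube: "topspace (simplex_cube q (J :: 'n set)) = coord_simplex J \<times> cube q"
  by (simp add: simplex_cube_def cube_def)

lemma simplex_direction_translate: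
  assumes "\<forall>k. k \<notin> J \<longrightarrow> v $ k = 0" "(\<Sum>j\<in>J. v $ j) = real (r + 1) * t"
  shows "simplex_direction (cell_coords (\<chi> k. if k \<in> J then v $ k - t else 0, w)) = (\<chi> k. if k \<in> J then v $ k - t else 0)"
  using assms by (intro simplex_direction_cell_coords) (auto simp: sum_subtractf card_J)

lemma continuous_on_cell_coords:
  fixes f :: "'a::topological_space \<Rightarrow> (real ^ 'n) \<times> (nat \<Rightarrow> real)"
  assumes "\<And>j. continuous_on S (\<lambda>x. fst (f x) $ j)" "\<And>l. continuous_on S (\<lambda>x. snd (f x) l)"
  shows "continuous_on S (\<lambda>x. cell_coords (f x))"
proof (rule continuous_on_coordinatewise_then_product)
  show "continuous_on S (\<lambda>x. cell_coords (f x) i)" for i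
    unfolding cell_coords_def by (cases "i < r"; cases "i < r + q") (simp_all add: assms)
qed

text \<open>The barycentre moves to 0 and each side of the cube to the interval from -1 to 1. The
  product becomes the unit body of the larger of the two gauges, and its boundary becomes the level
  1.\<close>

lemma homeomorphic_maps_simplex_cube_gauge:
  defines "f \<equiv> \<lambda>(\<sigma>, z). cell_coords (\<chi> k. if k \<in> J then \<sigma> $ k - 1 / real (r + 1) else 0, \<lambda>l. 2 * z l - 1)"
  shows "homeomorphic_maps (simplex_cube q J)
      (top_of_set {y. (\<forall>i\<ge>r + q. y i = 0) \<and> max (simplex_gauge y) (cube_gauge y) \<le> 1}) f
      (\<lambda>y. (\<chi> k. if k \<in> J then simplex_direction y $ k + 1 / real (r + 1) else 0, \<lambda>l\<in>{..<q}. (y (r + l) + 1) / 2))"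
    and "\<And>c. c \<in> topspace (simplex_cube q J) \<Longrightarrow>
      c \<in> simplex_cube_boundary q J \<longleftrightarrow> max (simplex_gauge (f c)) (cube_gauge (f c)) = 1"
proof -
  let ?G = "{y. (\<forall>i\<ge>r + q. y i = 0) \<and> max (simplex_gauge y) (cube_gauge y) \<le> 1}"
  let ?h = "\<lambda>y. (\<chi> k. if k \<in> J then simplex_direction y $ k + 1 / real (r + 1) else 0, \<lambda>l\<in>{..<q}. (y (r + l) + 1) / 2)"
  have f: "f (\<sigma>, z) = cell_coords (\<chi> k. if k \<in> J then \<sigma> $ k - 1 / real (r + 1) else 0, \<lambda>l. 2 * z l - 1)" for \<sigma> z
    by (simp add: f_def)
  have sd: "simplex_direction (f (\<sigma>, z)) = (\<chi> k. if k \<in> J then \<sigma> $ k - 1 / real (r + 1) else 0)" if "\<sigma> \<in> coord_simplex J" for \<sigma> z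
    unfolding f using that by (intro simplex_direction_translate) (auto simp: coord_simplex_eq)
  have fl: "f (\<sigma>, z) (r + l) = 2 * z l - 1" if "l < q" for \<sigma> z l
    using that by (simp add: f cell_coords_def)
  have sg: "- real (r + 1) * simplex_direction (f (\<sigma>, z)) $ j = 1 - real (r + 1) * \<sigma> $ j"
    if "\<sigma> \<in> coord_simplex J" "j \<in> J" for \<sigma> z j
    using that by (simp add: sd field_simps)
  have cg: "1 \<le> cube_gauge y \<longleftrightarrow> (\<exists>l<q. 1 \<le> \<bar>y (r + l)\<bar>)" for y by (rule cube_gauge_ge) simp
  have le: "max (simplex_gauge (f (\<sigma>, z))) (cube_gauge (f (\<sigma>, z))) \<le> 1" if "\<sigma> \<in> coord_simplex J" "z \<in> cube q" for \<sigma> z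
  proof -
    have "\<forall>j\<in>J. - real (r + 1) * simplex_direction (f (\<sigma>, z)) $ j \<le> 1"
      using sg[OF that(1)] that(1) by (simp add: coord_simplex_eq)
    moreover have "\<forall>l<q. \<bar>f (\<sigma>, z) (r + l)\<bar> \<le> 1"
    proof (intro allI impI)
      fix l assume "l < q"
      moreover then have "0 \<le> z l" "z l \<le> 1" using that(2) by (auto simp: cube_def PiE_def Pi_def)
      ultimately show "\<bar>f (\<sigma>, z) (r + l)\<bar> \<le> 1" by (simp add: fl abs_le_iff)
    qed
    ultimately show ?thesis by (simp only: max.bounded_iff simplex_gauge_le cube_gauge_le[OF zero_le_one] conj_commute)
  qed
  show "c \<in> simplex_cube_boundary q J \<longleftrightarrow> max (simplex_gauge (f c)) (cube_gauge (f c)) = 1"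
    if c: "c \<in> topspace (simplex_cube q J)" for c
  proof -
    obtain \<sigma> z where cz: "c = (\<sigma>, z)" and \<sigma>: "\<sigma> \<in> coord_simplex J" and z: "z \<in> cube q"
      using c by (auto simp: topspace_simplex_cube)
    have "max (simplex_gauge (f c)) (cube_gauge (f c)) = 1 \<longleftrightarrow>
       1 \<le> simplex_gauge (f c) \<or> 1 \<le> cube_gauge (f c)"
      using le[OF \<sigma> z] cz by (auto simp: max_def)
    also have "\<dots> \<longleftrightarrow> (\<exists>j\<in>J. 1 \<le> 1 - real (r + 1) * \<sigma> $ j) \<or> (\<exists>l<q. 1 \<le> \<bar>2 * z l - 1\<bar>)"
      unfolding simplex_gauge_ge cg cz using sg[OF \<sigma>] fl by auto
    also have "(\<exists>j\<in>J. 1 \<le> 1 - real (r + 1) * \<sigma> $ j) \<longleftrightarrow> (\<exists>j\<in>J. \<sigma> $ j = 0)"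
    proof -
      have "1 \<le> 1 - real (r + 1) * \<sigma> $ j \<longleftrightarrow> \<sigma> $ j = 0" for j
      proof -
        have "1 \<le> 1 - real (r + 1) * \<sigma> $ j \<longleftrightarrow> \<sigma> $ j \<le> 0"
          by (simp add: mult_le_0_iff)
        then show ?thesis using \<sigma> by (auto simp: coord_simplex_eq order_antisym)
      qed
      then show ?thesis by blast
    qed
    also have "(\<exists>l<q. 1 \<le> \<bar>2 * z l - 1\<bar>) \<longleftrightarrow> (\<exists>l<q. z l = 0 \<or> z l = 1)"
    proof -
      have "1 \<le> \<bar>2 * z l - 1\<bar> \<longleftrightarrow> z l = 0 \<or> z l = 1" if "l < q" for l
      proof -
        have "0 \<le> z l" "z l \<le> 1" using z that by (auto simp: cube_def PiE_def Pi_def)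
        then show ?thesis by (auto simp: abs_if)
      qed
      then show ?thesis by blast
    qed
    finally show ?thesis
      using \<sigma> z cz by (auto simp: simplex_cube_boundary_def rel_frontier_coord_simplex)
  qed
  have cf: "continuous_map (simplex_cube q J) euclidean f"
  proof -
    have fst: "continuous_map (simplex_cube q J) euclideanreal (\<lambda>x. fst x $ j)" for j
    proof -
      have "continuous_map (top_of_set (coord_simplex J)) euclideanreal (\<lambda>\<sigma>. \<sigma> $ j)"
        by (auto intro!: continuous_intros)
      from continuous_map_compose[OF continuous_map_fst this] show ?thesis
        by (simp add: simplex_cube_def o_def)
    qed
    have snd: "continuous_map (simplex_cube q J) euclideanreal (\<lambda>x. snd x l)" if "l < q" for l
    proof -
      have "continuous_map (product_topology (\<lambda>i. top_of_set {0..1::real}) {..<q}) (top_of_set {0..1}) (\<lambda>z. z l)"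
        using that by (intro continuous_map_product_projection) auto
      from continuous_map_compose[OF continuous_map_snd this] show ?thesis
        by (auto simp: simplex_cube_def o_def continuous_map_in_subtopology)
    qed
    have "continuous_map (simplex_cube q J) (powertop_real UNIV) f"
      unfolding continuous_map_componentwise_UNIV
    proof
      fix i
      consider "i < r" | l where "i = r + l" "l < q" | "i \<ge> r + q"
        by (metis add_diff_inverse_nat nat_add_left_cancel_less not_le)
      then show "continuous_map (simplex_cube q J) euclideanreal (\<lambda>x. f x i)"
      proof cases
        case 1
        then have "f x i = fst x $ e i - 1 / real (r + 1)" for x
          using e_in[of i] by (cases x) (auto simp: f cell_coords_def)
        then show ?thesis by (simp only:) (intro continuous_intros fst)
      next
        case 2
        then have "f x i = 2 * snd x l - 1" for x
          using fl by (cases x) auto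
        then show ?thesis using snd[OF 2(2)] by (simp only:) (intro continuous_intros)
      next
        case 3
        then have "f x i = 0" for x by (cases x) (auto simp: f cell_coords_def)
        then show ?thesis by simp
      qed
    qed
    then show ?thesis by (simp add: euclidean_product_topology)
  qed
  show "homeomorphic_maps (simplex_cube q J) (top_of_set ?G) f ?h"
    unfolding homeomorphic_maps_def
  proof (intro conjI ballI)
    show "continuous_map (simplex_cube q J) (top_of_set ?G) f"
      unfolding continuous_map_in_subtopology
      using cf le by (auto simp: topspace_simplex_cube f cell_coords_def)
    have ch1: "continuous_map (top_of_set ?G) (top_of_set (coord_simplex J)) (\<lambda>y. fst (?h y))"
      unfolding continuous_map_in_subtopology
    proof
      have "continuous_on ?G (\<lambda>y. fst (?h y))"
        unfolding fst_conv
      proof (rule continuous_on_vec_lambda)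
        show "continuous_on ?G (\<lambda>y. if k \<in> J then simplex_direction y $ k + 1 / real (r + 1) else 0)" for k
          by (cases "k \<in> J") (auto intro!: continuous_intros continuous_simplex_direction)
      qed
      then show "continuous_map (top_of_set ?G) euclidean (\<lambda>y. fst (?h y))" by simp
      show "(\<lambda>y. fst (?h y)) \<in> topspace (top_of_set ?G) \<rightarrow> coord_simplex J"
      proof
        fix y assume "y \<in> topspace (top_of_set ?G)"
        then have "simplex_gauge y \<le> 1" by simp
        then have "\<forall>j\<in>J. - real (r + 1) * simplex_direction y $ j \<le> 1" unfolding simplex_gauge_le .
        then have "\<forall>j\<in>J. 0 \<le> simplex_direction y $ j + 1 / real (r + 1)" using nonneg_add_divide by blast
        then show "fst (?h y) \<in> coord_simplex J"
          by (auto simp: coord_simplex_eq sum.distrib sum_simplex_direction card_J)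
      qed
    qed
    have ch2: "continuous_map (top_of_set ?G) (product_topology (\<lambda>i. top_of_set {0..1}) {..<q}) (\<lambda>y. snd (?h y))"
      unfolding continuous_map_componentwise
    proof (intro conjI ballI)
      fix l assume l: "l \<in> {..<q}"
      have "continuous_on ?G (\<lambda>y. (y (r + l) + 1) / 2)"
        by (intro continuous_intros continuous_on_product_then_coordinatewise[OF continuous_on_id]) auto
      moreover have "(y (r + l) + 1) / 2 \<in> {0..1}" if "y \<in> ?G" for y
      proof -
        have "cube_gauge y \<le> 1" using that by simp
        then have "\<bar>y (r + l)\<bar> \<le> 1" using l cube_gauge_le[of 1 y] by simp
        then show ?thesis by (simp add: abs_le_iff)
      qed
      ultimately show "continuous_map (top_of_set ?G) (top_of_set {0..1}) (\<lambda>x. snd (?h x) l)"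
        using l by (auto simp: continuous_map_in_subtopology)
    qed (auto simp: extensional_def)
    show "continuous_map (top_of_set ?G) (simplex_cube q J) ?h"
      using continuous_map_pairedI[OF ch1 ch2] by (simp add: simplex_cube_def)
    fix x assume "x \<in> topspace (simplex_cube q J)"
    then obtain \<sigma> z where x: "x = (\<sigma>, z)" and \<sigma>: "\<sigma> \<in> coord_simplex J" and z: "z \<in> cube q"
      by (auto simp: topspace_simplex_cube)
    have "fst (?h (f x)) = \<sigma>"
      using \<sigma> unfolding x by (simp add: Finite_Cartesian_Product.vec_eq_iff sd coord_simplex_eq)
    moreover have "snd (?h (f x)) = z"
      using z unfolding x by (auto simp: fl fun_eq_iff cube_def restrict_def PiE_def extensional_def)
    ultimately show "?h (f x) = x" using x by (metis prod.collapse fst_conv snd_conv)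
  next
    fix y assume y: "y \<in> topspace (top_of_set ?G)"
    show "f (?h y) = y"
    proof
      fix i
      consider "i < r" | l where "i = r + l" "l < q" | "i \<ge> r + q"
        by (metis add_diff_inverse_nat nat_add_left_cancel_less not_le)
      then show "f (?h y) i = y i"
      proof cases
        case 1
        then show ?thesis using e_in[of i] by (simp add: f cell_coords_def simplex_direction_e)
      next
        case 2
        show ?thesis unfolding 2(1) fl[OF 2(2)] using 2(2) by (simp add: add_divide_distrib)
      next
        case 3
        then show ?thesis using y by (simp add: f cell_coords_def)
      qed
    qed
  qed
qed

text \<open>For fixed \<open>w\<close> the piece is a simplex whose size is
  \<open>\<epsilon>\<close> minus the squared length of \<open>w\<close>. Subtracting its barycentre
  turns it into the set where \<open>simplex_gauge\<close> is at most this size; over all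
  \<open>w\<close> these sets fill the unit body of \<open>parab_gauge\<close>, and its boundary is
  where some \<open>u $ j\<close> vanishes.\<close>

lemma homeomorphic_maps_paraboloid_gauge:
  assumes \<epsilon>: "\<epsilon> > 0"
  defines "f \<equiv> \<lambda>(u, w). cell_coords (\<chi> k. if k \<in> J then u $ k - (\<epsilon> - (\<Sum>l<q. w l ^ 2)) / real (r + 1) else 0, w)"
  shows "homeomorphic_maps (top_of_set (paraboloid_cell \<epsilon> q J))
      (top_of_set {y. (\<forall>i\<ge>r + q. y i = 0) \<and> parab_gauge \<epsilon> y \<le> 1}) f
      (\<lambda>y. (\<chi> k. if k \<in> J then simplex_direction y $ k + (\<epsilon> - fiber_norm y) / real (r + 1) else 0, \<lambda>l. if l < q then y (r + l) else 0))"
    and "\<And>c. c \<in> paraboloid_cell \<epsilon> q J \<Longrightarrow> parab_gauge \<epsilon> (f c) = 1 \<longleftrightarrow> (\<exists>j\<in>J. fst c $ j = 0)"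
proof -
  let ?G = "{y. (\<forall>i\<ge>r + q. y i = 0) \<and> parab_gauge \<epsilon> y \<le> 1}"
  let ?n = "\<lambda>w :: nat \<Rightarrow> real. \<Sum>l<q. w l ^ 2"
  let ?h = "\<lambda>y. (\<chi> k. if k \<in> J then simplex_direction y $ k + (\<epsilon> - fiber_norm y) / real (r + 1) else 0, \<lambda>l. if l < q then y (r + l) else 0)"
  have f: "f (u, w) = cell_coords (\<chi> k. if k \<in> J then u $ k - (\<epsilon> - ?n w) / real (r + 1) else 0, w)" for u w
    by (simp add: f_def)
  have sd: "simplex_direction (f (u, w)) = (\<chi> k. if k \<in> J then u $ k - (\<epsilon> - ?n w) / real (r + 1) else 0)"
    if "(u, w) \<in> paraboloid_cell \<epsilon> q J" for u w
    unfolding f using that by (intro simplex_direction_translate) (auto simp: paraboloid_cell_def)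
  have fl: "f (u, w) (r + l) = w l" if "l < q" for u w l
    using that by (simp add: f cell_coords_def)
  have fn: "fiber_norm (f (u, w)) = ?n w" for u w by (simp add: fiber_norm_def fl)
  have sg: "- real (r + 1) * simplex_direction (f (u, w)) $ j = \<epsilon> - ?n w - real (r + 1) * u $ j"
    if "(u, w) \<in> paraboloid_cell \<epsilon> q J" "j \<in> J" for u w j
    using that by (simp add: sd field_simps)
  have le: "simplex_gauge (f (u, w)) \<le> \<epsilon> - ?n w" if c: "(u, w) \<in> paraboloid_cell \<epsilon> q J" for u w
    unfolding simplex_gauge_le using sg[OF c] c by (auto simp: paraboloid_cell_def)
  show "parab_gauge \<epsilon> (f c) = 1 \<longleftrightarrow> (\<exists>j\<in>J. fst c $ j = 0)" if c': "c \<in> paraboloid_cell \<epsilon> q J" for c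
  proof -
    obtain u w where cz: "c = (u, w)" by force
    then have c: "(u, w) \<in> paraboloid_cell \<epsilon> q J" using c' by simp
    have "parab_gauge \<epsilon> (f c) = 1 \<longleftrightarrow> \<epsilon> - ?n w \<le> simplex_gauge (f (u, w))"
      unfolding parab_gauge_compare[OF \<epsilon>] cz fn using le[OF c] by linarith
    also have "\<dots> \<longleftrightarrow> (\<exists>j\<in>J. real (r + 1) * u $ j \<le> 0)"
      unfolding simplex_gauge_ge using sg[OF c] by auto
    also have "\<dots> \<longleftrightarrow> (\<exists>j\<in>J. u $ j = 0)"
    proof -
      have "real (r + 1) * u $ j \<le> 0 \<longleftrightarrow> u $ j \<le> 0" for j by (simp add: mult_le_0_iff)
      moreover have "0 \<le> u $ j" for j using c by (simp add: paraboloid_cell_def)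
      ultimately show ?thesis by (metis order_antisym order_refl)
    qed
    finally show ?thesis using cz by simp
  qed
  show "homeomorphic_maps (top_of_set (paraboloid_cell \<epsilon> q J)) (top_of_set ?G) f ?h"
    unfolding homeomorphic_maps_def
  proof (intro conjI ballI)
    have c1: "continuous_on S (\<lambda>x :: (real ^ 'n) \<times> (nat \<Rightarrow> real). snd x l)" for S l
      by (intro continuous_on_product_then_coordinatewise[OF continuous_on_snd] continuous_on_id)
    have "continuous_on (paraboloid_cell \<epsilon> q J) f"
      unfolding f_def split_beta
    proof (rule continuous_on_cell_coords)
      show "continuous_on (paraboloid_cell \<epsilon> q J) (\<lambda>x. fst (\<chi> k. if k \<in> J then fst x $ k - (\<epsilon> - (\<Sum>l<q. snd x l ^ 2)) / real (r + 1) else 0, snd x) $ j)" for j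
        by (cases "j \<in> J") (auto intro!: continuous_intros c1)
    qed (simp add: c1)
    then show "continuous_map (top_of_set (paraboloid_cell \<epsilon> q J)) (top_of_set ?G) f"
    proof -
      assume cont: "continuous_on (paraboloid_cell \<epsilon> q J) f"
      have "f x \<in> ?G" if x: "x \<in> paraboloid_cell \<epsilon> q J" for x
      proof -
        obtain u w where "x = (u, w)" by force
        then show ?thesis using le[of u w] x parab_gauge_compare(1)[OF \<epsilon>, of "f (u, w)"] fn[of u w]
          by (simp add: f cell_coords_def)
      qed
      then show ?thesis using cont by (auto simp: continuous_map_in_subtopology)
    qed
    have ch1: "continuous_on ?G (\<lambda>y. fst (?h y))"
      unfolding fst_conv
    proof (rule continuous_on_vec_lambda)
      show "continuous_on ?G (\<lambda>y. if k \<in> J then simplex_direction y $ k + (\<epsilon> - fiber_norm y) / real (r + 1) else 0)" for k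
        unfolding fiber_norm_def
        by (cases "k \<in> J") (auto intro!: continuous_intros continuous_simplex_direction continuous_on_product_then_coordinatewise[OF continuous_on_id])
    qed
    have ch2: "continuous_on ?G (\<lambda>y. snd (?h y))"
    proof (rule continuous_on_coordinatewise_then_product)
      show "continuous_on ?G (\<lambda>y. snd (?h y) l)" for l
        by (cases "l < q") (auto intro!: continuous_on_product_then_coordinatewise[OF continuous_on_id])
    qed
    have "continuous_on ?G ?h" using continuous_on_Pair[OF ch1 ch2] by simp
    moreover have "?h y \<in> paraboloid_cell \<epsilon> q J" if "y \<in> ?G" for y
    proof -
      have "simplex_gauge y \<le> \<epsilon> - fiber_norm y" using that parab_gauge_compare[OF \<epsilon>, of y] by simp
      then have "\<forall>j\<in>J. - real (r + 1) * simplex_direction y $ j \<le> \<epsilon> - fiber_norm y" unfolding simplex_gauge_le .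
      then have "\<forall>j\<in>J. 0 \<le> simplex_direction y $ j + (\<epsilon> - fiber_norm y) / real (r + 1)" using nonneg_add_divide by blast
      then show ?thesis
        by (auto simp: paraboloid_cell_def sum.distrib sum_simplex_direction card_J fiber_norm_def)
    qed
    ultimately show "continuous_map (top_of_set ?G) (top_of_set (paraboloid_cell \<epsilon> q J)) ?h"
      by (auto simp: continuous_map_in_subtopology)
    fix x assume "x \<in> topspace (top_of_set (paraboloid_cell \<epsilon> q J))"
    moreover obtain u w where x: "x = (u, w)" by force
    ultimately have c: "(u, w) \<in> paraboloid_cell \<epsilon> q J" by simp
    have "fst (?h (f x)) = u"
      using c unfolding x by (simp add: Finite_Cartesian_Product.vec_eq_iff sd fn paraboloid_cell_def)
    moreover have "snd (?h (f x)) = w"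
      using c unfolding x by (auto simp: fl fun_eq_iff paraboloid_cell_def)
    ultimately show "?h (f x) = x" using x by (metis prod.collapse fst_conv snd_conv)
  next
    fix y assume y: "y \<in> topspace (top_of_set ?G)"
    have n: "?n (\<lambda>l. if l < q then y (r + l) else 0) = fiber_norm y" by (simp add: fiber_norm_def)
    show "f (?h y) = y"
    proof
      fix i
      consider "i < r" | l where "i = r + l" "l < q" | "i \<ge> r + q"
        by (metis add_diff_inverse_nat nat_add_left_cancel_less not_le)
      then show "f (?h y) i = y i"
      proof cases
        case 1
        then show ?thesis using e_in[of i] unfolding f n by (simp add: cell_coords_def simplex_direction_e)
      next
        case 2
        then show ?thesis by (simp add: fl)
      next
        case 3
        then show ?thesis using y by (simp add: f cell_coords_def)
      qed
    qed
  qed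
qed

text \<open>In gauge coordinates a radial map to the Euclidean norm takes the unit body to the ball
  and level 1 to the sphere.\<close>

lemma closed_cell_simplex_cube_aux: "closed_cell (r + q) (simplex_cube q J) (simplex_cube_boundary q J)"
proof -
  let ?g = "\<lambda>y. max (simplex_gauge y) (cube_gauge y)"
  let ?N = "\<lambda>y :: nat \<Rightarrow> real. sqrt (\<Sum>i<r + q. y i ^ 2)"
  obtain f f' where f: "homeomorphic_maps (simplex_cube q J)
      (top_of_set {y. (\<forall>i\<ge>r + q. y i = 0) \<and> ?g y \<le> 1}) f f'"
    and fb: "\<And>c. c \<in> topspace (simplex_cube q J) \<Longrightarrow> c \<in> simplex_cube_boundary q J \<longleftrightarrow> ?g (f c) = 1"
    using homeomorphic_maps_simplex_cube_gauge by blast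
  let ?r = "radial_map ?g ?N" and ?r' = "radial_map ?N ?g"
  have "homeomorphic_maps (simplex_cube q J) (top_of_set {y. (\<forall>i\<ge>r + q. y i = 0) \<and> ?N y \<le> 1}) (?r \<circ> f) (f' \<circ> ?r')"
    by (rule homeomorphic_maps_compose[OF conjI[OF f homeomorphic_maps_radial_map[OF gauge_on_max gauge_on_norm]]])
  moreover have "top_of_set {y. (\<forall>i\<ge>r + q. y i = 0) \<and> ?N y \<le> 1} =
      subtopology (Euclidean_space (r + q)) {y. (\<Sum>i<r + q. y i ^ 2) \<le> 1}"
    unfolding Euclidean_space_eq_top_of_set subtopology_subtopology by (auto intro: arg_cong[where f=top_of_set])
  ultimately have hm: "homeomorphic_maps (simplex_cube q J) (subtopology (Euclidean_space (r + q)) {y. (\<Sum>i<r + q. y i ^ 2) \<le> 1}) (?r \<circ> f) (f' \<circ> ?r')"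
    by simp
  then have "homeomorphic_map (simplex_cube q J) (subtopology (Euclidean_space (r + q)) {y. (\<Sum>i<r + q. y i ^ 2) \<le> 1}) (?r \<circ> f)"
    using homeomorphic_maps_map by blast
  moreover have sub: "simplex_cube_boundary q J \<subseteq> topspace (simplex_cube q J)"
    by (auto simp: simplex_cube_boundary_def topspace_simplex_cube rel_frontier_coord_simplex)
  moreover have "(?r \<circ> f) ` simplex_cube_boundary q J = {y \<in> topspace (Euclidean_space (r + q)). (\<Sum>i<r + q. y i ^ 2) = 1}"
  proof (intro subset_antisym subsetI)
    have fin: "\<forall>i\<ge>r + q. f c i = 0" if "c \<in> topspace (simplex_cube q J)" for c
      using f that unfolding homeomorphic_maps_def continuous_map_in_subtopology by auto
    fix y
    {
      assume "y \<in> (?r \<circ> f) ` simplex_cube_boundary q J"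
      then obtain c where c: "c \<in> simplex_cube_boundary q J" "y = ?r (f c)" by auto
      then have ct: "c \<in> topspace (simplex_cube q J)" using sub by blast
      then have "?N y = 1" "\<forall>i\<ge>r + q. y i = 0"
        using radial_map[OF gauge_on_max gauge_on_norm fin[OF ct]] c fb[OF ct] by metis+
      then show "y \<in> {y \<in> topspace (Euclidean_space (r + q)). (\<Sum>i<r + q. y i ^ 2) = 1}"
        by (simp add: topspace_Euclidean_space)
    }
    {
      assume y: "y \<in> {y \<in> topspace (Euclidean_space (r + q)). (\<Sum>i<r + q. y i ^ 2) = 1}"
      then have yt: "y \<in> topspace (subtopology (Euclidean_space (r + q)) {y. (\<Sum>i<r + q. y i ^ 2) \<le> 1})" by simp
      define c where "c = (f' \<circ> ?r') y"
      have ct: "c \<in> topspace (simplex_cube q J)" and cy: "(?r \<circ> f) c = y"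
        using hm yt unfolding homeomorphic_maps_def c_def continuous_map_def by auto
      have "?g (f c) = ?N y" using radial_map(2)[OF gauge_on_max gauge_on_norm fin[OF ct]] cy by simp
      then have "c \<in> simplex_cube_boundary q J" using fb[OF ct] y by simp
      then show "y \<in> (?r \<circ> f) ` simplex_cube_boundary q J" using cy by blast
    }
  qed
  ultimately show ?thesis unfolding closed_cell_def by blast
qed

text \<open>Both bodies are star-shaped in the same coordinates, so the radial map between their
  gauges identifies them together with their boundaries.\<close>

lemma simplex_cube_paraboloid_aux:
  assumes \<epsilon>: "\<epsilon> > 0"
  shows "\<exists>\<theta> \<eta>. homeomorphic_maps (simplex_cube q J) (top_of_set (paraboloid_cell \<epsilon> q J)) \<theta> \<eta> \<and>
    (\<forall>c\<in>topspace (simplex_cube q J). c \<in> simplex_cube_boundary q J \<longleftrightarrow> (\<exists>j\<in>J. fst (\<theta> c) $ j = 0))"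
proof -
  let ?g = "\<lambda>y. max (simplex_gauge y) (cube_gauge y)"
  let ?N = "parab_gauge \<epsilon>"
  obtain f f' where f: "homeomorphic_maps (simplex_cube q J)
      (top_of_set {y. (\<forall>i\<ge>r + q. y i = 0) \<and> ?g y \<le> 1}) f f'"
    and fb: "\<And>c. c \<in> topspace (simplex_cube q J) \<Longrightarrow> c \<in> simplex_cube_boundary q J \<longleftrightarrow> ?g (f c) = 1"
    using homeomorphic_maps_simplex_cube_gauge by blast
  obtain p p' where p: "homeomorphic_maps (top_of_set (paraboloid_cell \<epsilon> q J))
      (top_of_set {y. (\<forall>i\<ge>r + q. y i = 0) \<and> ?N y \<le> 1}) p p'"
    and pb: "\<And>c. c \<in> paraboloid_cell \<epsilon> q J \<Longrightarrow> ?N (p c) = 1 \<longleftrightarrow> (\<exists>j\<in>J. fst c $ j = 0)"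
    using homeomorphic_maps_paraboloid_gauge[OF \<epsilon>] by blast
  let ?r = "radial_map ?g ?N" and ?r' = "radial_map ?N ?g"
  have fr: "homeomorphic_maps (simplex_cube q J) (top_of_set {y. (\<forall>i\<ge>r + q. y i = 0) \<and> ?N y \<le> 1}) (?r \<circ> f) (f' \<circ> ?r')"
    by (rule homeomorphic_maps_compose[OF conjI[OF f homeomorphic_maps_radial_map[OF gauge_on_max gauge_on_parab[OF \<epsilon>]]]])
  have hm: "homeomorphic_maps (simplex_cube q J) (top_of_set (paraboloid_cell \<epsilon> q J)) (p' \<circ> (?r \<circ> f)) ((f' \<circ> ?r') \<circ> p)"
    by (rule homeomorphic_maps_compose[OF conjI[OF fr]]) (use p homeomorphic_maps_sym in blast)
  have "c \<in> simplex_cube_boundary q J \<longleftrightarrow> (\<exists>j\<in>J. fst ((p' \<circ> (?r \<circ> f)) c) $ j = 0)"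
    if c: "c \<in> topspace (simplex_cube q J)" for c
  proof -
    have fin: "\<forall>i\<ge>r + q. f c i = 0"
      using f c unfolding homeomorphic_maps_def continuous_map_in_subtopology by auto
    have "continuous_map (simplex_cube q J) (top_of_set {y. (\<forall>i\<ge>r + q. y i = 0) \<and> ?N y \<le> 1}) (?r \<circ> f)"
      using fr unfolding homeomorphic_maps_def by (rule conjunct1)
    from funcset_mem[OF continuous_map_funspace[OF this] c]
    have y: "?r (f c) \<in> topspace (top_of_set {y. (\<forall>i\<ge>r + q. y i = 0) \<and> ?N y \<le> 1})" unfolding o_apply .
    have p1: "continuous_map (top_of_set {y. (\<forall>i\<ge>r + q. y i = 0) \<and> ?N y \<le> 1}) (top_of_set (paraboloid_cell \<epsilon> q J)) p'"
      and p2: "\<forall>y\<in>topspace (top_of_set {y. (\<forall>i\<ge>r + q. y i = 0) \<and> ?N y \<le> 1}). p (p' y) = y"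
      using p unfolding homeomorphic_maps_def by simp_all
    have "p' (?r (f c)) \<in> paraboloid_cell \<epsilon> q J"
      using funcset_mem[OF continuous_map_funspace[OF p1] y] unfolding topspace_euclidean_subtopology .
    moreover have "p (p' (?r (f c))) = ?r (f c)"
      using p2 y by (rule bspec)
    ultimately have P: "(p' \<circ> (?r \<circ> f)) c \<in> paraboloid_cell \<epsilon> q J" and pP: "p ((p' \<circ> (?r \<circ> f)) c) = ?r (f c)"
      unfolding o_apply .
    have "(\<exists>j\<in>J. fst ((p' \<circ> (?r \<circ> f)) c) $ j = 0) \<longleftrightarrow> ?N (?r (f c)) = 1"
      using pb[OF P] unfolding pP by (rule sym)
    also have "\<dots> \<longleftrightarrow> ?g (f c) = 1"
      using radial_map(2)[OF gauge_on_max gauge_on_parab[OF \<epsilon>] fin] by simp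
    finally show ?thesis using fb[OF c] by blast
  qed
  with hm show ?thesis by blast
qed

end

lemma closed_cell_simplex_cube:
  assumes "card J = r + 1"
  shows "closed_cell (r + q) (simplex_cube q J) (simplex_cube_boundary q (J :: 'n::finite set))"
proof -
  obtain e where "bij_betw e {..r} J"
    using ex_bij_betw_nat_finite[of J] assms by (auto simp: atLeast0LessThan lessThan_Suc_atMost)
  then show ?thesis by (rule closed_cell_simplex_cube_aux)
qed

lemma simplex_cube_paraboloid:
  assumes "card J = r + 1" "\<epsilon> > 0"
  obtains \<theta> \<eta> where "homeomorphic_maps (simplex_cube q J) (top_of_set (paraboloid_cell \<epsilon> q J)) \<theta> \<eta>"
    "\<And>c. c \<in> topspace (simplex_cube q J) \<Longrightarrow> c \<in> simplex_cube_boundary q (J :: 'n::finite set) \<longleftrightarrow> (\<exists>j\<in>J. fst (\<theta> c) $ j = 0)"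
proof -
  obtain e where "bij_betw e {..r} J"
    using ex_bij_betw_nat_finite[of J] assms by (auto simp: atLeast0LessThan lessThan_Suc_atMost)
  then show ?thesis using simplex_cube_paraboloid_aux[OF _ assms(2)] that by metis
qed

section \<open>Attaching the core\<close>

text \<open>The pasting lemma, with pieces given as compact images under \<open>\<kappa>\<close>. In
  a Hausdorff space the images of their closed subsets are closed, so continuity can be tested
  before applying \<open>\<kappa>\<close>.\<close>

lemma continuous_map_finite_closed_cover:
  fixes \<kappa> :: "'b::topological_space \<Rightarrow> 'a::t2_space"
  assumes Y: "closedin (top_of_set X) Y" and J: "finite J"
    and D: "\<And>j. j \<in> J \<Longrightarrow> compact (D j)" and \<kappa>: "\<And>j. j \<in> J \<Longrightarrow> continuous_on (D j) \<kappa>"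
    and X: "X = Y \<union> (\<Union>j\<in>J. \<kappa> ` D j)"
    and hY: "continuous_map (top_of_set Y) W h"
    and hD: "\<And>j. j \<in> J \<Longrightarrow> continuous_map (top_of_set (D j)) W (\<lambda>z. h (\<kappa> z))"
  shows "continuous_map (top_of_set X) W h"
  unfolding continuous_map_closedin
proof (intro conjI allI impI ballI)
  show "h \<in> topspace (top_of_set X) \<rightarrow> topspace W"
    using X continuous_map_mem[OF hY] continuous_map_mem[OF hD] by auto
  fix V assume V: "closedin W V"
  have "{x \<in> topspace (top_of_set X). h x \<in> V} = {y \<in> Y. h y \<in> V} \<union> (\<Union>j\<in>J. \<kappa> ` {z \<in> D j. h (\<kappa> z) \<in> V})"
    using X by auto
  moreover have "closedin (top_of_set X) {y \<in> Y. h y \<in> V}"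
  proof -
    have "closedin (top_of_set Y) {y \<in> topspace (top_of_set Y). h y \<in> V}"
      by (rule closedin_continuous_map_preimage[OF hY V])
    then show ?thesis using closedin_trans[OF _ Y] by simp
  qed
  moreover have "closedin (top_of_set X) (\<Union>j\<in>J. \<kappa> ` {z \<in> D j. h (\<kappa> z) \<in> V})"
  proof (intro closedin_Union ballI finite_imageI J, clarify)
    fix j assume j: "j \<in> J"
    have "closedin (top_of_set (D j)) {z \<in> topspace (top_of_set (D j)). h (\<kappa> z) \<in> V}"
      by (rule closedin_continuous_map_preimage[OF hD[OF j] V])
    then have "compact {z \<in> D j. h (\<kappa> z) \<in> V}"
      using closedin_compact[OF D[OF j]] by simp
    then have "compact (\<kappa> ` {z \<in> D j. h (\<kappa> z) \<in> V})"
      by (intro compact_continuous_image continuous_on_subset[OF \<kappa>[OF j]]) auto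
    then show "closedin (top_of_set X) (\<kappa> ` {z \<in> D j. h (\<kappa> z) \<in> V})"
      using X j by (intro closed_subset compact_imp_closed) auto
  qed
  ultimately show "closedin (top_of_set X) {x \<in> topspace (top_of_set X). h x \<in> V}" by auto
qed

lemma continuous_on_Min_image:
  fixes f :: "'i \<Rightarrow> 'a::topological_space \<Rightarrow> real"
  assumes "finite I" "I \<noteq> {}" "\<And>i. i \<in> I \<Longrightarrow> continuous_on S (f i)"
  shows "continuous_on S (\<lambda>x. Min ((\<lambda>i. f i x) ` I))"
  using assms
proof (induction I rule: finite_ne_induct)
  case (insert i I)
  then have "continuous_on S (\<lambda>x. min (f i x) (Min ((\<lambda>i. f i x) ` I)))"
    by (intro continuous_on_min) auto
  then show ?case using insert by simp
qed simp

section \<open>The core, its cover by parts, lifting and lowering\<close>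

definition core_cone :: "real \<Rightarrow> nat \<Rightarrow> nat \<Rightarrow> 'n::finite set \<Rightarrow> ((real ^ 'n) \<times> (nat \<Rightarrow> real)) set" where
  "core_cone \<epsilon> r q I = {(u, w). (\<forall>i. 0 \<le> u $ i) \<and> (\<forall>i. i \<notin> I \<longrightarrow> u $ i = 0) \<and> card {i. u $ i \<noteq> 0} \<le> r \<and>
     (\<forall>l\<ge>q. w l = 0) \<and> (\<Sum>i\<in>UNIV. u $ i) + (\<Sum>l<q. w l ^ 2) \<le> \<epsilon>}"

text \<open>How far the local model lies below its value at the stationary point, see
  \<open>local_model_\<kappa>\<close>.\<close>

definition core_height :: "nat \<Rightarrow> (real ^ 'n::finite) \<times> (nat \<Rightarrow> real) \<Rightarrow> real" where
  "core_height q z = (\<Sum>i\<in>UNIV. fst z $ i) + (\<Sum>l<q. snd z l ^ 2)"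

definition lift_core :: "real \<Rightarrow> nat \<Rightarrow> 'n::finite \<Rightarrow> real \<Rightarrow> (real ^ 'n) \<times> (nat \<Rightarrow> real) \<Rightarrow> (real ^ 'n) \<times> (nat \<Rightarrow> real)" where
  "lift_core \<epsilon> q p t z = (fst z + (t * (\<epsilon> - core_height q z)) *\<^sub>R axis p 1, snd z)"

definition subtract_min :: "'n::finite set \<Rightarrow> (real ^ 'n) \<times> (nat \<Rightarrow> real) \<Rightarrow> (real ^ 'n) \<times> (nat \<Rightarrow> real)" where
  "subtract_min J z = (\<chi> i. if i \<in> J then fst z $ i - Min ((\<lambda>j. fst z $ j) ` J) else 0, snd z)"

context
  fixes \<epsilon> :: real and r q :: nat and I :: "'n::finite set" and p :: 'n
    and Js and P DJ :: "'n set \<Rightarrow> ((real ^ 'n) \<times> (nat \<Rightarrow> real)) set"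
  assumes \<epsilon>: "\<epsilon> > 0" and pI: "p \<in> I" and rI: "r + 1 \<le> card I"
  defines "Js \<equiv> {J. J \<subseteq> I \<and> p \<in> J \<and> card J = r + 1}"
    and "P \<equiv> paraboloid_cell \<epsilon> q"
    and "DJ \<equiv> \<lambda>J. {z \<in> core_cone \<epsilon> r q I. \<forall>i. i \<notin> J \<longrightarrow> fst z $ i = 0}"
begin

abbreviation "supp z \<equiv> {i. fst z $ i \<noteq> (0::real)}"

lemma Js_nonempty: "J \<in> Js \<Longrightarrow> finite J \<and> J \<noteq> {} \<and> p \<in> J \<and> J \<subseteq> I \<and> card J = r + 1"
  by (auto simp: Js_def)

text \<open>The support together with \<open>p\<close> has at most \<open>r + 1\<close> elements and
  can be enlarged inside \<open>I\<close> to a set of exactly that size.\<close>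

lemma core_cone_cover: "core_cone \<epsilon> r q I = (\<Union>J\<in>Js. DJ J)"
proof
  show "core_cone \<epsilon> r q I \<subseteq> (\<Union>J\<in>Js. DJ J)"
  proof
    fix z assume z: "z \<in> core_cone \<epsilon> r q I"
    have "insert p (supp z) \<subseteq> I" "card (insert p (supp z)) \<le> r + 1"
      using z pI by (auto simp: core_cone_def card_insert_if)
    then obtain J where "insert p (supp z) \<subseteq> J" "J \<subseteq> I" "card J = r + 1"
      using exists_subset_between[of "insert p (supp z)" "r + 1" I] rI by auto
    then have "J \<in> Js" "z \<in> DJ J" using z by (auto simp: Js_def DJ_def)
    then show "z \<in> (\<Union>J\<in>Js. DJ J)" by blast
  qed
qed (auto simp: DJ_def)

lemma core_height_P: "z \<in> P J \<Longrightarrow> core_height q z = \<epsilon>"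
proof -
  assume z: "z \<in> P J"
  have "(\<Sum>i\<in>UNIV. fst z $ i) = (\<Sum>i\<in>J. fst z $ i)"
    using z by (intro sum.mono_neutral_right) (auto simp: P_def paraboloid_cell_def)
  then show ?thesis using z by (auto simp: P_def paraboloid_cell_def core_height_def)
qed

lemma P_iff: "z \<in> P J \<longleftrightarrow> (\<forall>i. 0 \<le> fst z $ i) \<and> (\<forall>i. i \<notin> J \<longrightarrow> fst z $ i = 0) \<and> (\<forall>l\<ge>q. snd z l = 0) \<and> core_height q z = \<epsilon>"
proof -
  have "(\<Sum>i\<in>UNIV. fst z $ i) = (\<Sum>i\<in>J. fst z $ i)" if "\<forall>i. i \<notin> J \<longrightarrow> fst z $ i = 0"
    using that by (intro sum.mono_neutral_right) auto
  then show ?thesis by (cases z) (auto simp: P_def paraboloid_cell_def core_height_def)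
qed

text \<open>If all coordinates off the \<open>r + 1\<close> elements of \<open>J\<close> are zero,
  having at most \<open>r\<close> nonzero ones means that some coordinate on \<open>J\<close>
  vanishes. This is also the condition under which \<open>subtract_min\<close> changes
  nothing.\<close>

lemma DJ_iff: "J \<in> Js \<Longrightarrow> z \<in> DJ J \<longleftrightarrow> (\<forall>i. 0 \<le> fst z $ i) \<and> (\<forall>i. i \<notin> J \<longrightarrow> fst z $ i = 0) \<and> (\<forall>l\<ge>q. snd z l = 0) \<and>
    core_height q z \<le> \<epsilon> \<and> (\<exists>j\<in>J. fst z $ j = 0)"
proof -
  assume J: "J \<in> Js"
  have "card (supp z) \<le> r \<longleftrightarrow> (\<exists>j\<in>J. fst z $ j = 0)" if "\<forall>i. i \<notin> J \<longrightarrow> fst z $ i = 0"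
  proof
    assume "card (supp z) \<le> r"
    then have "supp z \<noteq> J" using Js_nonempty[OF J] by auto
    then show "\<exists>j\<in>J. fst z $ j = 0" using that by auto
  next
    assume "\<exists>j\<in>J. fst z $ j = 0"
    then have "supp z \<subset> J" using that by auto
    then have "card (supp z) < card J" by (intro psubset_card_mono) auto
    then show "card (supp z) \<le> r" using Js_nonempty[OF J] by simp
  qed
  then show ?thesis using Js_nonempty[OF J]
    by (cases z) (auto simp: DJ_def core_cone_def core_height_def)
qed

lemma Min_eq_0: "J \<in> Js \<Longrightarrow> \<forall>i. 0 \<le> fst z $ i \<Longrightarrow> j \<in> J \<Longrightarrow> fst z $ j = 0 \<Longrightarrow> Min ((\<lambda>j. fst z $ j) ` J) = (0::real)"
  using Js_nonempty[of J] by (intro Min_eqI) auto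

lemma subtract_min_eq:
  assumes J: "J \<in> Js" and nn: "\<forall>i. 0 \<le> fst z $ i" and out: "\<forall>i. i \<notin> J \<longrightarrow> fst z $ i = 0" and j: "j \<in> J" "fst z $ j = 0"
  shows "subtract_min J z = z"
  unfolding subtract_min_def Min_eq_0[OF J nn j]
  using out by (cases z) (auto simp: Finite_Cartesian_Product.vec_eq_iff)

lemma subtract_min_DJ:
  assumes J: "J \<in> Js" and nn: "\<forall>i. 0 \<le> fst z $ i" and out: "\<forall>i. i \<notin> J \<longrightarrow> fst z $ i = 0"
    and w: "\<forall>l\<ge>q. snd z l = 0" and h: "core_height q z \<le> \<epsilon>"
  shows "subtract_min J z \<in> DJ J"
proof -
  let ?m = "Min ((\<lambda>j. fst z $ j) ` J)"
  have m: "?m \<in> (\<lambda>j. fst z $ j) ` J" using Js_nonempty[OF J] by (intro Min_in) auto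
  have mle: "?m \<le> fst z $ j" if "j \<in> J" for j using that by (intro Min_le) auto
  have m0: "0 \<le> ?m" using m nn by auto
  have "core_height q (subtract_min J z) \<le> core_height q z"
    unfolding core_height_def
    by (intro add_mono sum_mono) (use nn m0 in \<open>auto simp: subtract_min_def\<close>)
  moreover obtain j where "j \<in> J" "?m = fst z $ j" using m by blast
  ultimately show ?thesis
    unfolding DJ_iff[OF J] using mle w h
    by (auto simp: subtract_min_def intro!: bexI[of _ j])
qed

lemma core_height_lift: "core_height q (lift_core \<epsilon> q p t z) = core_height q z + t * (\<epsilon> - core_height q z)"
  by (simp add: lift_core_def core_height_def[of q "(_, _)"] sum.distrib axis_def if_distrib[of "(*) _"] cong: if_cong)
    (simp add: core_height_def)

lemma lift_core_props:
  assumes J: "J \<in> Js" and z: "z \<in> DJ J" and t: "t \<in> {0..1}"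
  shows "\<forall>i. 0 \<le> fst (lift_core \<epsilon> q p t z) $ i" "\<forall>i. i \<notin> J \<longrightarrow> fst (lift_core \<epsilon> q p t z) $ i = 0"
    "\<forall>l\<ge>q. snd (lift_core \<epsilon> q p t z) l = 0" "core_height q (lift_core \<epsilon> q p t z) \<le> \<epsilon>"
proof -
  have h: "core_height q z \<le> \<epsilon>" using z DJ_iff[OF J] by blast
  then have "0 \<le> t * (\<epsilon> - core_height q z)" using t by simp
  then show "\<forall>i. 0 \<le> fst (lift_core \<epsilon> q p t z) $ i"
    using z unfolding DJ_iff[OF J] by (auto simp: lift_core_def axis_def)
  show "\<forall>i. i \<notin> J \<longrightarrow> fst (lift_core \<epsilon> q p t z) $ i = 0" "\<forall>l\<ge>q. snd (lift_core \<epsilon> q p t z) l = 0"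
    using z Js_nonempty[OF J] unfolding DJ_iff[OF J] by (auto simp: lift_core_def axis_def)
  have "t * (\<epsilon> - core_height q z) \<le> 1 * (\<epsilon> - core_height q z)" using t h by (intro mult_right_mono) auto
  then show "core_height q (lift_core \<epsilon> q p t z) \<le> \<epsilon>" unfolding core_height_lift by simp
qed

lemma lift_core_P: "J \<in> Js \<Longrightarrow> z \<in> DJ J \<Longrightarrow> lift_core \<epsilon> q p 1 z \<in> P J"
  using lift_core_props[of J z 1] unfolding P_iff core_height_lift by auto

text \<open>Lifting changes only the coordinate at \<open>p\<close>, which belongs to both sets, so
  the support stays in \<open>J'\<close>; and \<open>J\<close>, of the same size, has an element
  outside \<open>J'\<close>. A point of two parts is thus lifted into the boundary faces of both, so
  maps defined part by part agree on overlaps.\<close>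

lemma lift_core_common:
  assumes "J \<in> Js" "J' \<in> Js" "J \<noteq> J'" "z \<in> DJ J" "z \<in> DJ J'" "t \<in> {0..1}"
  shows "\<exists>j\<in>J. fst (lift_core \<epsilon> q p t z) $ j = 0"
proof -
  have "\<not> J \<subseteq> J'"
    using assms(1-3) Js_nonempty card_subset_eq by metis
  then obtain j where "j \<in> J" "j \<notin> J'" by blast
  then show ?thesis using lift_core_props(2)[OF assms(2,5,6)] by auto
qed

lemma lift_core_id: "core_height q z = \<epsilon> \<or> t = 0 \<Longrightarrow> lift_core \<epsilon> q p t z = z"
  by (cases z) (auto simp: lift_core_def)

lemma continuous_on_snd_coord: "continuous_on S (\<lambda>z. snd (f z) l)" if "continuous_on S f"
  for f :: "'z::topological_space \<Rightarrow> (real ^ 'n) \<times> (nat \<Rightarrow> real)"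
  by (rule continuous_on_product_then_coordinatewise[OF continuous_on_snd[OF that]])

lemma continuous_on_lift_core:
  assumes "continuous_on S f" "continuous_on S g"
  shows "continuous_on S (\<lambda>z. lift_core \<epsilon> q p (g z) (f z))"
proof -
  have "continuous_on S (\<lambda>z. snd (f z) l)" for l by (rule continuous_on_snd_coord[OF assms(1)])
  then show ?thesis
    unfolding lift_core_def core_height_def by (intro continuous_intros assms)
qed

lemma continuous_on_subtract_min:
  assumes "J \<in> Js" "continuous_on S f"
  shows "continuous_on S (\<lambda>z. subtract_min J (f z))"
proof -
  have "continuous_on S (\<lambda>z. if i \<in> J then fst (f z) $ i - Min ((\<lambda>j. fst (f z) $ j) ` J) else 0)" for i
    using Js_nonempty[OF assms(1)]
    by (cases "i \<in> J") (auto intro!: continuous_intros continuous_on_Min_image assms)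
  then show ?thesis
    unfolding subtract_min_def by (intro continuous_on_Pair continuous_on_vec_lambda continuous_intros assms)
qed

text \<open>A point of the core is reached from the paraboloid by spreading its missing height
  evenly over \<open>J\<close>. The equality yields compactness of the parts of the core.\<close>

lemma subtract_min_surj: "J \<in> Js \<Longrightarrow> subtract_min J ` P J = DJ J"
proof (intro subset_antisym subsetI)
  assume J: "J \<in> Js"
  {
    fix z assume "z \<in> subtract_min J ` P J"
    then obtain x where "x \<in> P J" "z = subtract_min J x" by blast
    then show "z \<in> DJ J" using subtract_min_DJ[OF J, of x] unfolding P_iff by simp
  }
  fix z assume z: "z \<in> DJ J"
  then obtain j0 where j0: "j0 \<in> J" "fst z $ j0 = 0" using DJ_iff[OF J] by blast
  define a where "a = (\<epsilon> - core_height q z) / real (r + 1)"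
  have nn: "\<forall>i. 0 \<le> fst z $ i" and a0: "0 \<le> a" using z unfolding DJ_iff[OF J] a_def by auto
  define y where "y = ((\<chi> i. if i \<in> J then fst z $ i + a else 0), snd z)"
  have fy: "fst y $ i = (if i \<in> J then fst z $ i + a else 0)" for i by (simp add: y_def)
  have "(\<Sum>i\<in>UNIV. fst y $ i) = (\<Sum>i\<in>UNIV. fst z $ i) + (\<Sum>i\<in>UNIV. if i \<in> J then a else 0)"
    unfolding sum.distrib[symmetric] using z DJ_iff[OF J] by (intro sum.cong) (auto simp: fy)
  also have "(\<Sum>i\<in>UNIV. if i \<in> J then a else 0) = \<epsilon> - core_height q z"
    using Js_nonempty[OF J] by (simp add: sum.If_cases a_def)
  finally have "core_height q y = \<epsilon>" by (simp add: core_height_def y_def)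
  then have "y \<in> P J" unfolding P_iff fy using z a0 unfolding DJ_iff[OF J] by (auto simp: y_def)
  moreover have "Min ((\<lambda>j. fst y $ j) ` J) = a"
    using j0 nn by (intro Min_eqI) (auto simp: fy image_iff intro!: bexI[of _ j0])
  then have "subtract_min J y = z"
    using z unfolding DJ_iff[OF J] by (cases z) (auto simp: subtract_min_def fy Finite_Cartesian_Product.vec_eq_iff y_def)
  ultimately show "z \<in> subtract_min J ` P J" by blast
qed

lemma subtract_min_P: "J \<in> Js \<Longrightarrow> x \<in> P J \<Longrightarrow> subtract_min J x \<in> DJ J"
  using subtract_min_DJ[of J x] unfolding P_iff by simp

lemma subtract_min_P_boundary: "J \<in> Js \<Longrightarrow> x \<in> P J \<Longrightarrow> j \<in> J \<Longrightarrow> fst x $ j = 0 \<Longrightarrow> subtract_min J x = x"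
  using subtract_min_eq[of J x j] unfolding P_iff by simp

lemma subtract_min_core: "J \<in> Js \<Longrightarrow> z \<in> DJ J \<Longrightarrow> subtract_min J z = z"
  using subtract_min_eq[of J z] unfolding DJ_iff by blast

lemma snd_subtract_min [simp]: "snd (subtract_min J x) = snd x"
  by (simp add: subtract_min_def)

lemma snd_lift_core [simp]: "snd (lift_core \<epsilon> q p t x) = snd x"
  by (simp add: lift_core_def)

lemma core_height_convex: "core_height q ((1 - t) *\<^sub>R a + t *\<^sub>R b, w) = (1 - t) * core_height q (a, w) + t * core_height q (b, w)"
proof -
  have "(\<Sum>i\<in>UNIV. ((1 - t) *\<^sub>R a + t *\<^sub>R b) $ i) = (1 - t) * (\<Sum>i\<in>UNIV. a $ i) + t * (\<Sum>i\<in>UNIV. b $ i)"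
    by (simp add: sum.distrib sum_distrib_left)
  then show ?thesis by (simp add: core_height_def algebra_simps)
qed

text \<open>With the second component fixed, a piece is convex, because \<open>core_height\<close>
  is affine in the first. So the segment from a point to its lowered and lifted image stays in the
  piece.\<close>

lemma mix_P:
  assumes J: "J \<in> Js" and x: "x \<in> P J" and t: "t \<in> {0..1}"
  shows "((1 - t) *\<^sub>R fst x + t *\<^sub>R fst (lift_core \<epsilon> q p 1 (subtract_min J x)), snd x) \<in> P J"
proof -
  let ?y = "lift_core \<epsilon> q p 1 (subtract_min J x)"
  have y: "?y \<in> P J" by (rule lift_core_P[OF J subtract_min_P[OF J x]])
  have "core_height q (fst x, snd x) = \<epsilon>" "core_height q (fst ?y, snd x) = \<epsilon>"
    using core_height_P[OF x] core_height_P[OF y] by (simp_all add: core_height_def)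
  then have "core_height q ((1 - t) *\<^sub>R fst x + t *\<^sub>R fst ?y, snd x) = \<epsilon>"
    unfolding core_height_convex by (simp add: algebra_simps)
  then show ?thesis using x y t unfolding P_iff by simp
qed

text \<open>The attaching map is the lowering of a piece into the core. On the boundary of the piece
  lowering is the identity and the height is \<open>\<epsilon>\<close>, so the image lies in
  \<open>Y\<close>. Lowering the cells and lifting the core are the two maps of the homotopy
  equivalence, both the identity on \<open>Y\<close>.\<close>

proposition attach_core:
  fixes \<kappa> :: "(real ^ 'n) \<times> (nat \<Rightarrow> real) \<Rightarrow> 'a::t2_space"
  assumes Y: "closedin (top_of_set X) Y"
    and \<kappa>: "continuous_on (core_cone \<epsilon> r q I) \<kappa>" and inj: "inj_on \<kappa> (core_cone \<epsilon> r q I)"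
    and X: "X = Y \<union> \<kappa> ` core_cone \<epsilon> r q I"
    and \<kappa>Y: "\<And>z. z \<in> core_cone \<epsilon> r q I \<Longrightarrow> \<kappa> z \<in> Y \<longleftrightarrow> core_height q z = \<epsilon>"
  shows "\<exists>\<phi>. (\<forall>J\<in>Js. continuous_map (subtopology (simplex_cube q J) (simplex_cube_boundary q J)) (top_of_set Y) (\<phi> J)) \<and>
    top_of_set X homotopy_equivalent_space glued_space (top_of_set Y) Js (simplex_cube q) (simplex_cube_boundary q) \<phi>"
proof -
  let ?C = "simplex_cube q :: 'n set \<Rightarrow> _" and ?B = "simplex_cube_boundary q :: 'n set \<Rightarrow> _"
  let ?D = "core_cone \<epsilon> r q I" and ?I = "top_of_set {0..1::real}"
  have cardJ: "card J = r + 1" if "J \<in> Js" for J using that by (simp add: Js_def)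
  have "\<exists>\<theta> \<eta>. homeomorphic_maps (?C J) (top_of_set (P J)) \<theta> \<eta> \<and>
      (\<forall>c\<in>topspace (?C J). c \<in> ?B J \<longleftrightarrow> (\<exists>j\<in>J. fst (\<theta> c) $ j = 0))" if "J \<in> Js" for J
    using simplex_cube_paraboloid[OF cardJ[OF that] \<epsilon>, of q] unfolding P_def by metis
  then obtain \<theta> \<eta> where hm: "\<And>J. J \<in> Js \<Longrightarrow> homeomorphic_maps (?C J) (top_of_set (P J)) (\<theta> J) (\<eta> J)"
    and \<theta>B: "\<And>J c. J \<in> Js \<Longrightarrow> c \<in> topspace (?C J) \<Longrightarrow> c \<in> ?B J \<longleftrightarrow> (\<exists>j\<in>J. fst (\<theta> J c) $ j = 0)"
    by metis
  have c\<theta>: "continuous_map (?C J) (top_of_set (P J)) (\<theta> J)" and c\<eta>: "continuous_map (top_of_set (P J)) (?C J) (\<eta> J)"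
    and \<eta>\<theta>: "\<And>c. c \<in> topspace (?C J) \<Longrightarrow> \<eta> J (\<theta> J c) = c" and \<theta>\<eta>: "\<And>x. x \<in> P J \<Longrightarrow> \<theta> J (\<eta> J x) = x"
    if "J \<in> Js" for J
    using hm[OF that] unfolding homeomorphic_maps_def by simp_all
  have \<theta>P: "\<theta> J c \<in> P J" if "J \<in> Js" "c \<in> topspace (?C J)" for J c
    using continuous_map_mem[OF c\<theta>[OF that(1)] that(2)] by simp
  have \<eta>C: "\<eta> J x \<in> topspace (?C J)" if "J \<in> Js" "x \<in> P J" for J x
    using continuous_map_mem[OF c\<eta>[OF that(1)]] that(2) by simp
  have \<eta>B: "\<eta> J x \<in> ?B J \<longleftrightarrow> (\<exists>j\<in>J. fst x $ j = 0)" if "J \<in> Js" "x \<in> P J" for J x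
    using \<theta>B[OF that(1) \<eta>C[OF that]] \<theta>\<eta>[OF that] by simp
  have DD: "z \<in> ?D" if "J \<in> Js" "z \<in> DJ J" for J z using core_cone_cover that by blast
  have cP: "compact (P J)" if "J \<in> Js" for J
  proof -
    have "compact_space (?C J)"
      unfolding simplex_cube_def compact_space_prod_topology compact_space_product_topology coord_simplex_def
      by (simp add: compact_space_subtopology finite_imp_compact_convex_hull)
    then have "compact_space (top_of_set (P J))"
      using hm[OF that] homeomorphic_compact_space homeomorphic_maps_imp_homeomorphic_space by metis
    then show ?thesis by (simp add: compact_space_def compactin_subtopology)
  qed
  have cDJ: "compact (DJ J)" if "J \<in> Js" for J
    unfolding subtract_min_surj[OF that, symmetric]
    by (intro compact_continuous_image continuous_on_subtract_min[OF that] continuous_on_id cP that)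
  have \<kappa>DJ: "continuous_on (DJ J) \<kappa>" if "J \<in> Js" for J
    using continuous_on_subset[OF \<kappa>] DD[OF that] by blast
  have finJs: "finite Js" by simp
  define \<phi> where "\<phi> J c = \<kappa> (subtract_min J (\<theta> J c))" for J c
  have YX: "Y \<subseteq> X" using X by blast
  have \<kappa>X: "\<kappa> z \<in> X" if "z \<in> ?D" for z using X that by blast
  have smc: "continuous_map (top_of_set (P J)) (top_of_set X) (\<lambda>x. \<kappa> (subtract_min J x))" if J: "J \<in> Js" for J
  proof -
    have "continuous_on (P J) (\<lambda>x. \<kappa> (subtract_min J x))"
      by (rule continuous_on_compose2[OF \<kappa>DJ[OF J] continuous_on_subtract_min[OF J continuous_on_id]])
        (use subtract_min_P[OF J] in blast)
    then show ?thesis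
      using subtract_min_P[OF J] DD[OF J] \<kappa>X by (auto simp: continuous_map_in_subtopology)
  qed
  have c\<phi>: "continuous_map (?C J) (top_of_set X) (\<phi> J)" if J: "J \<in> Js" for J
    using continuous_map_compose[OF c\<theta>[OF J] smc[OF J]] by (simp add: \<phi>_def[abs_def] o_def)
  have \<phi>Y: "\<phi> J \<in> topspace (?C J) \<inter> ?B J \<rightarrow> Y" if J: "J \<in> Js" for J
  proof
    fix c assume c: "c \<in> topspace (?C J) \<inter> ?B J"
    then obtain j where j: "j \<in> J" "fst (\<theta> J c) $ j = 0" using \<theta>B[OF J] by blast
    have x: "\<theta> J c \<in> P J" using \<theta>P[OF J] c by blast
    have "\<theta> J c \<in> DJ J" using subtract_min_P[OF J x] subtract_min_P_boundary[OF J x j] by simp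
    then show "\<phi> J c \<in> Y"
      using \<kappa>Y[OF DD[OF J]] core_height_P[OF x] subtract_min_P_boundary[OF J x j] by (simp add: \<phi>_def)
  qed
  have \<phi>Y': "\<phi> J \<in> topspace (?C J) \<inter> ?B J \<rightarrow> topspace (top_of_set Y)" if "J \<in> Js" for J
    using \<phi>Y[OF that] by simp
  have c\<phi>B: "continuous_map (subtopology (?C J) (?B J)) (top_of_set Y) (\<phi> J)" if J: "J \<in> Js" for J
    using continuous_map_from_subtopology[OF c\<phi>[OF J], of "?B J"] \<phi>Y[OF J]
    by (auto simp: continuous_map_in_subtopology)
  define Z where "Z = glued_space (top_of_set Y) Js ?C ?B \<phi>"
  have topZ: "topspace Z = glued_carrier (top_of_set Y) Js ?C ?B"
    unfolding Z_def by (rule topspace_glued_space) (rule \<phi>Y')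
  have cInl: "continuous_map (top_of_set Y) Z Inl"
    unfolding Z_def by (rule continuous_map_Inl_glued_space) (rule \<phi>Y')
  have cglue: "continuous_map (?C J) Z (glue_map ?B \<phi> J)" if "J \<in> Js" for J
    unfolding Z_def by (rule continuous_map_glue_map[OF _ that]) (rule \<phi>Y')
  have glue_boundary: "glue_map ?B \<phi> J (\<eta> J x) = Inl (\<kappa> x)" if J: "J \<in> Js" and x: "x \<in> P J" and j: "\<exists>j\<in>J. fst x $ j = 0" for J x
  proof -
    have "\<eta> J x \<in> ?B J" using \<eta>B[OF J x] j by simp
    moreover have "subtract_min J x = x" using j subtract_min_P_boundary[OF J x] by blast
    ultimately show ?thesis by (simp add: glue_map_def \<phi>_def \<theta>\<eta>[OF J x])
  qed
  \<comment> \<open>\<open>Jof\<close> selects one part of the cover containing \<open>z\<close>; by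
    \<open>lift_core_common\<close> the maps built from it do not depend on the choice.\<close>
  define Jof where "Jof z = (SOME J. J \<in> Js \<and> z \<in> DJ J)" for z
  have Jof: "Jof z \<in> Js" "z \<in> DJ (Jof z)" if "z \<in> ?D" for z
  proof -
    have "\<exists>J. J \<in> Js \<and> z \<in> DJ J" using that core_cone_cover by blast
    from someI_ex[OF this] show "Jof z \<in> Js" "z \<in> DJ (Jof z)" by (auto simp: Jof_def)
  qed
  define iz where "iz = inv_into ?D \<kappa>"
  have iz: "iz (\<kappa> z) = z" if "z \<in> ?D" for z using inv_into_f_f[OF inj that] by (simp add: iz_def)
  have zero: "\<exists>j\<in>J. fst z $ j = 0" if "J \<in> Js" "z \<in> DJ J" for J z
    using that DJ_iff by blast
  define \<Psi> where "\<Psi> x = (if x \<in> Y then Inl x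
      else glue_map ?B \<phi> (Jof (iz x)) (\<eta> (Jof (iz x)) (lift_core \<epsilon> q p 1 (iz x))))" for x
  have \<Psi>\<kappa>: "\<Psi> (\<kappa> z) = glue_map ?B \<phi> J (\<eta> J (lift_core \<epsilon> q p 1 z))" if J: "J \<in> Js" and z: "z \<in> DJ J" for J z
  proof -
    note zD = DD[OF J z]
    show ?thesis
    proof (cases "\<kappa> z \<in> Y")
      case True
      then have "lift_core \<epsilon> q p 1 z = z" using \<kappa>Y[OF zD] lift_core_id by blast
      then show ?thesis
        using glue_boundary[OF J lift_core_P[OF J z]] zero[OF J z] True by (simp add: \<Psi>_def)
    next
      case False
      let ?J = "Jof z"
      have eq: "\<Psi> (\<kappa> z) = glue_map ?B \<phi> ?J (\<eta> ?J (lift_core \<epsilon> q p 1 z))"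
        using False iz[OF zD] by (simp add: \<Psi>_def)
      show ?thesis
      \<comment> \<open>For two different parts the lifted point is on the boundary of both pieces,
        where both cells are glued to the same point of \<open>Y\<close>.\<close>
      proof (cases "?J = J")
        case False
        have "glue_map ?B \<phi> ?J (\<eta> ?J (lift_core \<epsilon> q p 1 z)) = Inl (\<kappa> (lift_core \<epsilon> q p 1 z))"
          using False lift_core_common[OF Jof(1)[OF zD] J _ Jof(2)[OF zD] z, of 1]
          by (intro glue_boundary lift_core_P Jof zD) auto
        moreover have "glue_map ?B \<phi> J (\<eta> J (lift_core \<epsilon> q p 1 z)) = Inl (\<kappa> (lift_core \<epsilon> q p 1 z))"
          using False lift_core_common[OF J Jof(1)[OF zD] _ z Jof(2)[OF zD], of 1]
          by (intro glue_boundary lift_core_P J z) auto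
        ultimately show ?thesis using eq by simp
      qed (use eq in simp)
    qed
  qed
  have Xcov: "X = Y \<union> (\<Union>J\<in>Js. \<kappa> ` DJ J)" unfolding X core_cone_cover by blast
  have c\<Psi>: "continuous_map (top_of_set X) Z \<Psi>"
  proof (rule continuous_map_finite_closed_cover[OF Y finJs cDJ \<kappa>DJ Xcov])
    show "continuous_map (top_of_set Y) Z \<Psi>"
      by (rule continuous_map_eq[OF cInl]) (simp add: \<Psi>_def)
    fix J assume J: "J \<in> Js"
    have "continuous_on (DJ J) (\<lambda>z. lift_core \<epsilon> q p 1 z)"
      by (intro continuous_on_lift_core continuous_intros)
    then have "continuous_map (top_of_set (DJ J)) (top_of_set (P J)) (\<lambda>z. lift_core \<epsilon> q p 1 z)"
      using lift_core_P[OF J] by (auto simp: continuous_map_in_subtopology)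
    from continuous_map_compose[OF continuous_map_compose[OF this c\<eta>[OF J]] cglue[OF J]]
    have "continuous_map (top_of_set (DJ J)) Z (\<lambda>z. glue_map ?B \<phi> J (\<eta> J (lift_core \<epsilon> q p 1 z)))"
      by (simp add: o_def)
    then show "continuous_map (top_of_set (DJ J)) Z (\<lambda>z. \<Psi> (\<kappa> z))"
      by (rule continuous_map_eq) (simp add: \<Psi>\<kappa>[OF J])
  qed
  define \<Phi> where "\<Phi> v = (case v of Inl y \<Rightarrow> y | Inr (J, c) \<Rightarrow> \<phi> J c)" for v
  have \<Phi>glue: "\<Phi> (glue_map ?B \<phi> J c) = \<phi> J c" for J c
    by (simp add: \<Phi>_def glue_map_def)
  have c\<Phi>: "continuous_map Z (top_of_set X) \<Phi>"
    unfolding Z_def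
  proof (rule continuous_map_from_glued_space[OF \<phi>Y'])
    have "continuous_map (top_of_set Y) (top_of_set X) (\<lambda>y. y)" using YX by (auto simp: continuous_map_in_subtopology)
    then show "continuous_map (top_of_set Y) (top_of_set X) (\<lambda>y. \<Phi> (Inl y))" by (simp add: \<Phi>_def)
  qed (simp_all add: \<Phi>glue c\<phi>)
  \<comment> \<open>Lifting by the fraction \<open>t\<close> of the missing height and then
    lowering: nothing happens at \<open>t = 0\<close>, and \<open>t = 1\<close> is the composite
    through the gluing.\<close>
  define K where "K = (\<lambda>(t, x). if x \<in> Y then x else \<kappa> (subtract_min (Jof (iz x)) (lift_core \<epsilon> q p t (iz x))))"
  have smD: "subtract_min J (lift_core \<epsilon> q p t z) \<in> DJ J" if "J \<in> Js" "z \<in> DJ J" "t \<in> {0..1}" for J z t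
    using lift_core_props[OF that] by (intro subtract_min_DJ that)
  have sm_id: "subtract_min J (lift_core \<epsilon> q p t z) = lift_core \<epsilon> q p t z"
    if "J \<in> Js" "z \<in> DJ J" "t \<in> {0..1}" "\<exists>j\<in>J. fst (lift_core \<epsilon> q p t z) $ j = 0" for J z t
    using that lift_core_props[OF that(1-3)] subtract_min_eq[OF that(1)] by blast
  have K\<kappa>: "K (t, \<kappa> z) = \<kappa> (subtract_min J (lift_core \<epsilon> q p t z))"
    if J: "J \<in> Js" and z: "z \<in> DJ J" and t: "t \<in> {0..1}" for J z t
  proof -
    note zD = DD[OF J z]
    show ?thesis
    proof (cases "\<kappa> z \<in> Y")
      case True
      then have "lift_core \<epsilon> q p t z = z" using \<kappa>Y[OF zD] lift_core_id by blast
      then show ?thesis using subtract_min_core[OF J z] True by (simp add: K_def)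
    next
      case False
      let ?J = "Jof z"
      have eq: "K (t, \<kappa> z) = \<kappa> (subtract_min ?J (lift_core \<epsilon> q p t z))"
        using False iz[OF zD] by (simp add: K_def)
      show ?thesis
      proof (cases "?J = J")
        case False
        have "subtract_min ?J (lift_core \<epsilon> q p t z) = lift_core \<epsilon> q p t z"
          using False lift_core_common[OF Jof(1)[OF zD] J _ Jof(2)[OF zD] z t]
          by (intro sm_id Jof zD t) auto
        moreover have "subtract_min J (lift_core \<epsilon> q p t z) = lift_core \<epsilon> q p t z"
          using False lift_core_common[OF J Jof(1)[OF zD] _ z Jof(2)[OF zD] t]
          by (intro sm_id J z t) auto
        ultimately show ?thesis using eq by simp
      qed (use eq in simp)
    qed
  qed
  have cK: "continuous_map (prod_topology ?I (top_of_set X)) (top_of_set X) K"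
    unfolding prod_topology_subtopology_eu
  proof (rule continuous_map_finite_closed_cover[where \<kappa>="\<lambda>(t, z). (t, \<kappa> z)" and D="\<lambda>J. {0..1} \<times> DJ J" and Y="{0..1} \<times> Y", OF _ finJs])
    have "closedin (prod_topology ?I (top_of_set X)) ({0..1} \<times> Y)"
      unfolding closedin_prod_Times_iff using Y by simp
    then show "closedin (top_of_set ({0..1::real} \<times> X)) ({0..1} \<times> Y)" by simp
    show "({0..1::real} \<times> X) = {0..1} \<times> Y \<union> (\<Union>J\<in>Js. (\<lambda>(t, z). (t, \<kappa> z)) ` ({0..1} \<times> DJ J))"
      unfolding Xcov by force
    have "continuous_on ({0..1::real} \<times> Y) snd" by (intro continuous_intros)
    then have "continuous_map (top_of_set ({0..1::real} \<times> Y)) (top_of_set X) snd"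
      using YX by (auto simp: continuous_map_in_subtopology)
    then show "continuous_map (top_of_set ({0..1::real} \<times> Y)) (top_of_set X) K"
      by (rule continuous_map_eq) (auto simp: K_def)
    fix J assume J: "J \<in> Js"
    show "compact ({0..1::real} \<times> DJ J)" by (intro compact_Times cDJ J) simp
    show "continuous_on ({0..1::real} \<times> DJ J) (\<lambda>(t, z). (t, \<kappa> z))"
      unfolding split_beta
      by (intro continuous_on_Pair continuous_on_fst continuous_on_id continuous_on_compose2[OF \<kappa>DJ[OF J] continuous_on_snd]) auto
    have "continuous_on ({0..1::real} \<times> DJ J) (\<lambda>x. subtract_min J (lift_core \<epsilon> q p (fst x) (snd x)))"
      by (intro continuous_on_subtract_min[OF J] continuous_on_lift_core continuous_on_fst continuous_on_snd continuous_on_id)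
    then have "continuous_on ({0..1::real} \<times> DJ J) (\<lambda>x. \<kappa> (subtract_min J (lift_core \<epsilon> q p (fst x) (snd x))))"
      by (rule continuous_on_compose2[OF \<kappa>DJ[OF J]]) (use smD[OF J] in auto)
    moreover have "\<kappa> (subtract_min J (lift_core \<epsilon> q p (fst x) (snd x))) \<in> X" if "x \<in> {0..1} \<times> DJ J" for x
      using that by (intro \<kappa>X DD[OF J] smD[OF J]) auto
    ultimately have "continuous_map (top_of_set ({0..1::real} \<times> DJ J)) (top_of_set X) (\<lambda>x. \<kappa> (subtract_min J (lift_core \<epsilon> q p (fst x) (snd x))))"
      unfolding continuous_map_in_subtopology by simp
    then show "continuous_map (top_of_set ({0..1::real} \<times> DJ J)) (top_of_set X) (\<lambda>x. K ((\<lambda>(t, z). (t, \<kappa> z)) x))"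
      by (rule continuous_map_eq) (auto simp: K\<kappa>[OF J])
  qed
  have 1: "homotopic_with (\<lambda>_. True) (top_of_set X) (top_of_set X) id (\<Phi> \<circ> \<Psi>)"
  proof (subst homotopic_with, simp, intro exI[of _ K] conjI ballI cK TrueI)
    fix x assume "x \<in> topspace (top_of_set X)"
    then consider "x \<in> Y" | J z where "x = \<kappa> z" "J \<in> Js" "z \<in> DJ J" using Xcov by auto
    then have "K (0, x) = x \<and> K (1, x) = \<Phi> (\<Psi> x)"
    proof cases
      case 1 then show ?thesis by (simp add: K_def \<Psi>_def \<Phi>_def)
    next
      case 2
      have "\<phi> J (\<eta> J (lift_core \<epsilon> q p 1 z)) = \<kappa> (subtract_min J (lift_core \<epsilon> q p 1 z))"
        using \<theta>\<eta>[OF 2(2) lift_core_P[OF 2(2,3)]] by (simp add: \<phi>_def)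
      then show ?thesis
        using 2 K\<kappa>[OF 2(2,3)] lift_core_id[of z 0] subtract_min_core[OF 2(2,3)] \<Psi>\<kappa>[OF 2(2,3)] \<Phi>glue by simp
    qed
    then show "K (0, x) = id x" "K (1, x) = (\<Phi> \<circ> \<Psi>) x" by simp_all
  qed
  \<comment> \<open>On a cell, lowering and lifting is joined to the identity by a segment, which is
    constant on the boundary.\<close>
  define mix where "mix J t x = ((1 - t) *\<^sub>R fst x + t *\<^sub>R fst (lift_core \<epsilon> q p 1 (subtract_min J x)), snd x)" for J t x
  define L where "L = (\<lambda>(t, v). case v of Inl y \<Rightarrow> Inl y | Inr (J, c) \<Rightarrow> glue_map ?B \<phi> J (\<eta> J (mix J t (\<theta> J c))))"
  have Lglue: "L (t, glue_map ?B \<phi> J c) = glue_map ?B \<phi> J (\<eta> J (mix J t (\<theta> J c)))"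
    if J: "J \<in> Js" and c: "c \<in> topspace (?C J)" for J t c
  proof (cases "c \<in> ?B J")
    case True
    then obtain j where j: "j \<in> J" "fst (\<theta> J c) $ j = 0" using \<theta>B[OF J c] by blast
    have x: "\<theta> J c \<in> P J" using \<theta>P[OF J c] .
    have "subtract_min J (\<theta> J c) = \<theta> J c" by (rule subtract_min_P_boundary[OF J x j])
    then have "mix J t (\<theta> J c) = \<theta> J c"
      using lift_core_id core_height_P[OF x] by (simp add: mix_def algebra_simps flip: scaleR_add_left)
    then show ?thesis using True \<eta>\<theta>[OF J c] by (simp add: L_def glue_map_def)
  qed (simp add: L_def glue_map_def)
  have cL: "continuous_map (prod_topology ?I Z) Z L"
    unfolding Z_def
  proof (rule continuous_map_from_interval_glued_space[OF \<phi>Y'])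
    show "continuous_map (prod_topology ?I (top_of_set Y)) (glued_space (top_of_set Y) Js ?C ?B \<phi>) (\<lambda>(t, y). L (t, Inl y))"
      using continuous_map_compose[OF continuous_map_snd cInl, of ?I]
      by (simp add: L_def o_def split_beta' Z_def del: prod_topology_subtopology_eu)
    fix J assume J: "J \<in> Js"
    have m: "continuous_map (prod_topology ?I (top_of_set (P J))) (top_of_set (P J)) (\<lambda>(t, x). mix J t x)"
      unfolding prod_topology_subtopology_eu continuous_map_in_subtopology
    proof
      have "continuous_on ({0..1::real} \<times> P J) (\<lambda>x. mix J (fst x) (snd x))"
        unfolding mix_def
        by (intro continuous_intros continuous_on_lift_core continuous_on_subtract_min[OF J])
      then show "continuous_map (top_of_set ({0..1} \<times> P J)) euclidean (\<lambda>(t, x). mix J t x)"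
        by (simp add: split_beta')
    qed (use mix_P[OF J] in \<open>auto simp: mix_def\<close>)
    have "continuous_map (prod_topology ?I (?C J)) (prod_topology ?I (top_of_set (P J))) (\<lambda>x. (fst x, \<theta> J (snd x)))"
      using continuous_map_compose[OF continuous_map_snd c\<theta>[OF J]]
      by (intro continuous_map_pairedI continuous_map_fst) (simp add: o_def)
    from continuous_map_compose[OF continuous_map_compose[OF continuous_map_compose[OF this m] c\<eta>[OF J]] cglue[OF J]]
    have "continuous_map (prod_topology ?I (?C J)) (glued_space (top_of_set Y) Js ?C ?B \<phi>)
        (\<lambda>(t, c). glue_map ?B \<phi> J (\<eta> J (mix J t (\<theta> J c))))"
      by (simp add: o_def split_beta' Z_def del: prod_topology_subtopology_eu)
    then show "continuous_map (prod_topology ?I (?C J)) (glued_space (top_of_set Y) Js ?C ?B \<phi>)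
        (\<lambda>(t, c). L (t, glue_map ?B \<phi> J c))"
      by (rule continuous_map_eq) (auto simp: Lglue[OF J])
  qed
  have 2: "homotopic_with (\<lambda>_. True) Z Z id (\<Psi> \<circ> \<Phi>)"
  proof (subst homotopic_with, simp, intro exI[of _ L] conjI ballI cL TrueI)
    fix v assume v: "v \<in> topspace Z"
    have "L (0, v) = v \<and> L (1, v) = \<Psi> (\<Phi> v)"
    proof (cases v)
      case (Inl y)
      then show ?thesis using v by (auto simp: topZ glued_carrier_def L_def \<Phi>_def \<Psi>_def)
    next
      case (Inr w)
      then obtain J c where w: "w = (J, c)" "J \<in> Js" "c \<in> topspace (?C J)" "c \<notin> ?B J"
        using v by (auto simp: topZ glued_carrier_def)
      have vg: "v = glue_map ?B \<phi> J c" using Inr w by (simp add: glue_map_def)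
      have x: "\<theta> J c \<in> P J" using \<theta>P w by blast
      have "mix J 0 (\<theta> J c) = \<theta> J c" by (simp add: mix_def)
      then have 0: "L (0, v) = v" using Lglue[OF w(2,3)] vg \<eta>\<theta>[OF w(2,3)] by simp
      have "mix J 1 (\<theta> J c) = lift_core \<epsilon> q p 1 (subtract_min J (\<theta> J c))"
        by (simp add: mix_def prod_eq_iff)
      then have "L (1, v) = \<Psi> (\<Phi> v)"
        using Lglue[OF w(2,3)] vg \<Phi>glue \<Psi>\<kappa>[OF w(2) subtract_min_P[OF w(2) x]] by (simp add: \<phi>_def)
      with 0 show ?thesis by simp
    qed
    then show "L (0, v) = id v" "L (1, v) = (\<Psi> \<circ> \<Phi>) v" by simp_all
  qed
  have "top_of_set X homotopy_equivalent_space Z"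
    unfolding homotopy_equivalent_space_def
    using c\<Phi> c\<Psi> homotopic_with_symD[OF 1] homotopic_with_symD[OF 2] by blast
  then show ?thesis using c\<phi>B unfolding Z_def by blast
qed

end

section \<open>Descent\<close>

definition gradient :: "(real ^ 'n::finite \<Rightarrow> real) \<Rightarrow> real ^ 'n \<Rightarrow> real ^ 'n" where
  "gradient f x = (\<chi> i. partial i f x)"

text \<open>The gradient is carried as explicit data because the modified function is built together
  with a formula for it.\<close>

definition has_gradient :: "(real ^ 'n::finite \<Rightarrow> real) \<Rightarrow> (real ^ 'n \<Rightarrow> real ^ 'n) \<Rightarrow> bool" where
  "has_gradient f G \<longleftrightarrow> (\<forall>x. (f has_derivative (\<lambda>h. G x \<bullet> h)) (at x)) \<and> continuous_on UNIV G"

lemma has_gradient_line: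
  assumes "has_gradient f G"
  shows "((\<lambda>t. f (x + t *\<^sub>R v)) has_real_derivative G (x + t *\<^sub>R v) \<bullet> v) (at t within S)"
proof -
  have 1: "((\<lambda>t. x + t *\<^sub>R v) has_derivative (\<lambda>t. t *\<^sub>R v)) (at t within S)"
    by (auto intro!: derivative_eq_intros)
  have "(f has_derivative (\<lambda>h. G (x + t *\<^sub>R v) \<bullet> h)) (at (x + t *\<^sub>R v))"
    using assms by (simp add: has_gradient_def)
  from has_derivative_compose[OF 1 this]
  show ?thesis by (simp add: has_field_derivative_def mult.commute[of _ "G (x + t *\<^sub>R v) \<bullet> v"] mult_commute_abs)
qed

lemma C1_has_gradient:
  assumes "C1 f"
  shows "has_gradient f (gradient f)"
  unfolding has_gradient_def
proof (intro conjI allI)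
  show "continuous_on UNIV (gradient f)"
    unfolding gradient_def using assms by (intro continuous_on_vec_lambda) (auto simp: C1_def)
  fix x
  obtain D where D: "(f has_derivative D) (at x)"
    using assms by (auto simp: C1_def differentiable_def)
  then have lin: "linear D" by (rule has_derivative_linear)
  have DD: "D (axis i 1) = partial i f x" for i
  proof -
    have 1: "((\<lambda>t. x + t *\<^sub>R axis i 1) has_derivative (\<lambda>t. t *\<^sub>R axis i 1)) (at 0)"
      by (auto intro!: derivative_eq_intros)
    have "(f has_derivative D) (at (x + 0 *\<^sub>R axis i 1))" using D by simp
    from has_derivative_compose[OF 1 this]
    have "((\<lambda>t. f (x + t *\<^sub>R axis i 1)) has_real_derivative D (axis i 1)) (at 0)"
      using linear_scale[OF lin] by (simp add: has_field_derivative_def mult_commute_abs)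
    then show ?thesis by (simp add: partial_def DERIV_imp_deriv)
  qed
  have "D h = gradient f x \<bullet> h" for h
  proof -
    have "D h = D (\<Sum>i\<in>UNIV. (h $ i) *\<^sub>R axis i 1)"
      using basis_expansion[of h] by (simp add: scalar_mult_eq_scaleR)
    also have "\<dots> = (\<Sum>i\<in>UNIV. h $ i * partial i f x)"
      by (simp add: linear_sum[OF lin] linear_scale[OF lin] DD)
    also have "\<dots> = gradient f x \<bullet> h"
      by (simp add: gradient_def inner_vec_def mult.commute)
    finally show ?thesis .
  qed
  then have "D = (\<lambda>h. gradient f x \<bullet> h)" by blast
  then show "(f has_derivative (\<lambda>h. gradient f x \<bullet> h)) (at x)" using D by simp
qed

lemma has_gradient_mvt:
  assumes "has_gradient f G" "0 \<le> (t::real)"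
  obtains \<xi> where "0 \<le> \<xi>" "\<xi> \<le> t" "f (x + t *\<^sub>R v) - f x = t * (G (x + \<xi> *\<^sub>R v) \<bullet> v)"
proof (cases "t = 0")
  case True
  then show ?thesis using that[of 0] by simp
next
  case False
  then have "0 < t" using assms by simp
  then obtain \<xi> where "0 < \<xi>" "\<xi> < t"
    "f (x + t *\<^sub>R v) - f (x + 0 *\<^sub>R v) = (t - 0) * (G (x + \<xi> *\<^sub>R v) \<bullet> v)"
    using MVT2[of 0 t "\<lambda>t. f (x + t *\<^sub>R v)" "\<lambda>t. G (x + t *\<^sub>R v) \<bullet> v"] has_gradient_line[OF assms(1)]
    by blast
  then show ?thesis using that[of \<xi>] by simp
qed

definition descent_field :: "(real ^ 'n::finite \<Rightarrow> real ^ 'n) \<Rightarrow> real ^ 'n \<Rightarrow> real ^ 'n" where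
  "descent_field G x = (\<chi> i. - (x $ i)\<^sup>2 * G x $ i)"

lemma sparse_vectors_mono_support:
  assumes "x \<in> sparse_vectors s" "\<And>i. x $ i = 0 \<Longrightarrow> y $ i = 0"
  shows "y \<in> sparse_vectors s"
proof -
  have "card {i. y $ i \<noteq> 0} \<le> card {i. x $ i \<noteq> 0}"
    using assms(2) by (intro card_mono) auto
  then show ?thesis using assms(1) by (simp add: sparse_vectors_def norm0_def)
qed

lemma sparse_descent_field: "x \<in> sparse_vectors s \<Longrightarrow> x + t *\<^sub>R descent_field G x \<in> sparse_vectors s"
  by (erule sparse_vectors_mono_support) (simp add: descent_field_def)

lemma continuous_on_descent_field: "has_gradient f G \<Longrightarrow> continuous_on S (descent_field G)"
  unfolding descent_field_def has_gradient_def
  by (intro continuous_on_vec_lambda continuous_intros) (auto intro: continuous_on_subset)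

text \<open>The derivative of \<open>F\<close> along the field is minus the sum of the squares of
  \<open>x $ i * G x $ i\<close>, hence negative on \<open>K\<close> and, by compactness, at most
  \<open>- 2 * \<eta>\<close>. Uniform continuity in the point and the step length keeps it at most
  \<open>- \<eta>\<close> along steps up to \<open>\<tau>\<close>.\<close>

lemma uniform_descent:
  assumes F: "has_gradient F G" and K: "compact K" and nonstat: "\<And>x. x \<in> K \<Longrightarrow> \<exists>i. x $ i \<noteq> 0 \<and> G x $ i \<noteq> 0"
  obtains \<tau> \<eta> M where "\<tau> > 0" "\<eta> > 0" "M > 0" "\<And>x. x \<in> K \<Longrightarrow> norm (descent_field G x) \<le> M"
    "\<And>x t. x \<in> K \<Longrightarrow> 0 \<le> t \<Longrightarrow> t \<le> \<tau> \<Longrightarrow> F (x + t *\<^sub>R descent_field G x) \<le> F x - \<eta> * t"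
proof (cases "K = {}")
  case True
  then show ?thesis using that[of 1 1 1] by simp
next
  case False
  let ?V = "descent_field G"
  have cG: "continuous_on S G" for S using F by (auto simp: has_gradient_def intro: continuous_on_subset)
  have cV: "continuous_on S ?V" for S by (rule continuous_on_descent_field[OF F])
  have neg: "G x \<bullet> ?V x < 0" if "x \<in> K" for x
  proof -
    obtain i where i: "x $ i \<noteq> 0" "G x $ i \<noteq> 0" using nonstat[OF \<open>x \<in> K\<close>] by blast
    have "0 < (\<Sum>i\<in>UNIV. (x $ i * G x $ i)\<^sup>2)"
      using i by (intro sum_pos2[of _ i]) auto
    also have "\<dots> = - (G x \<bullet> ?V x)"
      by (simp add: inner_vec_def descent_field_def power_mult_distrib power2_eq_square sum_negf mult.assoc mult.left_commute)
    finally show ?thesis by simp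
  qed
  have "continuous_on K (\<lambda>x. G x \<bullet> ?V x)" by (intro continuous_on_inner cG cV)
  from continuous_attains_sup[OF K False this]
  obtain x0 where x0: "x0 \<in> K" "\<And>x. x \<in> K \<Longrightarrow> G x \<bullet> ?V x \<le> G x0 \<bullet> ?V x0" by blast
  define \<eta> where "\<eta> = - (G x0 \<bullet> ?V x0) / 2"
  have \<eta>: "\<eta> > 0" using neg[OF x0(1)] by (simp add: \<eta>_def)
  let ?\<psi> = "\<lambda>p. G (fst p + snd p *\<^sub>R ?V (fst p)) \<bullet> ?V (fst p)"
  have c1: "continuous_on S (\<lambda>p. ?V (fst p))" for S :: "((real ^ 'a) \<times> real) set"
    by (rule continuous_on_compose2[OF cV continuous_on_fst[OF continuous_on_id]]) auto
  have "continuous_on (K \<times> {0..1}) (\<lambda>p. fst p + snd p *\<^sub>R ?V (fst p))"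
    by (intro continuous_intros c1)
  then have "continuous_on (K \<times> {0..1}) (\<lambda>p. G (fst p + snd p *\<^sub>R ?V (fst p)))"
    by (rule continuous_on_compose2[OF cG[of UNIV]]) auto
  then have "continuous_on (K \<times> {0..1}) ?\<psi>" by (intro continuous_on_inner c1)
  moreover have "compact (K \<times> {0..1::real})" by (intro compact_Times K) simp
  ultimately have "uniformly_continuous_on (K \<times> {0..1}) ?\<psi>" by (rule compact_uniformly_continuous)
  then obtain e where e: "e > 0" "\<And>p p'. p \<in> K \<times> {0..1} \<Longrightarrow> p' \<in> K \<times> {0..1} \<Longrightarrow> dist p' p < e \<Longrightarrow> dist (?\<psi> p') (?\<psi> p) < \<eta>"
    using \<eta> unfolding uniformly_continuous_on_def by metis
  define \<tau> where "\<tau> = min 1 (e / 2)"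
  have \<tau>: "\<tau> > 0" using e by (simp add: \<tau>_def)
  have desc: "?\<psi> (x, t) \<le> - \<eta>" if "x \<in> K" "0 \<le> t" "t \<le> \<tau>" for x t
  proof -
    have "dist (x, t) (x, 0) < e" using that e by (simp add: dist_prod_def \<tau>_def dist_real_def)
    then have "dist (?\<psi> (x, t)) (?\<psi> (x, 0)) < \<eta>" using that by (intro e) (auto simp: \<tau>_def)
    moreover have "?\<psi> (x, 0) \<le> - 2 * \<eta>" using x0(2)[OF that(1)] by (simp add: \<eta>_def)
    ultimately show ?thesis by (simp add: dist_real_def)
  qed
  have "compact (?V ` K)" by (intro compact_continuous_image cV K)
  then obtain M where M: "M > 0" "\<And>x. x \<in> K \<Longrightarrow> norm (?V x) \<le> M"
    using compact_imp_bounded bounded_pos by (metis imageI)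
  show ?thesis
  proof (rule that[OF \<tau> \<eta> M])
    fix x t assume x: "x \<in> K" and t: "0 \<le> t" "t \<le> \<tau>"
    obtain \<xi> where \<xi>: "0 \<le> \<xi>" "\<xi> \<le> t" "F (x + t *\<^sub>R ?V x) - F x = t * (G (x + \<xi> *\<^sub>R ?V x) \<bullet> ?V x)"
      using has_gradient_mvt[OF F t(1)] by blast
    have "G (x + \<xi> *\<^sub>R ?V x) \<bullet> ?V x \<le> - \<eta>" using desc[OF x, of \<xi>] \<xi> t by simp
    then have "t * (G (x + \<xi> *\<^sub>R ?V x) \<bullet> ?V x) \<le> t * (- \<eta>)" using t by (intro mult_left_mono) auto
    then show "F (x + t *\<^sub>R ?V x) \<le> F x - \<eta> * t" using \<xi>(3) by (simp add: mult.commute)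
  qed
qed

lemma has_gradient_continuous: "has_gradient F G \<Longrightarrow> continuous_on S F"
  by (meson continuous_at_imp_continuous_on has_derivative_continuous has_gradient_def)

text \<open>A finite union of coordinate subspaces.\<close>

lemma closed_sparse_vectors: "closed (sparse_vectors s :: (real ^ 'n::finite) set)"
proof -
  have "sparse_vectors s = (\<Union>A\<in>{A :: 'n set. card A \<le> s}. {x. \<forall>i\<in>-A. x $ i = 0})"
  proof (intro subset_antisym subsetI)
    fix x :: "real ^ 'n" assume "x \<in> (\<Union>A\<in>{A. card A \<le> s}. {x. \<forall>i\<in>-A. x $ i = 0})"
    then obtain A :: "'n set" where A: "card A \<le> s" "\<forall>i\<in>-A. x $ i = 0" by auto
    then have "card {i. x $ i \<noteq> 0} \<le> card A" by (intro card_mono) auto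
    then show "x \<in> sparse_vectors s" using A by (simp add: sparse_vectors_def norm0_def)
  qed (auto simp: sparse_vectors_def norm0_def)
  moreover have "closed {x :: real ^ 'n. \<forall>i\<in>-A. x $ i = 0}" for A
  proof -
    have "{x :: real ^ 'n. \<forall>i\<in>-A. x $ i = 0} = (\<Inter>i\<in>-A. {x. x $ i = 0})" by auto
    then show ?thesis by (simp add: closed_INT closed_Collect_eq continuous_intros)
  qed
  ultimately show ?thesis by (simp add: closed_UN)
qed

text \<open>A single Euler step, faded out between the values \<open>a0\<close> and
  \<open>a1\<close>, so that the field acts only in the compact band. A point above
  \<open>v'\<close>, which is at least \<open>a0\<close>, makes the full step and drops by
  \<open>\<eta> * \<tau>\<close>; this is the admissible gap.\<close>

lemma regular_interval_step:
  assumes F: "has_gradient F G" and ab: "a1 < a0"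
    and K: "compact (level_band s F a1 b0)"
    and nonstat: "\<And>x. x \<in> level_band s F a1 b0 \<Longrightarrow> \<exists>i. x $ i \<noteq> 0 \<and> G x $ i \<noteq> 0"
  obtains \<delta> where "\<delta> > 0" "\<And>v v'. a0 \<le> v' \<Longrightarrow> v' \<le> v \<Longrightarrow> v \<le> b0 \<Longrightarrow> v - v' \<le> \<delta> \<Longrightarrow>
     \<exists>H. weak_deformation (top_of_set (lower_level s F v)) (lower_level s F v') H"
proof -
  obtain \<tau> \<eta> M where \<tau>: "\<tau> > 0" and \<eta>: "\<eta> > 0"
    and desc: "\<And>x t. x \<in> level_band s F a1 b0 \<Longrightarrow> 0 \<le> t \<Longrightarrow> t \<le> \<tau> \<Longrightarrow> F (x + t *\<^sub>R descent_field G x) \<le> F x - \<eta> * t"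
    using uniform_descent[OF F K nonstat] by metis
  define c where "c x = max 0 (min 1 ((F x - a1) / (a0 - a1)))" for x
  have c01: "0 \<le> c x" "c x \<le> 1" for x by (auto simp: c_def)
  define H where "H p = snd p + (fst p * \<tau> * c (snd p)) *\<^sub>R descent_field G (snd p)" for p
  have cont: "continuous_on S H" for S
  proof -
    have "continuous_on UNIV c" unfolding c_def
      using ab by (intro continuous_intros has_gradient_continuous[OF F]) auto
    then show ?thesis unfolding H_def
      by (intro continuous_intros continuous_on_compose2[OF _ continuous_on_snd[OF continuous_on_id], of UNIV]
           continuous_on_descent_field[OF F]) auto
  qed
  have drop: "F (H (t, x)) \<le> F x - \<eta> * (t * \<tau> * c x)"
    if x: "x \<in> sparse_vectors s" "F x \<le> b0" and t: "t \<in> {0..1}" for t x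
  proof (cases "F x \<le> a1")
    case True
    then have "(F x - a1) / (a0 - a1) \<le> 0" using ab by (simp add: divide_le_0_iff)
    then show ?thesis by (simp add: c_def H_def)
  next
    case False
    have "t * \<tau> * c x \<le> 1 * \<tau> * 1" using t c01[of x] \<tau> by (intro mult_mono) auto
    moreover have "0 \<le> t * \<tau> * c x" using t c01[of x] \<tau> by simp
    ultimately show ?thesis using False x by (simp add: H_def desc level_band_def)
  qed
  show ?thesis
  proof (rule that[of "\<eta> * \<tau>"])
    show "\<eta> * \<tau> > 0" using \<eta> \<tau> by simp
    fix v v' assume v: "a0 \<le> v'" "v' \<le> v" "v \<le> b0" "v - v' \<le> \<eta> * \<tau>"
    have pres: "H (t, x) \<in> lower_level s F u" if "x \<in> lower_level s F u" "u \<le> b0" "t \<in> {0..1}" for t x u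
    proof -
      have "F (H (t, x)) \<le> F x - \<eta> * (t * \<tau> * c x)" using that by (intro drop) (auto simp: lower_level_def)
      moreover have "0 \<le> \<eta> * (t * \<tau> * c x)" using that c01[of x] \<tau> \<eta> by simp
      ultimately show ?thesis
        using that sparse_descent_field[of x s] by (auto simp: lower_level_def H_def)
    qed
    have push: "H (1, x) \<in> lower_level s F v'" if "x \<in> lower_level s F v" for x
    proof (cases "F x \<le> v'")
      case True
      then show ?thesis using pres[of x v' 1] that v by (simp add: lower_level_def)
    next
      case False
      then have "(F x - a1) / (a0 - a1) \<ge> 1" using ab v by (simp add: le_divide_eq)
      then have "c x = 1" by (simp add: c_def)
      then have "F (H (1, x)) \<le> F x - \<eta> * \<tau>" using drop[of x 1] that v by (simp add: lower_level_def)
      moreover have "H (1, x) \<in> sparse_vectors s" using pres[OF that v(3), of 1] by (simp add: lower_level_def)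
      ultimately show ?thesis using that v by (simp add: lower_level_def)
    qed
    have "weak_deformation (top_of_set (lower_level s F v)) (lower_level s F v') H"
      unfolding weak_deformation_def
    proof (intro conjI ballI)
      show "lower_level s F v' \<subseteq> topspace (top_of_set (lower_level s F v))" using v by (auto simp: lower_level_def)
      show "continuous_map (prod_topology (top_of_set {0..1}) (top_of_set (lower_level s F v))) (top_of_set (lower_level s F v)) H"
        using cont pres[of _ v] v by (auto simp: continuous_map_in_subtopology)
      show "H (t, x) \<in> lower_level s F v'" if "t \<in> {0..1}" "x \<in> lower_level s F v'" for t x
        using pres that v by auto
    qed (use push in \<open>auto simp: H_def\<close>)
    then show "\<exists>H. weak_deformation (top_of_set (lower_level s F v)) (lower_level s F v') H" by blast
  qed
qed

text \<open>The Archimedean property reaches \<open>a\<close> after finitely many steps of size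
  \<open>\<delta>\<close>, cut off at \<open>a\<close>.\<close>

lemma descending_chain:
  fixes P :: "real \<Rightarrow> bool"
  assumes \<delta>: "\<delta> > 0" and ab: "a \<le> b" and b: "P b"
    and step: "\<And>v v'. a \<le> v' \<Longrightarrow> v' \<le> v \<Longrightarrow> v \<le> b \<Longrightarrow> v - v' \<le> \<delta> \<Longrightarrow> P v \<Longrightarrow> P v'"
  shows "P a"
proof -
  have "P (max a (b - real n * \<delta>))" for n
  proof (induction n)
    case 0
    then show ?case using b ab by (simp add: max_def)
  next
    case (Suc n)
    have "0 \<le> real n * \<delta>" using \<delta> by simp
    show ?case
    proof (rule step[OF _ _ _ _ Suc])
      show "max a (b - real (Suc n) * \<delta>) \<le> max a (b - real n * \<delta>)"
        using \<delta> by (intro max.mono) (auto simp: algebra_simps)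
      show "max a (b - real n * \<delta>) \<le> b" using ab \<open>0 \<le> real n * \<delta>\<close> by simp
      show "max a (b - real n * \<delta>) - max a (b - real (Suc n) * \<delta>) \<le> \<delta>"
        using \<delta> by (auto simp: max_def algebra_simps)
    qed simp
  qed
  moreover obtain n where "b - a < real n * \<delta>" using reals_Archimedean3[OF \<delta>] by blast
  ultimately show ?thesis by (metis add.commute diff_less_eq less_eq_real_def max.absorb1)
qed

section \<open>Symmetry of second derivatives\<close>

text \<open>Schwarz's theorem. The second difference over a square of side \<open>h\<close> is
  \<open>h^2\<close> times either mixed derivative at some point of the square, by two mean values
  taken in either order; continuity at \<open>x\<close> does the rest.\<close>

lemma partial_commute:
  assumes "C2 f"
  shows "partial i (partial j f) x = partial j (partial i f) x"
proof -
  have f: "has_gradient f (gradient f)" using assms C1_has_gradient by (auto simp: C2_def)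
  have p: "has_gradient (partial l f) (gradient (partial l f))" for l
    using assms C1_has_gradient by (auto simp: C2_def)
  have mixed: "\<exists>\<xi> \<eta>. 0 \<le> \<xi> \<and> \<xi> \<le> h \<and> 0 \<le> \<eta> \<and> \<eta> \<le> h \<and>
      f (x + h *\<^sub>R axis i 1 + h *\<^sub>R axis j 1) - f (x + h *\<^sub>R axis i 1) - f (x + h *\<^sub>R axis j 1) + f x =
      h\<^sup>2 * partial j (partial i f) (x + \<xi> *\<^sub>R axis i 1 + \<eta> *\<^sub>R axis j 1)" if h: "h > 0" for h i j
  proof -
    \<comment> \<open>The second difference, written as an increment in direction \<open>i\<close>
      of a difference in direction \<open>j\<close>.\<close>
    let ?\<phi> = "\<lambda>t. f (x + h *\<^sub>R axis j 1 + t *\<^sub>R axis i 1) - f (x + t *\<^sub>R axis i 1)"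
    have "DERIV ?\<phi> t :> partial i f (x + h *\<^sub>R axis j 1 + t *\<^sub>R axis i 1) - partial i f (x + t *\<^sub>R axis i 1)" for t
      using has_gradient_line[OF f, of _ "axis i 1" t UNIV]
      by (auto intro!: DERIV_diff simp: inner_axis gradient_def)
    then obtain \<xi> where \<xi>: "0 < \<xi>" "\<xi> < h"
      "?\<phi> h - ?\<phi> 0 = (h - 0) * (partial i f (x + h *\<^sub>R axis j 1 + \<xi> *\<^sub>R axis i 1) - partial i f (x + \<xi> *\<^sub>R axis i 1))"
      using MVT2[OF h, of ?\<phi> "\<lambda>t. partial i f (x + h *\<^sub>R axis j 1 + t *\<^sub>R axis i 1) - partial i f (x + t *\<^sub>R axis i 1)"]
      by blast
    obtain \<eta> where \<eta>: "0 \<le> \<eta>" "\<eta> \<le> h"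
      "partial i f (x + \<xi> *\<^sub>R axis i 1 + h *\<^sub>R axis j 1) - partial i f (x + \<xi> *\<^sub>R axis i 1)
        = h * (gradient (partial i f) (x + \<xi> *\<^sub>R axis i 1 + \<eta> *\<^sub>R axis j 1) \<bullet> axis j 1)"
      using has_gradient_mvt[OF p[of i], of h "x + \<xi> *\<^sub>R axis i 1" "axis j 1"] h by auto
    have "?\<phi> h - ?\<phi> 0 = h * (h * partial j (partial i f) (x + \<xi> *\<^sub>R axis i 1 + \<eta> *\<^sub>R axis j 1))"
      using \<xi>(3) \<eta>(3) by (simp add: inner_axis gradient_def add.commute add.left_commute)
    then show ?thesis using \<xi> \<eta>
      by (intro exI[of _ \<xi>] exI[of _ \<eta>]) (simp add: power2_eq_square algebra_simps)
  qed
  have cont: "isCont (partial l (partial m f)) x" for l m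
    using assms by (auto simp: C2_def C1_def continuous_on_eq_continuous_at)
  have close: "\<bar>partial j (partial i f) x - partial i (partial j f) x\<bar> \<le> 2 * e" if e: "e > 0" for e
  proof -
    obtain d1 where d1: "d1 > 0" "\<And>y. dist y x < d1 \<Longrightarrow> dist (partial j (partial i f) y) (partial j (partial i f) x) < e"
      using cont[of j i] e unfolding continuous_at_eps_delta by blast
    obtain d2 where d2: "d2 > 0" "\<And>y. dist y x < d2 \<Longrightarrow> dist (partial i (partial j f) y) (partial i (partial j f) x) < e"
      using cont[of i j] e unfolding continuous_at_eps_delta by blast
    define h where "h = min d1 d2 / 3"
    have h: "h > 0" using d1 d2 by (simp add: h_def)
    have near: "dist (x + \<xi> *\<^sub>R axis l 1 + \<eta> *\<^sub>R axis m 1) x < min d1 d2"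
      if "0 \<le> \<xi>" "\<xi> \<le> h" "0 \<le> \<eta>" "\<eta> \<le> h" for \<xi> \<eta> and l m :: 'a
    proof -
      have "dist (x + \<xi> *\<^sub>R axis l 1 + \<eta> *\<^sub>R axis m 1) x = norm (\<xi> *\<^sub>R axis l (1::real) + \<eta> *\<^sub>R axis m 1)"
        by (simp add: dist_norm)
      also have "\<dots> \<le> norm (\<xi> *\<^sub>R axis l (1::real)) + norm (\<eta> *\<^sub>R axis m (1::real))" by (rule norm_triangle_ineq)
      also have "\<dots> \<le> 2 * h" using that by simp
      also have "\<dots> < min d1 d2" using d1(1) d2(1) by (auto simp: h_def min_def)
      finally show ?thesis .
    qed
    obtain \<xi> \<eta> where 1: "0 \<le> \<xi>" "\<xi> \<le> h" "0 \<le> \<eta>" "\<eta> \<le> h"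
       "f (x + h *\<^sub>R axis i 1 + h *\<^sub>R axis j 1) - f (x + h *\<^sub>R axis i 1) - f (x + h *\<^sub>R axis j 1) + f x =
       h\<^sup>2 * partial j (partial i f) (x + \<xi> *\<^sub>R axis i 1 + \<eta> *\<^sub>R axis j 1)"
      using mixed[OF h] by blast
    obtain \<xi>' \<eta>' where 2: "0 \<le> \<xi>'" "\<xi>' \<le> h" "0 \<le> \<eta>'" "\<eta>' \<le> h"
       "f (x + h *\<^sub>R axis j 1 + h *\<^sub>R axis i 1) - f (x + h *\<^sub>R axis j 1) - f (x + h *\<^sub>R axis i 1) + f x =
       h\<^sup>2 * partial i (partial j f) (x + \<xi>' *\<^sub>R axis j 1 + \<eta>' *\<^sub>R axis i 1)"
      using mixed[OF h] by blast
    have "h\<^sup>2 * partial j (partial i f) (x + \<xi> *\<^sub>R axis i 1 + \<eta> *\<^sub>R axis j 1) =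
        h\<^sup>2 * partial i (partial j f) (x + \<xi>' *\<^sub>R axis j 1 + \<eta>' *\<^sub>R axis i 1)"
    proof -
      have eq: "x + h *\<^sub>R axis j 1 + h *\<^sub>R axis i 1 = x + h *\<^sub>R axis i 1 + h *\<^sub>R axis j 1" by (simp add: algebra_simps)
      show ?thesis using 1(5) 2(5)[unfolded eq] by linarith
    qed
    then have "partial j (partial i f) (x + \<xi> *\<^sub>R axis i 1 + \<eta> *\<^sub>R axis j 1) =
        partial i (partial j f) (x + \<xi>' *\<^sub>R axis j 1 + \<eta>' *\<^sub>R axis i 1)" using h by simp
    moreover have "dist (partial j (partial i f) (x + \<xi> *\<^sub>R axis i 1 + \<eta> *\<^sub>R axis j 1)) (partial j (partial i f) x) < e"
      using near[of \<xi> \<eta> i j] 1 by (intro d1) simp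
    moreover have "dist (partial i (partial j f) (x + \<xi>' *\<^sub>R axis j 1 + \<eta>' *\<^sub>R axis i 1)) (partial i (partial j f) x) < e"
      using near[of \<xi>' \<eta>' j i] 2 by (intro d2) simp
    ultimately show ?thesis by (simp add: dist_real_def)
  qed
  show ?thesis
  proof (rule ccontr)
    assume "\<not> ?thesis"
    then have "\<bar>partial j (partial i f) x - partial i (partial j f) x\<bar> > 0" by simp
    then show False using close[of "\<bar>partial j (partial i f) x - partial i (partial j f) x\<bar> / 4"] by simp
  qed
qed

section \<open>Diagonalization\<close>

text \<open>A maximiser \<open>e\<close> of \<open>x \<bullet> T x\<close> on the unit sphere of
  \<open>W\<close> is an eigenvector, since otherwise moving in the direction
  \<open>T e - c *\<^sub>R e\<close> would increase the quotient to first order. Self-adjointness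
  makes the orthogonal complement of \<open>e\<close> in \<open>W\<close> invariant, and the
  dimension drops.\<close>

lemma spectral_theorem_subspace:
  fixes T :: "'a::euclidean_space \<Rightarrow> 'a"
  assumes T: "linear T" and sa: "\<And>x y. T x \<bullet> y = x \<bullet> T y" and W: "subspace W" and inv: "T ` W \<subseteq> W"
  shows "\<exists>Bs. Bs \<subseteq> W \<and> pairwise Linear_Algebra.orthogonal Bs \<and> (\<forall>b\<in>Bs. norm b = 1 \<and> T b = (b \<bullet> T b) *\<^sub>R b) \<and> span Bs = W"
  using W inv
proof (induction "dim W" arbitrary: W rule: less_induct)
  case less
  show ?case
  proof (cases "W = {0}")
    case True
    then show ?thesis by (intro exI[of _ "{}"]) auto
  next
    case False
    let ?S = "sphere 0 1 \<inter> W"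
    have cont: "continuous_on ?S (\<lambda>x. x \<bullet> T x)"
      by (intro continuous_intros linear_continuous_on) (use T in \<open>simp add: linear_linear\<close>)
    have "compact ?S" by (intro compact_Int_closed closed_subspace less.prems) simp
    moreover have "?S \<noteq> {}"
    proof -
      obtain x where "x \<in> W" "x \<noteq> 0" using False subspace_0[OF less.prems(1)] by blast
      then have "(1 / norm x) *\<^sub>R x \<in> ?S" using subspace_scale[OF less.prems(1)] by simp
      then show ?thesis by blast
    qed
    ultimately obtain e where e: "e \<in> ?S" and max: "\<And>x. x \<in> ?S \<Longrightarrow> x \<bullet> T x \<le> e \<bullet> T e"
      using continuous_attains_sup[OF _ _ cont] by blast
    define c where "c = e \<bullet> T e"
    have ee: "e \<bullet> e = 1" and eW: "e \<in> W" using e by (auto simp: dot_square_norm)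
    have nonneg: "0 \<le> c * (x \<bullet> x) - x \<bullet> T x" if "x \<in> W" for x
    proof (cases "x = 0")
      case False
      then have "(1 / norm x) *\<^sub>R x \<in> ?S" using subspace_scale[OF less.prems(1)] that by simp
      from max[OF this] have "(x \<bullet> T x) / (norm x)\<^sup>2 \<le> c"
        using T by (simp add: linear_scale c_def power2_eq_square)
      then show ?thesis using False by (simp add: pos_divide_le_eq dot_square_norm)
    qed (use linear_0[OF T] in simp)
    define v where "v = T e - c *\<^sub>R e"
    have vW: "v \<in> W" unfolding v_def using less.prems eW by (intro subspace_diff subspace_scale) auto
    define b where "b = c * (v \<bullet> v) - v \<bullet> T v"
    have vv: "v \<bullet> v = e \<bullet> T v - c * (e \<bullet> v)"
    proof -
      have "v \<bullet> v = T e \<bullet> v - c * (e \<bullet> v)" by (subst (1) v_def) (simp add: inner_diff_left)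
      then show ?thesis using sa by simp
    qed
    have quad: "0 \<le> 2 * t * - (v \<bullet> v) + t\<^sup>2 * b" for t
    proof -
      have "e + t *\<^sub>R v \<in> W" using less.prems(1) eW vW by (intro subspace_add subspace_scale)
      from nonneg[OF this] have "0 \<le> c * ((e + t *\<^sub>R v) \<bullet> (e + t *\<^sub>R v)) - (e + t *\<^sub>R v) \<bullet> (T e + t *\<^sub>R T v)"
        using T by (simp add: linear_add linear_scale)
      also have "\<dots> = c * (1 + 2 * t * (e \<bullet> v) + t\<^sup>2 * (v \<bullet> v)) - (c + 2 * t * (e \<bullet> T v) + t\<^sup>2 * (v \<bullet> T v))"
        using sa[of v e] ee by (simp add: inner_add_left inner_add_right c_def inner_commute power2_eq_square algebra_simps)
      also have "\<dots> = 2 * t * - (v \<bullet> v) + t\<^sup>2 * b"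
        unfolding vv b_def by (simp add: algebra_simps vv)
      finally show ?thesis .
    qed
    have "v \<bullet> v = 0"
    proof (rule ccontr)
      assume "v \<bullet> v \<noteq> 0"
      then have pos: "v \<bullet> v > 0" by simp
      \<comment> \<open>Small enough for \<open>t\<^sup>2 * b\<close> to be at most half of the
        linear term \<open>2 * t * (v \<bullet> v)\<close>.\<close>
      define t where "t = (v \<bullet> v) / (\<bar>b\<bar> + 1)"
      have t: "t > 0" using pos by (simp add: t_def)
      have "t * b \<le> t * (\<bar>b\<bar> + 1)" using t by (intro mult_left_mono) auto
      also have "\<dots> = v \<bullet> v" by (simp add: t_def)
      finally have "t * (t * b) \<le> t * (v \<bullet> v)" using t by (intro mult_left_mono) auto
      then have "0 \<le> - (t * (v \<bullet> v))" using quad[of t] by (simp add: power2_eq_square algebra_simps)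
      then show False using t pos by (simp add: mult_le_0_iff)
    qed
    then have eig: "T e = c *\<^sub>R e" by (simp add: v_def)
    define W' where "W' = {x \<in> W. e \<bullet> x = 0}"
    have W': "subspace W'"
      using less.prems(1) by (auto simp: W'_def subspace_def inner_add_right)
    have "T ` W' \<subseteq> W'"
    proof
      fix y assume "y \<in> T ` W'"
      then obtain x where x: "x \<in> W" "e \<bullet> x = 0" "y = T x" by (auto simp: W'_def)
      have "e \<bullet> T x = T e \<bullet> x" using sa by simp
      then show "y \<in> W'" using x less.prems(2) by (auto simp: W'_def eig)
    qed
    moreover have "dim W' < dim W"
    proof (rule dim_psubset)
      have "e \<notin> W'" using ee by (simp add: W'_def)
      moreover have "W' \<subseteq> W" by (auto simp: W'_def)
      ultimately have "W' \<subset> W" using eW by blast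
      then show "span W' \<subset> span W" using W' less.prems(1) by (simp add: span_eq_iff[THEN iffD2])
    qed
    ultimately obtain B' where B': "B' \<subseteq> W'" "pairwise Linear_Algebra.orthogonal B'"
       "\<forall>b\<in>B'. norm b = 1 \<and> T b = (b \<bullet> T b) *\<^sub>R b" "span B' = W'"
      using less.hyps[OF _ W'] by metis
    show ?thesis
    proof (intro exI[of _ "insert e B'"] conjI ballI)
      show "insert e B' \<subseteq> W" using B' eW by (auto simp: W'_def)
      show "pairwise Linear_Algebra.orthogonal (insert e B')"
        using B' by (auto simp: pairwise_insert Linear_Algebra.orthogonal_def W'_def inner_commute)
      show "norm b = 1" "T b = (b \<bullet> T b) *\<^sub>R b" if "b \<in> insert e B'" for b
        using that B' e eig by (auto simp: c_def)
      show "span (insert e B') = W"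
      proof
        show "span (insert e B') \<subseteq> W"
          using \<open>insert e B' \<subseteq> W\<close> less.prems(1) by (simp add: span_minimal)
        show "W \<subseteq> span (insert e B')"
        proof
          fix x assume x: "x \<in> W"
          then have "x - (e \<bullet> x) *\<^sub>R e \<in> W'"
            using eW less.prems(1) ee by (auto simp: W'_def inner_diff_right intro!: subspace_diff subspace_scale)
          then show "x \<in> span (insert e B')" unfolding span_insert B'(4) by auto
        qed
      qed
    qed
  qed
qed

section \<open>Counting negative eigenvalues\<close>

lemma order_prod_linear_factors:
  "order a (\<Prod>x\<leftarrow>xs. [:- x, 1:]) = count_list xs (a :: real)"
proof (induction xs)
  case (Cons y ys)
  have "(\<Prod>x\<leftarrow>ys. [:- x, 1:]) \<noteq> 0" by (auto simp: prod_list_zero_iff)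
  then have "order a (\<Prod>x\<leftarrow>y # ys. [:- x, 1:]) = order a [:- y, 1:] + count_list ys a"
    using Cons by (simp add: order_mult del: mult_pCons_left)
  moreover have "order a [:- y, 1:] = (if y = a then 1 else 0)"
  proof (cases "y = a")
    case True
    then show ?thesis using order_power_n_n[of a 1] by simp
  qed (simp add: order_0I)
  ultimately show ?case by simp
qed (simp add: order_0I)

lemma count_list_filter: "P x \<Longrightarrow> count_list (filter P xs) x = count_list xs x"
  by (induction xs) auto

text \<open>The characteristic polynomial is the product of the linear factors of the diagonal, so
  the order of a root is the number of places holding it, and summing over negative roots counts
  places. Invertibility makes the determinant, which is the product of the diagonal,
  nonzero.\<close>

lemma negative_eigenvalue_count_similar_diag:
  assumes sim: "similar_mat A (Matrix.mat k k (\<lambda>(l, m). if l = m then d l else 0))" and A: "A \<in> carrier_mat k k"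
  shows "negative_eigenvalue_count A = card {l. l < k \<and> d l < 0}"
    and "invertible_mat A \<Longrightarrow> l < k \<Longrightarrow> d l \<noteq> 0"
proof -
  let ?D = "Matrix.mat k k (\<lambda>(l, m). if l = m then d l else 0)"
  let ?xs = "map d [0..<k]"
  have D: "?D \<in> carrier_mat k k" and ut: "upper_triangular ?D" by auto
  have diag: "diag_mat ?D = ?xs" by (simp add: diag_mat_def list_eq_iff_nth_eq)
  have cp: "char_poly A = (\<Prod>x\<leftarrow>?xs. [:- x, 1:])"
    using char_poly_similar[OF sim] char_poly_upper_triangular[OF D ut] diag by simp
  have ev: "eigenvalue A x \<longleftrightarrow> x \<in> set ?xs" for x
    unfolding eigenvalue_root_char_poly[OF A] cp by (auto simp: poly_prod_list prod_list_zero_iff o_def)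
  have "negative_eigenvalue_count A = (\<Sum>x\<in>{x \<in> set ?xs. x < 0}. count_list ?xs x)"
    unfolding negative_eigenvalue_count_def ev cp order_prod_linear_factors by simp
  also have "\<dots> = (\<Sum>x\<in>set (filter (\<lambda>x. x < 0) ?xs). count_list (filter (\<lambda>x. x < 0) ?xs) x)"
    by (intro sum.cong) (auto simp: count_list_filter)
  also have "\<dots> = length (filter (\<lambda>x. x < 0) ?xs)" by (rule sum_count_set) auto
  also have "\<dots> = card {l. l < k \<and> d l < 0}"
    unfolding length_filter_conv_card by (intro arg_cong[where f=card]) auto
  finally show "negative_eigenvalue_count A = card {l. l < k \<and> d l < 0}" .
  assume "invertible_mat A" and l: "l < k"
  then obtain B where B: "A * B = 1\<^sub>m k" "B * A = 1\<^sub>m (dim_row B)"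
    using A by (auto simp: invertible_mat_def inverts_mat_def)
  have "dim_row B = k" using arg_cong[OF B(2), of dim_col] A by simp
  moreover have "dim_col B = k" using arg_cong[OF B(1), of dim_col] by simp
  ultimately have "B \<in> carrier_mat k k" by auto
  then have "det A * det B = 1" using det_mult[OF A] B(1) by (metis det_one)
  then have "det A \<noteq> 0" by auto
  moreover have "det A = prod_list ?xs"
    using det_similar[OF sim] det_upper_triangular[OF ut D] diag by simp
  ultimately show "d l \<noteq> 0" using l by (auto simp: prod_list_zero_iff)
qed

text \<open>The spectral theorem is applied in the ambient space, to the operator of
  \<open>h\<close> on the coordinate subspace of \<open>S\<close>, so eigenvectors come as ambient
  vectors supported on \<open>S\<close>. The matrix having them as columns conjugates
  \<open>A\<close> to diagonal form, which identifies its number of negative eigenvalues.\<close>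

lemma diagonalize_principal_submatrix:
  fixes S :: "'n::finite set" and h :: "'n \<Rightarrow> 'n \<Rightarrow> real"
  assumes sym: "\<And>i j. i \<in> S \<Longrightarrow> j \<in> S \<Longrightarrow> h i j = h j i" and \<iota>: "bij_betw \<iota> {..<k} S"
  defines "A \<equiv> Matrix.mat k k (\<lambda>(p, q). h (\<iota> p) (\<iota> q))"
  assumes invA: "invertible_mat A"
  obtains \<beta> :: "nat \<Rightarrow> real ^ 'n" and d :: "nat \<Rightarrow> real" where
    "\<And>l i. l < k \<Longrightarrow> i \<notin> S \<Longrightarrow> \<beta> l $ i = 0"
    "\<And>l m. l < k \<Longrightarrow> m < k \<Longrightarrow> \<beta> l \<bullet> \<beta> m = (if l = m then 1 else 0)"
    "\<And>l. l < k \<Longrightarrow> d l \<noteq> 0" "\<And>l. l < k \<Longrightarrow> d l < 0 \<longleftrightarrow> l < negative_eigenvalue_count A"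
    "negative_eigenvalue_count A \<le> k"
    "\<And>l i. l < k \<Longrightarrow> i \<in> S \<Longrightarrow> (\<Sum>j\<in>S. h i j * \<beta> l $ j) = d l * \<beta> l $ i"
    "\<And>x. (\<And>i. i \<notin> S \<Longrightarrow> x $ i = 0) \<Longrightarrow> x = (\<Sum>l<k. (x \<bullet> \<beta> l) *\<^sub>R \<beta> l)"
proof -
  define T :: "real ^ 'n \<Rightarrow> real ^ 'n" where "T x = (\<chi> i. if i \<in> S then \<Sum>j\<in>S. h i j * x $ j else 0)" for x
  define W :: "(real ^ 'n) set" where "W = {x. \<forall>i. i \<notin> S \<longrightarrow> x $ i = 0}"
  have kS: "card S = k" using bij_betw_same_card[OF \<iota>] by simp
  have T: "linear T"
    by (rule linearI) (auto simp: T_def Finite_Cartesian_Product.vec_eq_iff sum.distrib sum_distrib_left algebra_simps)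
  have inner_S: "x \<bullet> y = (\<Sum>i\<in>S. x $ i * y $ i)" if "y \<in> W" for x y
    unfolding inner_vec_def inner_real_def using that by (intro sum.mono_neutral_right) (auto simp: W_def)
  have TW: "T x \<in> W" for x by (simp add: T_def W_def)
  have sa: "T x \<bullet> y = x \<bullet> T y" for x y
  proof -
    have Tc: "T x $ i = (\<Sum>j\<in>S. h i j * x $ j)" if "i \<in> S" for x i using that by (simp add: T_def)
    have "T x \<bullet> y = (\<Sum>i\<in>S. y $ i * T x $ i)"
      unfolding inner_commute[of "T x"] by (rule inner_S[OF TW])
    also have "\<dots> = (\<Sum>i\<in>S. \<Sum>j\<in>S. h i j * x $ j * y $ i)"
      by (simp add: Tc sum_distrib_left mult.commute)
    also have "\<dots> = (\<Sum>j\<in>S. \<Sum>i\<in>S. h j i * x $ j * y $ i)"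
      by (subst sum.swap) (simp add: sym)
    also have "\<dots> = (\<Sum>i\<in>S. x $ i * T y $ i)"
      by (simp add: Tc sum_distrib_left mult.commute mult.left_commute)
    also have "\<dots> = x \<bullet> T y" by (rule inner_S[OF TW, symmetric])
    finally show ?thesis .
  qed
  have W: "subspace W" by (auto simp: W_def subspace_def)
  obtain Bs where Bs: "Bs \<subseteq> W" "pairwise Linear_Algebra.orthogonal Bs" and Bs1: "\<And>b. b \<in> Bs \<Longrightarrow> norm b = 1"
    and eig: "\<And>b. b \<in> Bs \<Longrightarrow> T b = (b \<bullet> T b) *\<^sub>R b" and span: "span Bs = W"
    using spectral_theorem_subspace[OF T sa W] TW by (auto simp: image_subset_iff)
  have "0 \<notin> Bs" using Bs1 by force
  then have indep: "independent Bs" using pairwise_orthogonal_independent[OF Bs(2)] by blast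
  have finBs: "finite Bs" using indep independent_imp_finite by blast
  have "card Bs = dim W" using dim_eq_card_independent[OF indep] dim_span[of Bs] span by simp
  also have "dim W = k"
  proof -
    have "W = span ((\<lambda>i. axis i 1) ` S)"
    proof
      show "span ((\<lambda>i. axis i 1) ` S) \<subseteq> W"
        by (intro span_minimal W) (auto simp: W_def axis_def)
      show "W \<subseteq> span ((\<lambda>i. axis i 1) ` S)"
      proof
        fix x assume x: "x \<in> W"
        have "x = (\<Sum>i\<in>S. x $ i *\<^sub>R axis i 1)"
          using x by (auto simp: Finite_Cartesian_Product.vec_eq_iff W_def axis_def if_distrib[of "(*) _"] cong: if_cong)
        also have "\<dots> \<in> span ((\<lambda>i. axis i 1) ` S)"
          by (intro span_sum span_scale span_base) auto
        finally show "x \<in> span ((\<lambda>i. axis i 1) ` S)" .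
      qed
    qed
    moreover have "independent ((\<lambda>i. axis i (1::real)) ` S :: (real ^ 'n) set)"
      by (rule independent_mono[OF independent_Basis]) (auto simp: Basis_vec_def)
    moreover have "card ((\<lambda>i. axis i (1::real)) ` S :: (real ^ 'n) set) = k"
      unfolding kS[symmetric] by (intro card_image) (auto simp: inj_on_def axis_eq_axis)
    ultimately show ?thesis using dim_eq_card_independent dim_span by metis
  qed
  finally have cardBs: "card Bs = k" .
  define \<mu> where "\<mu> b = b \<bullet> T b" for b
  let ?N = "{b \<in> Bs. \<mu> b < 0}"
  define m where "m = card ?N"
  have mk: "m \<le> k" unfolding m_def cardBs[symmetric] by (intro card_mono finBs) auto
  obtain f where f: "bij_betw f {0..<m} ?N"
    using ex_bij_betw_nat_finite[of ?N] finBs by (auto simp: m_def)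
  have "card {m..<k} = card (Bs - ?N)" using finBs cardBs mk by (simp add: card_Diff_subset m_def)
  then obtain g where g: "bij_betw g {m..<k} (Bs - ?N)"
    using finite_same_card_bij[of "{m..<k}" "Bs - ?N"] finBs by auto
  \<comment> \<open>Eigenvectors with negative eigenvalue are numbered first, so the sign of an
    eigenvalue is read off from its index.\<close>
  define \<beta> where "\<beta> l = (if l < m then f l else g l)" for l
  have "bij_betw \<beta> {0..<m} ?N" using f by (subst bij_betw_cong[where g=f]) (auto simp: \<beta>_def)
  moreover have "bij_betw \<beta> {m..<k} (Bs - ?N)" using g by (subst bij_betw_cong[where g=g]) (auto simp: \<beta>_def)
  ultimately have "bij_betw \<beta> ({0..<m} \<union> {m..<k}) (?N \<union> (Bs - ?N))" by (rule bij_betw_combine) auto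
  moreover have "{0..<m} \<union> {m..<k} = {..<k}" "?N \<union> (Bs - ?N) = Bs" using mk by auto
  ultimately have \<beta>: "bij_betw \<beta> {..<k} Bs" by metis
  have \<beta>Bs: "\<beta> l \<in> Bs" if "l < k" for l using bij_betw_apply[OF \<beta>] that by simp
  have neg: "\<mu> (\<beta> l) < 0 \<longleftrightarrow> l < m" if "l < k" for l
  proof (cases "l < m")
    case True
    then show ?thesis using bij_betw_apply[OF f, of l] by (simp add: \<beta>_def)
  next
    case False
    then show ?thesis using bij_betw_apply[OF g, of l] that by (simp add: \<beta>_def)
  qed
  have orth: "\<beta> l \<bullet> \<beta> m = (if l = m then 1 else 0)" if "l < k" "m < k" for l m
  proof (cases "l = m")
    case True
    then show ?thesis using Bs1[OF \<beta>Bs[OF that(1)]] by (simp add: dot_square_norm)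
  next
    case False
    then have "\<beta> l \<noteq> \<beta> m" using \<beta> that by (auto simp: bij_betw_def inj_on_def)
    then show ?thesis using False Bs(2) \<beta>Bs that by (auto simp: pairwise_def Linear_Algebra.orthogonal_def)
  qed
  have zero: "\<beta> l $ i = 0" if "l < k" "i \<notin> S" for l i
    using \<beta>Bs[OF that(1)] Bs(1) that(2) by (auto simp: W_def)
  have eig': "(\<Sum>j\<in>S. h i j * \<beta> l $ j) = \<mu> (\<beta> l) * \<beta> l $ i" if "l < k" "i \<in> S" for l i
    using arg_cong[OF eig[OF \<beta>Bs[OF that(1)]], of "\<lambda>v. v $ i"] that(2) by (simp add: T_def \<mu>_def)
  define Pm where "Pm = Matrix.mat k k (\<lambda>(p, l). \<beta> l $ \<iota> p)"
  define Q where "Q = Matrix.mat k k (\<lambda>(l, p). \<beta> l $ \<iota> p)"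
  define D where "D = Matrix.mat k k (\<lambda>(l, m). if l = m then \<mu> (\<beta> l) else 0)"
  have re: "(\<Sum>p<k. F (\<iota> p)) = (\<Sum>i\<in>S. F i)" for F :: "'n \<Rightarrow> real"
    by (rule sum.reindex_bij_betw[OF \<iota>])
  have \<iota>S: "\<iota> p \<in> S" if "p < k" for p using bij_betw_apply[OF \<iota>] that by simp
  \<comment> \<open>This is orthonormality, read over \<open>S\<close> through the enumeration
    \<open>\<iota>\<close>; for square matrices the one-sided inverse is two-sided.\<close>
  have QP: "Q * Pm = 1\<^sub>m k"
  proof (rule eq_matI)
    fix l m assume "l < dim_row (1\<^sub>m k :: real mat)" "m < dim_col (1\<^sub>m k :: real mat)"
    then have lm: "l < k" "m < k" by auto
    have "(Q * Pm) $$ (l, m) = (\<Sum>p<k. \<beta> l $ \<iota> p * \<beta> m $ \<iota> p)"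
      using lm by (simp add: Q_def Pm_def scalar_prod_def atLeast0LessThan)
    also have "\<dots> = (\<Sum>i\<in>S. \<beta> l $ i * \<beta> m $ i)" by (rule re)
    also have "\<dots> = \<beta> l \<bullet> \<beta> m" using inner_S[of "\<beta> m" "\<beta> l"] zero[OF lm(2)] by (simp add: W_def)
    finally show "(Q * Pm) $$ (l, m) = 1\<^sub>m k $$ (l, m)" using orth[OF lm] lm by simp
  qed (auto simp: Q_def Pm_def)
  have carr: "Q \<in> carrier_mat k k" "Pm \<in> carrier_mat k k" "D \<in> carrier_mat k k" "A \<in> carrier_mat k k"
    by (auto simp: Q_def Pm_def D_def A_def)
  have PQ: "Pm * Q = 1\<^sub>m k" using mat_mult_left_right_inverse[OF carr(1,2) QP] .
  have AP: "A * Pm = Pm * D"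
  proof (rule eq_matI)
    fix p l assume "p < dim_row (Pm * D)" "l < dim_col (Pm * D)"
    then have pl: "p < k" "l < k" using carr by auto
    have "(A * Pm) $$ (p, l) = (\<Sum>q<k. h (\<iota> p) (\<iota> q) * \<beta> l $ \<iota> q)"
      using pl by (simp add: A_def Pm_def scalar_prod_def atLeast0LessThan)
    also have "\<dots> = (\<Sum>j\<in>S. h (\<iota> p) j * \<beta> l $ j)" by (rule re)
    also have "\<dots> = \<beta> l $ \<iota> p * \<mu> (\<beta> l)" using eig'[OF pl(2) \<iota>S[OF pl(1)]] by simp
    also have "\<dots> = (Pm * D) $$ (p, l)"
      using pl by (simp add: Pm_def D_def scalar_prod_def if_distrib[of "(*) _"] cong: if_cong)
    finally show "(A * Pm) $$ (p, l) = (Pm * D) $$ (p, l)" .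
  qed (use carr in auto)
  have "A = A * (Pm * Q)" using PQ carr by simp
  also have "\<dots> = Pm * D * Q" using assoc_mult_mat[OF carr(4,2,1)] AP by simp
  finally have "similar_mat_wit A D Pm Q" by (rule similar_mat_witI[OF PQ QP _ carr(4,3,2,1)])
  then have sim: "similar_mat A D" unfolding similar_mat_def by blast
  have "negative_eigenvalue_count A = card {l. l < k \<and> \<mu> (\<beta> l) < 0}"
    using negative_eigenvalue_count_similar_diag(1)[OF sim[unfolded D_def] carr(4)] by simp
  also have "{l. l < k \<and> \<mu> (\<beta> l) < 0} = {..<m}" using neg mk by auto
  finally have nec: "negative_eigenvalue_count A = m" by simp
  have d0: "\<mu> (\<beta> l) \<noteq> 0" if "l < k" for l
    using negative_eigenvalue_count_similar_diag(2)[OF sim[unfolded D_def] carr(4) invA that] by simp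
  have expand: "x = (\<Sum>l<k. (x \<bullet> \<beta> l) *\<^sub>R \<beta> l)" if x: "\<And>i. i \<notin> S \<Longrightarrow> x $ i = 0" for x
  proof -
    \<comment> \<open>The remainder of the expansion lies in \<open>W\<close> and is orthogonal to a
      spanning set of \<open>W\<close>, hence to itself.\<close>
    define y where "y = x - (\<Sum>l<k. (x \<bullet> \<beta> l) *\<^sub>R \<beta> l)"
    have "y \<in> W"
      unfolding y_def using x \<beta>Bs Bs(1) by (intro subspace_diff[OF W] subspace_sum[OF W] subspace_scale[OF W]) (auto simp: W_def)
    moreover have "y \<bullet> \<beta> m = 0" if "m < k" for m
    proof -
      have "(\<Sum>l<k. (x \<bullet> \<beta> l) *\<^sub>R \<beta> l) \<bullet> \<beta> m = (\<Sum>l<k. (x \<bullet> \<beta> l) * (if l = m then 1 else 0))"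
        unfolding inner_sum_left using orth that by (intro sum.cong) auto
      then show ?thesis using that by (simp add: y_def inner_diff_left if_distrib[of "(*) _"] cong: if_cong)
    qed
    then have "y \<bullet> b = 0" if "b \<in> Bs" for b
      using that \<beta> by (auto simp: bij_betw_def)
    ultimately have "Linear_Algebra.orthogonal y y"
      using orthogonal_to_span[of y Bs y] span by (auto simp: Linear_Algebra.orthogonal_def)
    then show ?thesis by (simp add: Linear_Algebra.orthogonal_def y_def)
  qed
  show ?thesis
    by (rule that[of \<beta> "\<lambda>l. \<mu> (\<beta> l)"]) (use zero orth d0 neg nec mk eig' expand in auto)
qed

section \<open>The local model\<close>

text \<open>The case \<open>t = 0\<close> carries the content: squaring removes the kink of the
  positive part.\<close>

lemma DERIV_positive_part_square: "((\<lambda>t. (max 0 t)\<^sup>2) has_real_derivative 2 * max 0 t) (at t)"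
proof -
  consider "t > 0" | "t < 0" | "t = 0" by linarith
  then show ?thesis
  proof cases
    case 1
    have "((\<lambda>t. t\<^sup>2) has_real_derivative 2 * t) (at t)" by (auto intro!: derivative_eq_intros)
    then have "((\<lambda>t. (max 0 t)\<^sup>2) has_real_derivative 2 * t) (at t)"
      by (rule has_field_derivative_transform_within_open[where S="{0<..}"]) (use 1 in auto)
    then show ?thesis using 1 by (simp add: max_def)
  next
    case 2
    have "((\<lambda>t. 0) has_real_derivative 0) (at t)" by simp
    then have "((\<lambda>t. (max 0 t)\<^sup>2) has_real_derivative 0) (at t)"
      by (rule has_field_derivative_transform_within_open[where S="{..<0}"]) (use 2 in \<open>auto simp: max_def\<close>)
    then show ?thesis using 2 by (simp add: max_def)
  next
    case 3
    have "((\<lambda>h::real. (max 0 h)\<^sup>2 / h) \<longlongrightarrow> 0) (at 0)"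
    proof (rule Lim_null_comparison)
      show "\<forall>\<^sub>F h::real in at 0. norm ((max 0 h)\<^sup>2 / h) \<le> \<bar>h\<bar>"
        by (intro always_eventually) (auto simp: max_def power2_eq_square)
      show "((\<lambda>h. \<bar>h\<bar>) \<longlongrightarrow> 0) (at (0::real))" by (intro tendsto_eq_intros) auto
    qed
    then show ?thesis using 3 by (simp add: has_field_derivative_iff)
  qed
qed

text \<open>The quotient \<open>A / (A + B)\<close> of squared positive parts of
  \<open>4 - t\<close> and \<open>t - 1\<close>, which never vanish together. The thresholds 1 and 4
  are squares because the argument will be the squared distance divided by
  \<open>\<delta>\<^sup>2\<close>: the transition takes place between the radii
  \<open>\<delta>\<close> and \<open>2 * \<delta>\<close>.\<close>

lemma smooth_cutoff:
  obtains \<psi> \<psi>' :: "real \<Rightarrow> real" and M where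
    "\<And>t. (\<psi> has_real_derivative \<psi>' t) (at t)" "continuous_on UNIV \<psi>'" "M > 0" "\<And>t. \<bar>\<psi>' t\<bar> \<le> M"
    "\<And>t. t \<le> 1 \<Longrightarrow> \<psi> t = 1" "\<And>t. t \<ge> 4 \<Longrightarrow> \<psi> t = 0" "\<And>t. t \<ge> 4 \<Longrightarrow> \<psi>' t = 0" "\<And>t. 0 \<le> \<psi> t \<and> \<psi> t \<le> 1"
proof -
  define A where "A t = (max 0 (4 - t))\<^sup>2" for t :: real
  define B where "B t = (max 0 (t - 1))\<^sup>2" for t :: real
  define A' where "A' t = - (2 * max 0 (4 - t))" for t :: real
  define B' where "B' t = 2 * max 0 (t - 1)" for t :: real
  have dA: "(A has_real_derivative A' t) (at t)" for t
  proof -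
    have "((\<lambda>t. 4 - t) has_real_derivative -1) (at t)" by (auto intro!: derivative_eq_intros)
    from DERIV_chain2[OF DERIV_positive_part_square this] show ?thesis by (simp add: A_def[abs_def] A'_def)
  qed
  have dB: "(B has_real_derivative B' t) (at t)" for t
  proof -
    have "((\<lambda>t. t - 1) has_real_derivative 1) (at t)" by (auto intro!: derivative_eq_intros)
    from DERIV_chain2[OF DERIV_positive_part_square this] show ?thesis by (simp add: B_def[abs_def] B'_def)
  qed
  have nn: "0 \<le> A t" "0 \<le> B t" for t by (auto simp: A_def B_def)
  have pos: "A t + B t > 0" for t
  proof -
    have "A t > 0 \<or> B t > 0" by (cases "t < 4") (auto simp: A_def B_def max_def)
    then show ?thesis using nn[of t] by linarith
  qed
  define \<psi> where "\<psi> t = A t / (A t + B t)" for t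
  define \<psi>' where "\<psi>' t = (A' t * (A t + B t) - A t * (A' t + B' t)) / ((A t + B t) * (A t + B t))" for t
  have "(\<psi> has_real_derivative \<psi>' t) (at t)" for t
    unfolding \<psi>_def[abs_def] \<psi>'_def using pos[of t] by (intro DERIV_divide DERIV_add dA dB) auto
  moreover have cont: "continuous_on S \<psi>'" for S
    unfolding \<psi>'_def A'_def B'_def using pos
    by (intro continuous_intros DERIV_continuous_on[OF DERIV_subset[OF dA]] DERIV_continuous_on[OF DERIV_subset[OF dB]])
      (auto simp: less_imp_neq[symmetric])
  moreover have p4: "\<psi> t = 0" "\<psi>' t = 0" if "t \<ge> 4" for t
    using that by (auto simp: \<psi>_def \<psi>'_def A_def A'_def)
  moreover have p1: "\<psi> t = 1" if "t \<le> 1" for t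
    using that pos[of t] by (auto simp: \<psi>_def B_def)
  moreover have "0 \<le> \<psi> t \<and> \<psi> t \<le> 1" for t
    using pos[of t] nn[of t] by (auto simp: \<psi>_def)
  moreover have "\<exists>M>0. \<forall>t. \<bar>\<psi>' t\<bar> \<le> M"
  proof -
    have "compact (\<psi>' ` {1..4})" by (intro compact_continuous_image cont) auto
    then obtain M where M: "M > 0" "\<And>t. t \<in> {1..4} \<Longrightarrow> \<bar>\<psi>' t\<bar> \<le> M"
      using compact_imp_bounded bounded_pos by (metis imageI real_norm_def)
    have "\<psi>' t = 0" if "t < 1" for t
      using that by (simp add: \<psi>'_def B_def B'_def)
    then have "\<bar>\<psi>' t\<bar> \<le> M" for t
      using M p4(2)[of t] by (cases "t < 1"; cases "t > 4") auto
    then show ?thesis using M by blast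
  qed
  ultimately show ?thesis using that by metis
qed

section \<open>The local model and the flattened function\<close>

definition core_hessian :: "(real ^ 'n::finite \<Rightarrow> real) \<Rightarrow> real ^ 'n \<Rightarrow> real ^ 'n \<Rightarrow> real ^ 'n" where
  "core_hessian f x w = (\<chi> i. if i \<in> I1 x then \<Sum>j\<in>I1 x. partial i (partial j f) x * w $ j else 0)"

text \<open>Second order along the stratum, first order across it. At a nondegenerate point, either
  the linear term dominates across the stratum or nearby sparse points do not leave it.\<close>

definition local_model :: "(real ^ 'n::finite \<Rightarrow> real) \<Rightarrow> real ^ 'n \<Rightarrow> real ^ 'n \<Rightarrow> real" where
  "local_model f x0 x = f x0 + gradient f x0 \<bullet> (x - x0) + (x - x0) \<bullet> core_hessian f x0 (x - x0) / 2"

lemma linear_core_hessian: "linear (core_hessian f x)"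
  by (rule linearI)
    (auto simp: core_hessian_def Finite_Cartesian_Product.vec_eq_iff sum.distrib sum_distrib_left algebra_simps)

lemma core_hessian_selfadjoint:
  assumes "C2 f"
  shows "core_hessian f x v \<bullet> w = v \<bullet> core_hessian f x w"
proof -
  have *: "core_hessian f x v \<bullet> w = (\<Sum>i\<in>I1 x. \<Sum>j\<in>I1 x. partial i (partial j f) x * v $ j * w $ i)" for v w
  proof -
    have "core_hessian f x v \<bullet> w = (\<Sum>i\<in>UNIV. if i \<in> I1 x then (\<Sum>j\<in>I1 x. partial i (partial j f) x * v $ j) * w $ i else 0)"
      unfolding inner_vec_def core_hessian_def by (intro sum.cong) auto
    also have "\<dots> = (\<Sum>i\<in>I1 x. (\<Sum>j\<in>I1 x. partial i (partial j f) x * v $ j) * w $ i)"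
      by (simp add: sum.If_cases)
    finally show ?thesis by (simp add: sum_distrib_right)
  qed
  have "v \<bullet> core_hessian f x w = (\<Sum>i\<in>I1 x. \<Sum>j\<in>I1 x. partial i (partial j f) x * w $ j * v $ i)"
    unfolding inner_commute[of v] by (rule *)
  also have "\<dots> = (\<Sum>j\<in>I1 x. \<Sum>i\<in>I1 x. partial i (partial j f) x * w $ j * v $ i)"
    by (rule sum.swap)
  also have "\<dots> = core_hessian f x v \<bullet> w"
    unfolding * by (intro sum.cong refl) (simp add: partial_commute[OF assms, of _ _ x])
  finally show ?thesis by simp
qed

lemma has_gradient_local_model:
  assumes "C2 f"
  shows "has_gradient (local_model f x0) (\<lambda>x. gradient f x0 + core_hessian f x0 (x - x0))"
proof -
  let ?T = "core_hessian f x0"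
  have bl: "bounded_linear ?T" using linear_core_hessian linear_conv_bounded_linear by blast
  have "(local_model f x0 has_derivative (\<lambda>h. (gradient f x0 + ?T (x - x0)) \<bullet> h)) (at x)" for x
  proof -
    have 1: "((\<lambda>x. x - x0) has_derivative (\<lambda>h. h)) (at x)" by (auto intro!: derivative_eq_intros)
    have 2: "((\<lambda>x. ?T (x - x0)) has_derivative (\<lambda>h. ?T h)) (at x)"
      by (rule bounded_linear.has_derivative[OF bl 1])
    have "(local_model f x0 has_derivative (\<lambda>h. 0 + gradient f x0 \<bullet> h + ((x - x0) \<bullet> ?T h + h \<bullet> ?T (x - x0)) / 2)) (at x)"
      unfolding local_model_def[abs_def]
      by (intro has_derivative_add has_derivative_const has_derivative_inner_right[OF 1]
          bounded_linear.has_derivative[OF bounded_linear_divide has_derivative_inner[OF 1 2]])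
    moreover have "0 + gradient f x0 \<bullet> h + ((x - x0) \<bullet> ?T h + h \<bullet> ?T (x - x0)) / 2 = (gradient f x0 + ?T (x - x0)) \<bullet> h" for h
      using core_hessian_selfadjoint[OF assms, of x0 "x - x0" h]
      by (simp add: inner_add_left inner_commute[of h])
    ultimately show ?thesis by simp
  qed
  moreover have "continuous_on UNIV (\<lambda>x. gradient f x0 + ?T (x - x0))"
    by (intro continuous_intros bounded_linear.continuous_on[OF bl])
  ultimately show ?thesis by (simp add: has_gradient_def)
qed

lemma core_hessian_outside: "i \<notin> I1 x \<Longrightarrow> core_hessian f x w $ i = 0"
  by (simp add: core_hessian_def)

lemma gradient_component: "gradient f x $ i = partial i f x"
  by (simp add: gradient_def)

text \<open>Replacing \<open>f\<close> by \<open>f + \<chi>(q - f)\<close> makes it equal to its local model \<open>q\<close> near the nondegenerate point.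
  The first-order remainder beats the slope \<open>1/\<delta>\<close> of the cutoff in the directions leaving the stratum, the
  second-order remainder beats it inside the stratum, so no new stationary points appear.\<close>

proposition flatten_near_nondegenerate:
  fixes f :: "real ^ 'n::finite \<Rightarrow> real"
  assumes f: "C2 f" and stat: "M_stationary s f x0"
    and nd1: "norm0 x0 < s \<Longrightarrow> \<forall>i\<in>I0 x0. partial i f x0 \<noteq> 0"
    and nd2: "\<And>w. (\<forall>i. i \<notin> I1 x0 \<longrightarrow> w $ i = 0) \<Longrightarrow> core_hessian f x0 w = 0 \<Longrightarrow> w = 0"
    and ab: "a < f x0" "f x0 < b"
  obtains F G \<delta> where "\<delta> > 0" "has_gradient F G"
    "\<And>x. norm (x - x0) > 2 * \<delta> \<Longrightarrow> F x = f x \<and> G x = gradient f x"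
    "\<And>x. norm (x - x0) \<le> \<delta> \<Longrightarrow> F x = local_model f x0 x"
    "\<And>x. norm (x - x0) \<le> 2 * \<delta> \<Longrightarrow> a < f x \<and> f x < b \<and> a < F x \<and> F x < b"
    "\<And>x i. norm (x - x0) \<le> 2 * \<delta> \<Longrightarrow> i \<in> I1 x0 \<Longrightarrow> x $ i \<noteq> 0"
    "\<And>x. x \<in> sparse_vectors s \<Longrightarrow> norm (x - x0) \<le> 2 * \<delta> \<Longrightarrow> x \<noteq> x0 \<Longrightarrow> \<exists>i. x $ i \<noteq> 0 \<and> G x $ i \<noteq> 0"
proof -
  let ?T = "core_hessian f x0" and ?q = "local_model f x0" and ?n = "real CARD('n)"
  let ?g = "\<lambda>i. partial i f x0"
  have bl: "bounded_linear ?T" using linear_core_hessian linear_conv_bounded_linear by blast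
  have gf: "has_gradient f (gradient f)" using f C1_has_gradient by (auto simp: C2_def)
  have gp: "has_gradient (partial i f) (gradient (partial i f))" for i
    using f C1_has_gradient by (auto simp: C2_def)
  have gq: "has_gradient ?q (\<lambda>x. gradient f x0 + ?T (x - x0))" by (rule has_gradient_local_model[OF f])
  have g1: "?g i = 0" if "i \<in> I1 x0" for i using stat that by (simp add: M_stationary_def)
  have q0: "?q x0 = f x0" by (simp add: local_model_def)
  have n1: "?n \<ge> 1" by (simp add: Suc_leI)
  obtain \<psi> \<psi>' M where \<psi>: "\<And>t. (\<psi> has_real_derivative \<psi>' t) (at t)" and c\<psi>': "continuous_on UNIV \<psi>'" and M: "M > 0" "\<And>t. \<bar>\<psi>' t\<bar> \<le> M"
    and \<psi>1: "\<And>t. t \<le> 1 \<Longrightarrow> \<psi> t = 1" and \<psi>4: "\<And>t. t \<ge> 4 \<Longrightarrow> \<psi> t = 0" "\<And>t. t \<ge> 4 \<Longrightarrow> \<psi>' t = 0" and \<psi>01: "\<And>t. 0 \<le> \<psi> t \<and> \<psi> t \<le> 1"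
    using smooth_cutoff by metis
  have "closed {w :: real ^ 'n. \<forall>i. i \<notin> I1 x0 \<longrightarrow> w $ i = 0}" "subspace {w :: real ^ 'n. \<forall>i. i \<notin> I1 x0 \<longrightarrow> w $ i = 0}"
  proof -
    show "subspace {w :: real ^ 'n. \<forall>i. i \<notin> I1 x0 \<longrightarrow> w $ i = 0}" by (auto simp: subspace_def)
    then show "closed {w :: real ^ 'n. \<forall>i. i \<notin> I1 x0 \<longrightarrow> w $ i = 0}" by (rule closed_subspace)
  qed
  \<comment> \<open>An injective linear map on a subspace of finite dimension stretches all its
    vectors by at least a positive factor.\<close>
  then obtain m0 where m0: "m0 > 0" "\<And>w. \<forall>i. i \<notin> I1 x0 \<longrightarrow> w $ i = 0 \<Longrightarrow> m0 * norm w \<le> norm (?T w)"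
    using injective_imp_isometric[OF _ _ bl, of "{w. \<forall>i. i \<notin> I1 x0 \<longrightarrow> w $ i = 0}"] nd2 by auto
  \<comment> \<open>\<open>\<gamma>\<close> measures the nondegeneracy: it is a lower bound for the
    nonzero first derivatives and for the stretching of the Hessian along the stratum.\<close>
  define \<gamma> where "\<gamma> = Min (insert m0 ((\<lambda>i. \<bar>?g i\<bar>) ` {i. ?g i \<noteq> 0}))"
  have \<gamma>: "\<gamma> > 0" unfolding \<gamma>_def using m0 by (subst Min_gr_iff) auto
  have \<gamma>g: "\<gamma> \<le> \<bar>?g i\<bar>" if "?g i \<noteq> 0" for i unfolding \<gamma>_def using that by (intro Min_le) auto
  have \<gamma>m0: "\<gamma> \<le> m0" unfolding \<gamma>_def by (intro Min_le) auto
  \<comment> \<open>The factor of the errors along the stratum: 1 for the remainder of the gradient,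
    and the rest for the remainder of the value, at most
    \<open>?n * \<theta> * (2 * \<delta>)\<close> times the distance, multiplied by the slope
    \<open>4 * M / \<delta>\<close> of the cutoff. The radius cancels.\<close>
  define K where "K = 1 + 8 * ?n * M"
  have K: "K \<ge> 1" "1 + 8 * M \<le> K" using M n1 by (auto simp: K_def)
  \<comment> \<open>Chosen so that these errors, added over all coordinates, still stay below
    \<open>\<gamma>\<close>.\<close>
  define \<theta> where "\<theta> = \<gamma> / (2 * ?n * K)"
  have \<theta>: "\<theta> > 0" using \<gamma> n1 K by (simp add: \<theta>_def)
  have \<theta>K: "?n * (\<theta> * K) < \<gamma>" using \<gamma> n1 K by (simp add: \<theta>_def field_simps)
  have \<theta>K1: "\<theta> * (1 + 8 * M) < \<gamma>"
  proof -
    have "\<theta> * (1 + 8 * M) \<le> 1 * (\<theta> * K)" using K \<theta> by simp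
    also have "\<dots> \<le> ?n * (\<theta> * K)" using n1 \<theta> K by (intro mult_right_mono) auto
    finally show ?thesis using \<theta>K by simp
  qed
  have "\<forall>\<^sub>F x in nhds x0. \<bar>partial i f x - ?g i\<bar> < \<theta>" for i
  proof -
    have "(partial i f \<longlongrightarrow> ?g i) (nhds x0)"
      using has_gradient_continuous[OF gp, of UNIV i] by (simp add: continuous_on_eq_continuous_at isCont_def tendsto_nhds_iff continuous_at)
    then have "\<forall>\<^sub>F x in nhds x0. dist (partial i f x) (?g i) < \<theta>" using \<theta> by (rule tendstoD)
    then show ?thesis by (simp add: dist_real_def)
  qed
  then have "\<forall>\<^sub>F x in nhds x0. \<forall>i. \<bar>partial i f x - ?g i\<bar> < \<theta>" by (intro eventually_all_finite)
  moreover have "\<forall>\<^sub>F x in nhds x0. \<bar>f x - ?q x\<bar> \<le> \<theta> * norm (x - x0)"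
  proof -
    have "(f has_derivative (\<lambda>h. gradient f x0 \<bullet> h)) (at x0)" "(?q has_derivative (\<lambda>h. gradient f x0 \<bullet> h)) (at x0)"
      using gf gq linear_0[OF linear_core_hessian[of f x0]] by (auto simp: has_gradient_def dest!: spec[of _ x0])
    from has_derivative_diff[OF this]
    have "((\<lambda>x. f x - ?q x) has_derivative (\<lambda>h. 0)) (at x0)" by simp
    then obtain d where "d > 0" "\<And>y. norm (y - x0) < d \<Longrightarrow> norm (f y - ?q y - (f x0 - ?q x0) - 0) \<le> \<theta> * norm (y - x0)"
      using \<theta> unfolding has_derivative_at_alt by blast
    then show ?thesis unfolding eventually_nhds_metric dist_norm using q0 by auto
  qed
  moreover have "\<forall>\<^sub>F x in nhds x0. \<bar>partial i f x - ?g i - gradient (partial i f) x0 \<bullet> (x - x0)\<bar> \<le> \<theta> * norm (x - x0)" for i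
  proof -
    have "(partial i f has_derivative (\<lambda>h. gradient (partial i f) x0 \<bullet> h)) (at x0)"
      using gp by (auto simp: has_gradient_def)
    then obtain d where "d > 0" "\<And>y. norm (y - x0) < d \<Longrightarrow> norm (partial i f y - ?g i - gradient (partial i f) x0 \<bullet> (y - x0)) \<le> \<theta> * norm (y - x0)"
      using \<theta> unfolding has_derivative_at_alt by blast
    then show ?thesis unfolding eventually_nhds_metric dist_norm by auto
  qed
  then have "\<forall>\<^sub>F x in nhds x0. \<forall>i. \<bar>partial i f x - ?g i - gradient (partial i f) x0 \<bullet> (x - x0)\<bar> \<le> \<theta> * norm (x - x0)"
    by (intro eventually_all_finite)
  moreover have "\<forall>\<^sub>F x in nhds x0. \<forall>i\<in>I1 x0. x $ i \<noteq> 0"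
  proof (intro eventually_ball_finite ballI)
    fix i assume "i \<in> I1 x0"
    moreover have "((\<lambda>x. x $ i) \<longlongrightarrow> x0 $ i) (nhds x0)" by (intro tendsto_vec_nth filterlim_ident)
    ultimately show "\<forall>\<^sub>F x in nhds x0. x $ i \<noteq> 0"
      by (intro tendsto_imp_eventually_ne) (auto simp: I1_def)
  qed simp
  moreover have "\<forall>\<^sub>F x in nhds x0. a < f x \<and> f x < b \<and> a < ?q x \<and> ?q x < b"
  proof -
    have *: "(h \<longlongrightarrow> h x0) (nhds x0)" if "continuous_on UNIV h" for h :: "real ^ 'n \<Rightarrow> real"
      using that by (simp add: continuous_on_eq_continuous_at isCont_def tendsto_nhds_iff)
    have "(f \<longlongrightarrow> f x0) (nhds x0)" "(?q \<longlongrightarrow> f x0) (nhds x0)"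
      using *[OF has_gradient_continuous[OF gf]] *[OF has_gradient_continuous[OF gq]] unfolding q0 .
    then show ?thesis using ab by (intro eventually_conj order_tendstoD[where y="f x0"])
  qed
  ultimately have "\<forall>\<^sub>F x in nhds x0. (\<forall>i. \<bar>partial i f x - ?g i\<bar> < \<theta>) \<and> \<bar>f x - ?q x\<bar> \<le> \<theta> * norm (x - x0) \<and>
      (\<forall>i. \<bar>partial i f x - ?g i - gradient (partial i f) x0 \<bullet> (x - x0)\<bar> \<le> \<theta> * norm (x - x0)) \<and>
      (\<forall>i\<in>I1 x0. x $ i \<noteq> 0) \<and> (a < f x \<and> f x < b \<and> a < ?q x \<and> ?q x < b)"
    by eventually_elim blast
  then obtain d where d: "d > 0" and near: "\<And>x. norm (x - x0) < d \<Longrightarrow> (\<forall>i. \<bar>partial i f x - ?g i\<bar> < \<theta>) \<and> \<bar>f x - ?q x\<bar> \<le> \<theta> * norm (x - x0) \<and>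
      (\<forall>i. \<bar>partial i f x - ?g i - gradient (partial i f) x0 \<bullet> (x - x0)\<bar> \<le> \<theta> * norm (x - x0)) \<and>
      (\<forall>i\<in>I1 x0. x $ i \<noteq> 0) \<and> (a < f x \<and> f x < b \<and> a < ?q x \<and> ?q x < b)"
    unfolding eventually_nhds_metric dist_norm by blast
  define \<delta> where "\<delta> = d / 3"
  have \<delta>: "\<delta> > 0" and \<delta>d: "norm (x - x0) \<le> 2 * \<delta> \<Longrightarrow> norm (x - x0) < d" for x using d by (auto simp: \<delta>_def)
  define N where "N x = ((x - x0) \<bullet> (x - x0)) / \<delta>\<^sup>2" for x
  define ct where "ct x = \<psi> (N x)" for x
  define ct' where "ct' x = (\<psi>' (N x) * 2 / \<delta>\<^sup>2) *\<^sub>R (x - x0)" for x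
  define F where "F x = f x + ct x * (?q x - f x)" for x
  define G where "G x = gradient f x + ct x *\<^sub>R (gradient f x0 + ?T (x - x0) - gradient f x) + (?q x - f x) *\<^sub>R ct' x" for x
  have Nn: "N x = (norm (x - x0) / \<delta>)\<^sup>2" for x
    by (simp add: N_def dot_square_norm power_divide)
  have ct01: "0 \<le> ct x" "ct x \<le> 1" for x using \<psi>01 by (auto simp: ct_def)
  have ctd: "(ct has_derivative (\<lambda>h. ct' x \<bullet> h)) (at x)" for x
  proof -
    have 1: "((\<lambda>x. x - x0) has_derivative (\<lambda>h. h)) (at x)" by (auto intro!: derivative_eq_intros)
    have "(N has_derivative (\<lambda>h. ((x - x0) \<bullet> h + h \<bullet> (x - x0)) / \<delta>\<^sup>2)) (at x)"
      unfolding N_def[abs_def]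
      by (rule bounded_linear.has_derivative[OF bounded_linear_divide has_derivative_inner[OF 1 1]])
    from has_derivative_compose[OF this \<psi>[of "N x", unfolded has_field_derivative_def]]
    show ?thesis
      unfolding ct_def[abs_def] ct'_def by (simp add: inner_commute algebra_simps diff_divide_distrib)
  qed
  have FG: "has_gradient F G"
    unfolding has_gradient_def
  proof (intro conjI allI)
    fix x
    have df: "(f has_derivative (\<lambda>h. gradient f x \<bullet> h)) (at x)" and dq: "(?q has_derivative (\<lambda>h. (gradient f x0 + ?T (x - x0)) \<bullet> h)) (at x)"
      using gf gq by (auto simp: has_gradient_def)
    have "(F has_derivative (\<lambda>h. gradient f x \<bullet> h + (ct x * ((gradient f x0 + ?T (x - x0)) \<bullet> h - gradient f x \<bullet> h) + (ct' x \<bullet> h) * (?q x - f x)))) (at x)"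
      unfolding F_def[abs_def] by (intro has_derivative_add df has_derivative_mult[OF ctd has_derivative_diff[OF dq df]])
    then show "(F has_derivative (\<lambda>h. G x \<bullet> h)) (at x)"
      by (simp add: G_def inner_add_left inner_diff_left algebra_simps)
  next
    have cN: "continuous_on UNIV N" unfolding N_def by (intro continuous_intros) (use \<delta> in auto)
    have "continuous_on UNIV ct" using ctd by (meson continuous_at_imp_continuous_on has_derivative_continuous)
    moreover have "continuous_on UNIV ct'" unfolding ct'_def
      using \<delta> by (intro continuous_intros continuous_on_compose2[OF c\<psi>' cN]) auto
    moreover have "continuous_on UNIV (gradient f)" using gf by (simp add: has_gradient_def)
    moreover have "continuous_on UNIV (\<lambda>x. ?T (x - x0))"
      by (intro continuous_intros bounded_linear.continuous_on[OF bl])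
    ultimately show "continuous_on UNIV G" unfolding G_def
      by (intro continuous_intros has_gradient_continuous[OF gf] has_gradient_continuous[OF gq]) (auto intro: continuous_intros)
  qed
  have ct'b: "\<bar>ct' x $ i\<bar> \<le> 4 * M / \<delta>" if x: "norm (x - x0) \<le> 2 * \<delta>" for x i
  proof -
    have "\<bar>ct' x $ i\<bar> \<le> norm (ct' x)" by (rule component_le_norm_cart)
    also have "\<dots> = \<bar>\<psi>' (N x)\<bar> * 2 / \<delta>\<^sup>2 * norm (x - x0)" by (simp add: ct'_def abs_mult)
    also have "\<dots> \<le> M * 2 / \<delta>\<^sup>2 * (2 * \<delta>)"
      using M x \<delta> by (intro mult_mono divide_right_mono) auto
    also have "\<dots> = 4 * M / \<delta>" using \<delta> by (simp add: power2_eq_square)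
    finally show ?thesis .
  qed
  have Gi: "G x $ i = (1 - ct x) * partial i f x + ct x * (?g i + ?T (x - x0) $ i) + (?q x - f x) * ct' x $ i" for x i
    by (simp add: G_def gradient_component algebra_simps)
  show ?thesis
  proof (rule that[OF \<delta> FG])
    show "F x = f x \<and> G x = gradient f x" if "norm (x - x0) > 2 * \<delta>" for x
    proof -
      have "2 \<le> norm (x - x0) / \<delta>" using that \<delta> by (simp add: le_divide_eq)
      then have "2\<^sup>2 \<le> N x" unfolding Nn by (intro power_mono) auto
      then show ?thesis using \<psi>4[of "N x"] by (simp add: F_def G_def ct_def ct'_def)
    qed
    show "F x = ?q x" if "norm (x - x0) \<le> \<delta>" for x
    proof -
      have "norm (x - x0) / \<delta> \<le> 1" using that \<delta> by simp
      then have "N x \<le> 1" unfolding Nn using \<delta> by (simp add: power_le_one)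
      then show ?thesis using \<psi>1[of "N x"] by (simp add: F_def ct_def)
    qed
    show "x $ i \<noteq> 0" if "norm (x - x0) \<le> 2 * \<delta>" "i \<in> I1 x0" for x i
      using near[OF \<delta>d[OF that(1)]] that(2) by blast
    show "a < f x \<and> f x < b \<and> a < F x \<and> F x < b" if "norm (x - x0) \<le> 2 * \<delta>" for x
    proof -
      have 1: "a < f x" "f x < b" "a < ?q x" "?q x < b" using near[OF \<delta>d[OF that]] by auto
      have F: "F x = (1 - ct x) * f x + ct x * ?q x" by (simp add: F_def algebra_simps)
      have "F x \<in> {a<..<b}"
        unfolding F using convexD[OF convex_real_interval(8), of "f x" a b "?q x" "1 - ct x" "ct x"] 1 ct01[of x] by simp
      then show ?thesis using 1 by simp
    qed
    fix x assume x: "x \<in> sparse_vectors s" "norm (x - x0) \<le> 2 * \<delta>" "x \<noteq> x0"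
    note nx = near[OF \<delta>d[OF x(2)]]
    let ?r = "norm (x - x0)"
    show "\<exists>i. x $ i \<noteq> 0 \<and> G x $ i \<noteq> 0"
    proof (cases "\<exists>i\<in>I0 x0. x $ i \<noteq> 0")
      case True
      then obtain i where i: "i \<in> I0 x0" "x $ i \<noteq> 0" by blast
      \<comment> \<open>\<open>x\<close> keeps all nonzero coordinates of \<open>x0\<close> and has
        one more, so \<open>x0\<close> has fewer than \<open>s\<close> of them and the first
        nondegeneracy condition applies.\<close>
      have "insert i (I1 x0) \<subseteq> {i. x $ i \<noteq> 0}" using i nx by auto
      then have "card (insert i (I1 x0)) \<le> norm0 x" unfolding norm0_def by (intro card_mono) auto
      moreover have "i \<notin> I1 x0" using i by (simp add: I0_def I1_def)
      ultimately have "norm0 x0 < s" using x(1) by (simp add: sparse_vectors_def norm0_def I1_def)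
      then have gi: "?g i \<noteq> 0" using nd1 i by blast
      have Ti: "?T (x - x0) $ i = 0" using \<open>i \<notin> I1 x0\<close> by (rule core_hessian_outside)
      have e: "G x $ i - ?g i = (1 - ct x) * (partial i f x - ?g i) + (?q x - f x) * ct' x $ i"
        unfolding Gi Ti by (simp add: algebra_simps)
      have "\<bar>(1 - ct x) * (partial i f x - ?g i)\<bar> \<le> 1 * \<theta>"
        unfolding abs_mult using ct01[of x] nx by (intro mult_mono) (auto simp: less_imp_le)
      moreover have "\<bar>(?q x - f x) * ct' x $ i\<bar> \<le> (\<theta> * (2 * \<delta>)) * (4 * M / \<delta>)"
      proof -
        have "\<bar>?q x - f x\<bar> \<le> \<theta> * ?r" using nx by (simp add: abs_minus_commute)
        also have "\<dots> \<le> \<theta> * (2 * \<delta>)" using x \<theta> by (intro mult_left_mono) auto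
        finally show ?thesis unfolding abs_mult using ct'b[OF x(2)] \<theta> \<delta> by (intro mult_mono) auto
      qed
      ultimately have "\<bar>G x $ i - ?g i\<bar> \<le> 1 * \<theta> + (\<theta> * (2 * \<delta>)) * (4 * M / \<delta>)"
        unfolding e by (intro order_trans[OF abs_triangle_ineq] add_mono)
      also have "\<dots> = \<theta> * (1 + 8 * M)" using \<delta> by (simp add: algebra_simps)
      also have "\<dots> < \<bar>?g i\<bar>" using \<theta>K1 \<gamma>g[OF gi] by simp
      finally have "G x $ i \<noteq> 0" by auto
      then show ?thesis using i by blast
    next
      case False
      then have w: "\<forall>i. i \<notin> I1 x0 \<longrightarrow> (x - x0) $ i = 0" by (auto simp: I0_def I1_def)
      have grad_i: "\<bar>partial i f y - ?T (y - x0) $ i\<bar> \<le> \<theta> * norm (y - x0)"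
        if i: "i \<in> I1 x0" and y: "norm (y - x0) < d" "\<forall>i. i \<notin> I1 x0 \<longrightarrow> (y - x0) $ i = 0" for y i
      proof -
        have "gradient (partial i f) x0 \<bullet> (y - x0) = (\<Sum>j\<in>I1 x0. partial j (partial i f) x0 * (y - x0) $ j)"
          unfolding inner_vec_def gradient_component inner_real_def using y(2) by (intro sum.mono_neutral_right) auto
        also have "\<dots> = ?T (y - x0) $ i"
          using i by (simp add: core_hessian_def partial_commute[OF f, of _ i])
        finally show ?thesis using near[OF y(1)] g1[OF i] by (metis diff_zero)
      qed
      \<comment> \<open>Along the stratum each component of the difference of gradients is at most
        \<open>\<theta>\<close> times the distance. The mean value theorem on the segment from
        \<open>x0\<close> makes the difference of values quadratic in the distance.\<close>
      have qf: "\<bar>?q x - f x\<bar> \<le> ?n * \<theta> * ?r\<^sup>2"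
      proof -
        have "has_gradient (\<lambda>x. f x - ?q x) (\<lambda>x. gradient f x - (gradient f x0 + ?T (x - x0)))"
          unfolding has_gradient_def
        proof (intro conjI allI)
          show "((\<lambda>x. f x - ?q x) has_derivative (\<lambda>h. (gradient f x - (gradient f x0 + ?T (x - x0))) \<bullet> h)) (at x)" for x
            unfolding inner_diff_left using gf gq by (intro has_derivative_diff) (auto simp: has_gradient_def)
          show "continuous_on UNIV (\<lambda>x. gradient f x - (gradient f x0 + ?T (x - x0)))"
            using gf gq by (intro continuous_on_diff) (auto simp: has_gradient_def)
        qed
        from has_gradient_mvt[OF this, of 1 x0 "x - x0"]
        obtain \<xi> where \<xi>: "0 \<le> \<xi>" "\<xi> \<le> 1" and eq: "f x - ?q x - (f x0 - ?q x0) = (gradient f (x0 + \<xi> *\<^sub>R (x - x0)) - (gradient f x0 + ?T (x0 + \<xi> *\<^sub>R (x - x0) - x0))) \<bullet> (x - x0)"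
          by auto
        define y where "y = x0 + \<xi> *\<^sub>R (x - x0)"
        have yx: "y - x0 = \<xi> *\<^sub>R (x - x0)" by (simp add: y_def)
        have ny: "norm (y - x0) \<le> ?r" unfolding yx using \<xi> by (simp add: mult_left_le_one_le)
        then have yd: "norm (y - x0) < d" using \<delta>d[OF x(2)] by simp
        have y1: "\<forall>i. i \<notin> I1 x0 \<longrightarrow> (y - x0) $ i = 0" unfolding yx using w by simp
        have "f x - ?q x = (\<Sum>i\<in>UNIV. (partial i f y - (?g i + ?T (y - x0) $ i)) * (x - x0) $ i)"
          using eq q0 unfolding y_def[symmetric] by (simp add: inner_vec_def gradient_component)
        moreover have "\<bar>(partial i f y - (?g i + ?T (y - x0) $ i)) * (x - x0) $ i\<bar> \<le> (\<theta> * ?r) * ?r" for i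
        proof (cases "i \<in> I1 x0")
          case True
          have "\<bar>partial i f y - (?g i + ?T (y - x0) $ i)\<bar> \<le> \<theta> * norm (y - x0)"
            using grad_i[OF True yd y1] g1[OF True] by simp
          also have "\<dots> \<le> \<theta> * ?r" using ny \<theta> by (intro mult_left_mono) auto
          finally show ?thesis unfolding abs_mult using component_le_norm_cart[of "x - x0" i] \<theta> by (intro mult_mono) auto
        next
          case False
          then have "(x - x0) $ i = 0" using w by blast
          then show ?thesis using \<theta> by (simp only: mult_zero_right abs_zero) simp
        qed
        then have "\<bar>\<Sum>i\<in>UNIV. (partial i f y - (?g i + ?T (y - x0) $ i)) * (x - x0) $ i\<bar> \<le> of_nat (card (UNIV :: 'n set)) * ((\<theta> * ?r) * ?r)"
          by (intro order_trans[OF sum_abs] sum_bounded_above) auto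
        ultimately show ?thesis by (simp add: abs_minus_commute power2_eq_square algebra_simps)
      qed
      show ?thesis
      proof (rule ccontr)
        \<comment> \<open>If \<open>G x\<close> vanished along the stratum, the Hessian term would
          equal the error terms and fall below its lower bound \<open>m0 * ?r\<close>.\<close>
        assume "\<not> ?thesis"
        then have G0: "G x $ i = 0" if "i \<in> I1 x0" for i using nx that by blast
        have rpos: "?r > 0" using x(3) by simp
        have Tb: "\<bar>?T (x - x0) $ i\<bar> \<le> \<theta> * K * ?r" for i
        proof (cases "i \<in> I1 x0")
          case True
          have e: "?T (x - x0) $ i = - ((1 - ct x) * (partial i f x - ?T (x - x0) $ i) + (?q x - f x) * ct' x $ i)"
            using G0[OF True] g1[OF True] unfolding Gi by (simp add: algebra_simps)
          have "\<bar>(1 - ct x) * (partial i f x - ?T (x - x0) $ i)\<bar> \<le> 1 * (\<theta> * ?r)"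
            unfolding abs_mult using ct01[of x] grad_i[OF True \<delta>d[OF x(2)] w] by (intro mult_mono) auto
          moreover have "\<bar>(?q x - f x) * ct' x $ i\<bar> \<le> (?n * \<theta> * ?r * (2 * \<delta>)) * (4 * M / \<delta>)"
          proof -
            have "(?n * \<theta> * ?r) * ?r \<le> (?n * \<theta> * ?r) * (2 * \<delta>)"
              using x \<theta> by (intro mult_left_mono) auto
            then have "?n * \<theta> * ?r\<^sup>2 \<le> ?n * \<theta> * ?r * (2 * \<delta>)"
              by (simp add: power2_eq_square mult.assoc)
            with qf have "\<bar>?q x - f x\<bar> \<le> ?n * \<theta> * ?r * (2 * \<delta>)" by (rule order_trans)
            then show ?thesis unfolding abs_mult using ct'b[OF x(2)] \<theta> \<delta> by (intro mult_mono) auto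
          qed
          moreover have "\<bar>?T (x - x0) $ i\<bar> = \<bar>(1 - ct x) * (partial i f x - ?T (x - x0) $ i) + (?q x - f x) * ct' x $ i\<bar>"
            using arg_cong[OF e, of abs] by (simp only: abs_minus_cancel)
          ultimately have "\<bar>?T (x - x0) $ i\<bar> \<le> 1 * (\<theta> * ?r) + (?n * \<theta> * ?r * (2 * \<delta>)) * (4 * M / \<delta>)"
            by linarith
          also have "\<dots> = \<theta> * K * ?r" using \<delta> by (simp add: K_def algebra_simps)
          finally show ?thesis .
        next
          case False
          then show ?thesis using core_hessian_outside[OF False, of f "x - x0"] \<theta> K by simp
        qed
        have "m0 * ?r \<le> norm (?T (x - x0))" by (rule m0(2)[OF w])
        also have "\<dots> \<le> (\<Sum>i\<in>UNIV. \<bar>?T (x - x0) $ i\<bar>)" by (rule norm_le_l1_cart)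
        also have "\<dots> \<le> of_nat (card (UNIV :: 'n set)) * (\<theta> * K * ?r)" by (intro sum_bounded_above Tb)
        also have "\<dots> = (?n * (\<theta> * K)) * ?r" by simp
        also have "\<dots> < \<gamma> * ?r" using \<theta>K rpos by (intro mult_strict_right_mono)
        also have "\<dots> \<le> m0 * ?r" using \<gamma>m0 by (intro mult_right_mono) auto
        finally show False by simp
      qed
    qed
  qed
qed

section \<open>The core of the handle\<close>

text \<open>The data provided by the diagonalization: \<open>\<beta>\<close> is an orthonormal
  eigenbasis of the Hessian along the stratum, \<open>d\<close> lists the eigenvalues, and the
  \<open>q\<close> negative ones come first.\<close>

locale nondegenerate_point =
  fixes f :: "real ^ 'n::finite \<Rightarrow> real" and x0 :: "real ^ 'n" and s k q :: nat
    and \<beta> :: "nat \<Rightarrow> real ^ 'n" and d :: "nat \<Rightarrow> real"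
  assumes stat: "M_stationary s f x0"
    and nd1: "norm0 x0 < s \<Longrightarrow> \<forall>i\<in>I0 x0. partial i f x0 \<noteq> 0"
    and k: "norm0 x0 = k" and qk: "q \<le> k"
    and \<beta>0: "\<And>l i. l < k \<Longrightarrow> i \<notin> I1 x0 \<Longrightarrow> \<beta> l $ i = 0"
    and \<beta>\<beta>: "\<And>l m. l < k \<Longrightarrow> m < k \<Longrightarrow> \<beta> l \<bullet> \<beta> m = (if l = m then 1 else 0)"
    and d0: "\<And>l. l < k \<Longrightarrow> d l \<noteq> 0" and dq: "\<And>l. l < k \<Longrightarrow> d l < 0 \<longleftrightarrow> l < q"
    and eig: "\<And>l i. l < k \<Longrightarrow> i \<in> I1 x0 \<Longrightarrow> (\<Sum>j\<in>I1 x0. partial i (partial j f) x0 * \<beta> l $ j) = d l * \<beta> l $ i"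
    and expand: "\<And>x. (\<And>i. i \<notin> I1 x0 \<Longrightarrow> x $ i = 0) \<Longrightarrow> x = (\<Sum>l<k. (x \<bullet> \<beta> l) *\<^sub>R \<beta> l)"
begin

definition y :: "nat \<Rightarrow> real ^ 'n \<Rightarrow> real" where "y l x = (x - x0) \<bullet> \<beta> l"

text \<open>The point with entries \<open>u\<close> off the support of \<open>x0\<close> and with
  displacement along the stratum given by the coefficients \<open>v\<close> in the basis
  \<open>\<beta>\<close>.\<close>

definition pt :: "('n \<Rightarrow> real) \<Rightarrow> (nat \<Rightarrow> real) \<Rightarrow> real ^ 'n" where
  "pt u v = x0 + (\<chi> i. if i \<in> I0 x0 then u i else 0) + (\<Sum>l<k. v l *\<^sub>R \<beta> l)"

lemma I0_iff: "i \<in> I0 x0 \<longleftrightarrow> i \<notin> I1 x0" and I0_zero: "i \<in> I0 x0 \<Longrightarrow> x0 $ i = 0"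
  by (auto simp: I0_def I1_def)

lemma pt_nth: "i \<in> I0 x0 \<Longrightarrow> pt u v $ i = u i"
  by (simp add: pt_def I0_zero \<beta>0 I0_iff)

lemma inner_\<beta>: "w \<bullet> \<beta> l = (\<Sum>i\<in>I1 x0. w $ i * \<beta> l $ i)" if "l < k"
  unfolding inner_vec_def inner_real_def using \<beta>0[OF that] by (intro sum.mono_neutral_right) auto

lemma y_pt: "l < k \<Longrightarrow> y l (pt u v) = v l"
proof -
  assume l: "l < k"
  have "(\<chi> i. if i \<in> I0 x0 then u i else 0) \<bullet> \<beta> l = 0"
    unfolding inner_\<beta>[OF l] by (intro sum.neutral) (auto simp: I0_iff)
  moreover have "(\<Sum>m<k. v m *\<^sub>R \<beta> m) \<bullet> \<beta> l = (\<Sum>m<k. v m * (if m = l then 1 else 0))"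
    unfolding inner_sum_left using \<beta>\<beta> l by (intro sum.cong) auto
  ultimately show ?thesis using l
    by (simp add: y_def pt_def inner_add_left if_distrib[of "(*) _"] cong: if_cong)
qed

lemma pt_coords: "pt (\<lambda>i. x $ i) (\<lambda>l. y l x) = x"
proof -
  define w where "w = (\<chi> i. if i \<in> I1 x0 then x $ i - x0 $ i else 0)"
  have wy: "w \<bullet> \<beta> l = y l x" if "l < k" for l
    unfolding y_def inner_\<beta>[OF that] by (intro sum.cong) (auto simp: w_def)
  have "w = (\<Sum>l<k. (w \<bullet> \<beta> l) *\<^sub>R \<beta> l)" by (rule expand) (simp add: w_def)
  then have "(\<Sum>l<k. y l x *\<^sub>R \<beta> l) = w" using wy by simp
  then show ?thesis
    unfolding pt_def by (auto simp: w_def Finite_Cartesian_Product.vec_eq_iff I0_iff I0_zero)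
qed

lemma eqI_coords: "(\<And>i. i \<in> I0 x0 \<Longrightarrow> x $ i = z $ i) \<Longrightarrow> (\<And>l. l < k \<Longrightarrow> y l x = y l z) \<Longrightarrow> x = z"
proof -
  assume 1: "\<And>i. i \<in> I0 x0 \<Longrightarrow> x $ i = z $ i" and 2: "\<And>l. l < k \<Longrightarrow> y l x = y l z"
  have "pt (\<lambda>i. x $ i) (\<lambda>l. y l x) = pt (\<lambda>i. z $ i) (\<lambda>l. y l z)"
    unfolding pt_def using 1 2 by (auto simp: Finite_Cartesian_Product.vec_eq_iff)
  then show ?thesis unfolding pt_coords .
qed

lemma inner_split: "w \<bullet> z = (\<Sum>i\<in>I0 x0. w $ i * z $ i) + (\<Sum>i\<in>I1 x0. w $ i * z $ i)"
proof -
  have "I0 x0 \<union> I1 x0 = UNIV" "I0 x0 \<inter> I1 x0 = {}" by (auto simp: I0_iff)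
  then show ?thesis
    unfolding inner_vec_def inner_real_def by (metis finite sum.union_disjoint)
qed

lemma stratum_component: "i \<in> I1 x0 \<Longrightarrow> (x - x0) $ i = (\<Sum>l<k. y l x *\<^sub>R \<beta> l) $ i"
proof -
  assume i: "i \<in> I1 x0"
  have "x $ i = pt (\<lambda>i. x $ i) (\<lambda>l. y l x) $ i" by (simp only: pt_coords)
  then show ?thesis using i by (simp add: pt_def I0_iff)
qed

text \<open>Parseval's identity along the stratum; off the support \<open>x0\<close>
  vanishes.\<close>

lemma norm_coords: "(norm (x - x0))\<^sup>2 = (\<Sum>i\<in>I0 x0. (x $ i)\<^sup>2) + (\<Sum>l<k. (y l x)\<^sup>2)"
proof -
  have "(\<Sum>i\<in>I1 x0. (x - x0) $ i * (x - x0) $ i) = (\<Sum>i\<in>I1 x0. (x - x0) $ i * (\<Sum>l<k. y l x *\<^sub>R \<beta> l) $ i)"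
    by (intro sum.cong refl arg_cong2[where f="(*)"] stratum_component)
  also have "\<dots> = (\<Sum>i\<in>I1 x0. \<Sum>l<k. y l x * ((x - x0) $ i * \<beta> l $ i))"
    by (simp add: sum_distrib_left mult.left_commute)
  also have "\<dots> = (\<Sum>l<k. y l x * (\<Sum>i\<in>I1 x0. (x - x0) $ i * \<beta> l $ i))"
    by (subst sum.swap) (simp add: sum_distrib_left)
  also have "\<dots> = (\<Sum>l<k. (y l x)\<^sup>2)"
    by (intro sum.cong refl) (simp only: lessThan_iff inner_\<beta>[symmetric] y_def[symmetric] power2_eq_square)
  finally show ?thesis
    unfolding power2_norm_eq_inner inner_split by (simp add: I0_zero power2_eq_square)
qed

text \<open>Only the displacement along the stratum enters, and the form is diagonal in the
  eigenbasis.\<close>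

lemma core_hessian_y: "(x - x0) \<bullet> core_hessian f x0 (x - x0) = (\<Sum>l<k. d l * (y l x)\<^sup>2)"
proof -
  let ?T = "core_hessian f x0"
  have T\<beta>: "?T (\<beta> l) = d l *\<^sub>R \<beta> l" if "l < k" for l
    using eig[OF that] \<beta>0[OF that] by (auto simp: core_hessian_def Finite_Cartesian_Product.vec_eq_iff)
  have "?T (x - x0) = ?T (\<Sum>l<k. y l x *\<^sub>R \<beta> l)"
    unfolding core_hessian_def Finite_Cartesian_Product.vec_eq_iff
    by (auto simp del: sum_component vector_minus_component intro!: sum.cong simp: stratum_component)
  also have "\<dots> = (\<Sum>l<k. (y l x * d l) *\<^sub>R \<beta> l)"
    using T\<beta> by (simp add: linear_sum[OF linear_core_hessian] linear_scale[OF linear_core_hessian])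
  finally show ?thesis
    by (simp add: inner_sum_right y_def[symmetric] power2_eq_square mult.assoc mult.left_commute)
qed

text \<open>In the rescaled coordinates \<open>\<gamma> i * x $ i\<close> the linear term of the
  model becomes minus their sum. The value 1 keeps the rescaling invertible where the derivative
  vanishes.\<close>

definition \<gamma> :: "'n \<Rightarrow> real" where "\<gamma> i = (if partial i f x0 = 0 then 1 else - partial i f x0)"

lemma \<gamma>0: "\<gamma> i \<noteq> 0" by (simp add: \<gamma>_def)

lemma ks: "k \<le> s" using stat k by (simp add: M_stationary_def sparse_vectors_def)

lemma card_I1: "card (I1 x0) = k" using k by (simp add: norm0_def I1_def)

text \<open>If \<open>k = s\<close>, the linear term may vanish, but then so do the coordinates in \<open>I0 x0\<close> of nearby sparse points.\<close>

lemma support_I0_card: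
  assumes "x \<in> sparse_vectors s" "\<And>i. i \<in> I1 x0 \<Longrightarrow> x $ i \<noteq> 0"
  shows "card {i \<in> I0 x0. x $ i \<noteq> 0} \<le> s - k"
proof -
  have "{i. x $ i \<noteq> 0} = {i \<in> I0 x0. x $ i \<noteq> 0} \<union> I1 x0" using assms(2) by (auto simp: I0_iff)
  then have "card {i. x $ i \<noteq> 0} = card {i \<in> I0 x0. x $ i \<noteq> 0} + card (I1 x0)"
    by (simp add: card_Un_disjoint I0_iff disjoint_iff)
  then show ?thesis using assms(1) card_I1 by (simp add: sparse_vectors_def norm0_def)
qed

lemma local_model_coords:
  assumes "x \<in> sparse_vectors s" "\<And>i. i \<in> I1 x0 \<Longrightarrow> x $ i \<noteq> 0"
  shows "local_model f x0 x = f x0 - (\<Sum>i\<in>I0 x0. \<gamma> i * x $ i) + (\<Sum>l<k. d l * (y l x)\<^sup>2) / 2"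
proof -
  have "gradient f x0 \<bullet> (x - x0) = (\<Sum>i\<in>I0 x0. partial i f x0 * x $ i)"
    unfolding inner_split using stat by (simp add: gradient_component I0_zero M_stationary_def)
  also have "\<dots> = (\<Sum>i\<in>I0 x0. - (\<gamma> i * x $ i))"
  proof (cases "k < s")
    case True
    then show ?thesis using nd1 k by (intro sum.cong) (auto simp: \<gamma>_def)
  next
    case False
    then have "{i \<in> I0 x0. x $ i \<noteq> 0} = {}" using support_I0_card[OF assms] by simp
    then show ?thesis by (intro sum.cong) auto
  qed
  finally show ?thesis by (simp add: local_model_def core_hessian_y sum_negf)
qed

section \<open>Truncation to the core and its parametrization\<close>

definition R :: "real ^ 'n \<Rightarrow> real ^ 'n" where
  "R x = pt (\<lambda>i. max 0 (\<gamma> i * x $ i) / \<gamma> i) (\<lambda>l. if l < q then y l x else 0)"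

lemma R_nth: "i \<in> I0 x0 \<Longrightarrow> R x $ i = (if 0 \<le> \<gamma> i * x $ i then x $ i else 0)"
  using \<gamma>0[of i] by (auto simp: R_def pt_nth max_def)

lemma y_R: "l < k \<Longrightarrow> y l (R x) = (if l < q then y l x else 0)"
  by (simp add: R_def y_pt)

lemma norm_R: "norm (R x - x0) \<le> norm (x - x0)"
proof -
  have "(norm (R x - x0))\<^sup>2 \<le> (norm (x - x0))\<^sup>2"
    unfolding norm_coords by (intro add_mono sum_mono) (auto simp: R_nth y_R)
  then show ?thesis by (rule power2_le_imp_le) simp
qed

lemma continuous_on_R: "continuous_on S R"
proof -
  have "continuous_on S (\<lambda>x. if i \<in> I0 x0 then max 0 (\<gamma> i * x $ i) / \<gamma> i else 0)" for i
    using \<gamma>0 by (cases "i \<in> I0 x0") (auto intro!: continuous_intros)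
  moreover have "continuous_on S (\<lambda>x. (if l < q then y l x else 0) *\<^sub>R \<beta> l)" for l
    by (cases "l < q") (auto simp: y_def intro!: continuous_intros)
  ultimately show ?thesis
    unfolding R_def[abs_def] pt_def by (intro continuous_on_add continuous_on_const continuous_on_vec_lambda continuous_on_sum)
qed

text \<open>\<open>R\<close> creates no nonzero entry off the support of \<open>x0\<close>, and on
  that support the entries of \<open>x\<close> are nonzero already.\<close>

lemma collapse_support:
  assumes "x \<in> sparse_vectors s" "\<And>i. i \<in> I1 x0 \<Longrightarrow> x $ i \<noteq> 0"
  shows "x + m *\<^sub>R (R x - x) \<in> sparse_vectors s"
proof (rule sparse_vectors_mono_support[OF assms(1)])
  fix i assume "x $ i = 0"
  then show "(x + m *\<^sub>R (R x - x)) $ i = 0" using assms(2)[of i] R_nth[of i x] I0_iff[of i] by auto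
qed

lemma norm_collapse: "0 \<le> m \<Longrightarrow> m \<le> 1 \<Longrightarrow> norm (x + m *\<^sub>R (R x - x) - x0) \<le> norm (x - x0)"
proof -
  assume m: "0 \<le> m" "m \<le> 1"
  have "x + m *\<^sub>R (R x - x) - x0 = (1 - m) *\<^sub>R (x - x0) + m *\<^sub>R (R x - x0)" by (simp add: algebra_simps)
  also have "norm \<dots> \<le> (1 - m) * norm (x - x0) + m * norm (R x - x0)"
    using m by (intro order_trans[OF norm_triangle_ineq]) simp
  also have "\<dots> \<le> (1 - m) * norm (x - x0) + m * norm (x - x0)"
    using m norm_R by (intro add_left_mono mult_left_mono) auto
  finally show ?thesis by (simp add: algebra_simps)
qed

text \<open>Towards \<open>R x\<close> every negative \<open>\<gamma> i * x $ i\<close> rises to 0,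
  and every coordinate with positive eigenvalue shrinks. The model contains the former with a minus
  sign and the squares of the latter with positive weights, so it cannot increase.\<close>

lemma local_model_collapse:
  assumes x: "x \<in> sparse_vectors s" "\<And>i. i \<in> I1 x0 \<Longrightarrow> x $ i \<noteq> 0"
    and z: "\<And>i. i \<in> I1 x0 \<Longrightarrow> (x + m *\<^sub>R (R x - x)) $ i \<noteq> 0" and m: "0 \<le> m" "m \<le> 1"
  shows "local_model f x0 (x + m *\<^sub>R (R x - x)) \<le> local_model f x0 x"
proof -
  let ?z = "x + m *\<^sub>R (R x - x)"
  have zi: "\<gamma> i * x $ i \<le> \<gamma> i * ?z $ i" if "i \<in> I0 x0" for i
  proof (cases "0 \<le> \<gamma> i * x $ i")
    case False
    then have "R x $ i = 0" using that by (simp add: R_nth)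
    then have "?z $ i = (1 - m) * x $ i" by (simp add: algebra_simps)
    then have "\<gamma> i * ?z $ i = (1 - m) * (\<gamma> i * x $ i)" by simp
    moreover have "m * (\<gamma> i * x $ i) \<le> 0" using False m by (simp add: mult_nonneg_nonpos)
    moreover have "(1 - m) * (\<gamma> i * x $ i) = \<gamma> i * x $ i - m * (\<gamma> i * x $ i)" by (simp add: algebra_simps)
    ultimately show ?thesis by linarith
  qed (use that in \<open>simp add: R_nth\<close>)
  have yz: "d l * (y l ?z)\<^sup>2 \<le> d l * (y l x)\<^sup>2" if l: "l < k" for l
  proof -
    have y0: "y l ?z = y l x + m * (y l (R x) - y l x)"
      by (simp add: y_def inner_add_left inner_diff_left algebra_simps)
    have e: "y l ?z = (if l < q then y l x else (1 - m) * y l x)"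
      unfolding y0 y_R[OF l] by (simp add: algebra_simps)
    show ?thesis
    proof (cases "l < q")
      case False
      then have "0 \<le> d l" using dq[OF l] by auto
      moreover have "(y l ?z)\<^sup>2 \<le> (y l x)\<^sup>2"
      proof -
        have "(1 - m)\<^sup>2 \<le> 1" using m by (simp add: power_le_one)
        then have "(1 - m)\<^sup>2 * (y l x)\<^sup>2 \<le> 1 * (y l x)\<^sup>2" by (intro mult_right_mono) auto
        then show ?thesis using e False by (simp add: power_mult_distrib)
      qed
      ultimately show ?thesis by (intro mult_left_mono)
    qed (use e in simp)
  qed
  have "(\<Sum>i\<in>I0 x0. \<gamma> i * x $ i) \<le> (\<Sum>i\<in>I0 x0. \<gamma> i * ?z $ i)" by (intro sum_mono zi)
  moreover have "(\<Sum>l<k. d l * (y l ?z)\<^sup>2) \<le> (\<Sum>l<k. d l * (y l x)\<^sup>2)" by (intro sum_mono yz) simp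
  moreover have "local_model f x0 x = f x0 - (\<Sum>i\<in>I0 x0. \<gamma> i * x $ i) + (\<Sum>l<k. d l * (y l x)\<^sup>2) / 2"
    by (rule local_model_coords[OF x])
  moreover have "local_model f x0 ?z = f x0 - (\<Sum>i\<in>I0 x0. \<gamma> i * ?z $ i) + (\<Sum>l<k. d l * (y l ?z)\<^sup>2) / 2"
    by (rule local_model_coords[OF collapse_support[OF x] z])
  ultimately show ?thesis by simp
qed

text \<open>With \<open>w l = c l * y l x\<close>, the term \<open>d l * (y l x)\<^sup>2 / 2\<close>
  of the model becomes \<open>- (w l)\<^sup>2\<close>.\<close>

definition c :: "nat \<Rightarrow> real" where "c l = sqrt (- d l / 2)"

lemma c_pos: "l < q \<Longrightarrow> c l > 0" and c_sq: "l < q \<Longrightarrow> (c l)\<^sup>2 = - d l / 2"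
  using dq[of l] qk by (auto simp: c_def)

definition \<kappa> :: "(real ^ 'n) \<times> (nat \<Rightarrow> real) \<Rightarrow> real ^ 'n" where
  "\<kappa> z = pt (\<lambda>i. fst z $ i / \<gamma> i) (\<lambda>l. if l < q then snd z l / c l else 0)"

lemma \<kappa>_nth: "i \<in> I0 x0 \<Longrightarrow> \<kappa> z $ i = fst z $ i / \<gamma> i" and y_\<kappa>: "l < k \<Longrightarrow> y l (\<kappa> z) = (if l < q then snd z l / c l else 0)"
  by (simp_all add: \<kappa>_def pt_nth y_pt)

lemma continuous_on_\<kappa>: "continuous_on S \<kappa>"
proof -
  have s: "continuous_on S (\<lambda>z :: (real ^ 'n) \<times> (nat \<Rightarrow> real). snd z l)" for l
    by (rule continuous_on_product_then_coordinatewise[OF continuous_on_snd[OF continuous_on_id]])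
  have "continuous_on S (\<lambda>z :: (real ^ 'n) \<times> (nat \<Rightarrow> real). if i \<in> I0 x0 then fst z $ i / \<gamma> i else 0)" for i
    using \<gamma>0 by (cases "i \<in> I0 x0") (auto intro!: continuous_intros)
  moreover have "continuous_on S (\<lambda>z :: (real ^ 'n) \<times> (nat \<Rightarrow> real). (if l < q then snd z l / c l else 0) *\<^sub>R \<beta> l)" for l
    using c_pos[of l] by (cases "l < q") (auto intro!: continuous_intros s)
  ultimately show ?thesis
    unfolding \<kappa>_def[abs_def] pt_def by (intro continuous_on_add continuous_on_const continuous_on_vec_lambda continuous_on_sum)
qed

abbreviation "kone \<epsilon> \<equiv> core_cone \<epsilon> (s - k) q (I0 x0)"

lemma inj_\<kappa>: "inj_on \<kappa> (kone \<epsilon>)"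
proof (rule inj_onI)
  fix z z' assume z: "z \<in> kone \<epsilon>" "z' \<in> kone \<epsilon>" and eq: "\<kappa> z = \<kappa> z'"
  have "fst z $ i = fst z' $ i" for i
    using z \<kappa>_nth[of i z] \<kappa>_nth[of i z'] eq \<gamma>0[of i] by (cases "i \<in> I0 x0") (auto simp: core_cone_def)
  moreover have "snd z l = snd z' l" for l
    using z y_\<kappa>[of l z] y_\<kappa>[of l z'] eq c_pos[of l] qk by (cases "l < q") (auto simp: core_cone_def)
  ultimately show "z = z'" by (auto simp: prod_eq_iff Finite_Cartesian_Product.vec_eq_iff)
qed

lemma coneD:
  assumes "z \<in> kone \<epsilon>"
  shows "\<And>i. 0 \<le> fst z $ i" "\<And>i. i \<in> I1 x0 \<Longrightarrow> fst z $ i = 0" "card {i. fst z $ i \<noteq> 0} \<le> s - k"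
    "core_height q z \<le> \<epsilon>" "(\<Sum>i\<in>I0 x0. fst z $ i) + (\<Sum>l<q. (snd z l)\<^sup>2) = core_height q z"
proof -
  obtain u w where [simp]: "z = (u, w)" by force
  show "\<And>i. 0 \<le> fst z $ i" "card {i. fst z $ i \<noteq> 0} \<le> s - k" "core_height q z \<le> \<epsilon>"
    using assms by (auto simp: core_cone_def core_height_def)
  show 0: "\<And>i. i \<in> I1 x0 \<Longrightarrow> fst z $ i = 0" using assms by (auto simp: core_cone_def I0_iff)
  have "(\<Sum>i\<in>UNIV. fst z $ i) = (\<Sum>i\<in>I0 x0. fst z $ i)"
    using 0 by (intro sum.mono_neutral_right) (auto simp: I0_iff)
  then show "(\<Sum>i\<in>I0 x0. fst z $ i) + (\<Sum>l<q. (snd z l)\<^sup>2) = core_height q z" by (simp add: core_height_def)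
qed

text \<open>At most \<open>s - k\<close> nonzero entries off the support of \<open>x0\<close> and at
  most \<open>k\<close> on it.\<close>

lemma \<kappa>_sparse: "z \<in> kone \<epsilon> \<Longrightarrow> \<kappa> z \<in> sparse_vectors s"
proof -
  assume z: "z \<in> kone \<epsilon>"
  have "{i. \<kappa> z $ i \<noteq> 0} \<subseteq> {i. fst z $ i \<noteq> 0} \<union> I1 x0"
  proof
    fix i assume "i \<in> {i. \<kappa> z $ i \<noteq> 0}"
    then show "i \<in> {i. fst z $ i \<noteq> 0} \<union> I1 x0" using \<kappa>_nth[of i z] I0_iff[of i] by auto
  qed
  then have "card {i. \<kappa> z $ i \<noteq> 0} \<le> card ({i. fst z $ i \<noteq> 0} \<union> I1 x0)" by (intro card_mono) auto
  also have "\<dots> \<le> (s - k) + k" using coneD(3)[OF z] card_I1 by (intro order_trans[OF card_Un_le] add_mono) auto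
  finally show ?thesis using ks by (simp add: sparse_vectors_def norm0_def)
qed

lemma local_model_\<kappa>:
  assumes z: "z \<in> kone \<epsilon>" and nz: "\<And>i. i \<in> I1 x0 \<Longrightarrow> \<kappa> z $ i \<noteq> 0"
  shows "local_model f x0 (\<kappa> z) = f x0 - core_height q z"
proof -
  have "(\<Sum>i\<in>I0 x0. \<gamma> i * \<kappa> z $ i) = (\<Sum>i\<in>I0 x0. fst z $ i)"
    using \<gamma>0 by (intro sum.cong) (auto simp: \<kappa>_nth)
  moreover have "(\<Sum>l<k. d l * (y l (\<kappa> z))\<^sup>2) = (\<Sum>l<q. d l * (y l (\<kappa> z))\<^sup>2)"
    using qk by (intro sum.mono_neutral_right) (auto simp: y_\<kappa>)
  moreover have "(\<Sum>l<q. d l * (y l (\<kappa> z))\<^sup>2) = (\<Sum>l<q. - 2 * (snd z l)\<^sup>2)"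
  proof (rule sum.cong)
    fix l assume "l \<in> {..<q}"
    then have l: "l < q" "l < k" using qk by auto
    have "d l * (snd z l / c l)\<^sup>2 = - 2 * (snd z l)\<^sup>2"
      unfolding power_divide c_sq[OF l(1)] using d0[OF l(2)] by (simp add: field_simps)
    then show "d l * (y l (\<kappa> z))\<^sup>2 = - 2 * (snd z l)\<^sup>2" using l by (simp add: y_\<kappa>)
  qed simp
  moreover have "local_model f x0 (\<kappa> z) = f x0 - (\<Sum>i\<in>I0 x0. \<gamma> i * \<kappa> z $ i) + (\<Sum>l<k. d l * (y l (\<kappa> z))\<^sup>2) / 2"
    by (rule local_model_coords[OF \<kappa>_sparse[OF z]]) (rule nz)
  ultimately show ?thesis
    using coneD(5)[OF z] by (simp add: sum_distrib_left[symmetric] sum_negf)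
qed

text \<open>For \<open>\<epsilon> \<le> 1\<close> all squared core coordinates are at most
  \<open>\<epsilon>\<close>. Undoing the rescalings by \<open>\<gamma>\<close> and \<open>c\<close>
  gives this factor, so the core shrinks to \<open>x0\<close> as \<open>\<epsilon>\<close> tends to
  0.\<close>

definition size_bound :: real where
  "size_bound = (\<Sum>i\<in>I0 x0. 1 / (\<gamma> i)\<^sup>2) + (\<Sum>l<q. 1 / (c l)\<^sup>2)"

lemma size_bound_nonneg: "0 \<le> size_bound"
  unfolding size_bound_def by (intro add_nonneg_nonneg sum_nonneg) auto

lemma norm_\<kappa>:
  assumes z: "z \<in> kone \<epsilon>" and \<epsilon>: "0 < \<epsilon>" "\<epsilon> \<le> 1"
  shows "(norm (\<kappa> z - x0))\<^sup>2 \<le> size_bound * \<epsilon>"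
proof -
  have h: "(\<Sum>i\<in>I0 x0. fst z $ i) + (\<Sum>l<q. (snd z l)\<^sup>2) \<le> \<epsilon>" using coneD[OF z] by simp
  have s0: "0 \<le> (\<Sum>i\<in>I0 x0. fst z $ i)" "0 \<le> (\<Sum>l<q. (snd z l)\<^sup>2)"
    using coneD(1)[OF z] by (auto intro!: sum_nonneg)
  have "(fst z $ i)\<^sup>2 \<le> \<epsilon>" if "i \<in> I0 x0" for i
  proof -
    have "fst z $ i \<le> (\<Sum>i\<in>I0 x0. fst z $ i)" using that coneD(1)[OF z] by (intro member_le_sum) auto
    then have "fst z $ i \<le> \<epsilon>" using h s0 by linarith
    then have "fst z $ i * fst z $ i \<le> 1 * \<epsilon>" using coneD(1)[OF z, of i] \<epsilon> by (intro mult_mono) auto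
    then show ?thesis by (simp add: power2_eq_square)
  qed
  then have 1: "(\<kappa> z $ i)\<^sup>2 \<le> 1 / (\<gamma> i)\<^sup>2 * \<epsilon>" if "i \<in> I0 x0" for i
    using that \<gamma>0[of i] by (simp add: \<kappa>_nth power_divide divide_right_mono)
  have 2: "(y l (\<kappa> z))\<^sup>2 \<le> 1 / (c l)\<^sup>2 * \<epsilon>" if "l < q" for l
  proof -
    have "(snd z l)\<^sup>2 \<le> (\<Sum>l<q. (snd z l)\<^sup>2)" using that by (intro member_le_sum) auto
    then have "(snd z l)\<^sup>2 \<le> \<epsilon>" using h s0 by linarith
    then show ?thesis using that qk by (simp add: y_\<kappa> power_divide divide_right_mono)
  qed
  have "(\<Sum>l<k. (y l (\<kappa> z))\<^sup>2) = (\<Sum>l<q. (y l (\<kappa> z))\<^sup>2)"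
    using qk by (intro sum.mono_neutral_right) (auto simp: y_\<kappa>)
  then have "(norm (\<kappa> z - x0))\<^sup>2 = (\<Sum>i\<in>I0 x0. (\<kappa> z $ i)\<^sup>2) + (\<Sum>l<q. (y l (\<kappa> z))\<^sup>2)" by (simp add: norm_coords)
  also have "\<dots> \<le> (\<Sum>i\<in>I0 x0. 1 / (\<gamma> i)\<^sup>2 * \<epsilon>) + (\<Sum>l<q. 1 / (c l)\<^sup>2 * \<epsilon>)"
    by (intro add_mono sum_mono 1 2) auto
  also have "\<dots> = size_bound * \<epsilon>" by (simp add: size_bound_def sum_distrib_right distrib_right)
  finally show ?thesis .
qed

lemma R_\<kappa>: "z \<in> kone \<epsilon> \<Longrightarrow> R (\<kappa> z) = \<kappa> z"
proof (rule eqI_coords)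
  assume z: "z \<in> kone \<epsilon>"
  show "R (\<kappa> z) $ i = \<kappa> z $ i" if "i \<in> I0 x0" for i
    using that coneD(1)[OF z, of i] \<gamma>0[of i] by (simp add: R_nth \<kappa>_nth)
  show "y l (R (\<kappa> z)) = y l (\<kappa> z)" if "l < k" for l
    using that by (simp add: y_R y_\<kappa>)
qed

lemma R_in_core:
  assumes z: "R x \<in> sparse_vectors s" and nz: "\<And>i. i \<in> I1 x0 \<Longrightarrow> R x $ i \<noteq> 0"
    and h: "f x0 - local_model f x0 (R x) \<le> \<epsilon>"
  shows "R x \<in> \<kappa> ` kone \<epsilon>"
proof -
  define u where "u = (\<chi> i. if i \<in> I0 x0 then \<gamma> i * R x $ i else 0)"
  define w where "w l = (if l < q then c l * y l (R x) else 0)" for l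
  have eq: "R x = \<kappa> (u, w)"
  proof (rule eqI_coords)
    show "R x $ i = \<kappa> (u, w) $ i" if "i \<in> I0 x0" for i
      using that \<gamma>0[of i] unfolding \<kappa>_nth[OF that] by (simp add: u_def)
    show "y l (R x) = y l (\<kappa> (u, w))" if "l < k" for l
      using that c_pos[of l] unfolding y_\<kappa>[OF that] by (auto simp: w_def y_R)
  qed
  have nn: "\<forall>i. 0 \<le> u $ i" by (auto simp: u_def R_nth)
  have out: "\<forall>i. i \<notin> I0 x0 \<longrightarrow> u $ i = 0" by (simp add: u_def)
  have "{i. u $ i \<noteq> 0} = {i \<in> I0 x0. R x $ i \<noteq> 0}" using \<gamma>0 by (auto simp: u_def)
  then have card: "card {i. u $ i \<noteq> 0} \<le> s - k" using support_I0_card[OF z nz] by simp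
  have wq: "\<forall>l\<ge>q. w l = 0" by (simp add: w_def)
  \<comment> \<open>The formula for the model holds inside a core, so the point is first placed in
    the core of its own height \<open>e\<close>; the formula then yields
    \<open>e \<le> \<epsilon>\<close>.\<close>
  define e where "e = (\<Sum>i\<in>UNIV. u $ i) + (\<Sum>l<q. (w l)\<^sup>2)"
  have "(u, w) \<in> kone e" using nn out card wq by (simp add: core_cone_def e_def)
  from local_model_\<kappa>[OF this] have "local_model f x0 (R x) = f x0 - e"
    using nz eq by (simp add: core_height_def e_def)
  then have "e \<le> \<epsilon>" using h by simp
  then have "(u, w) \<in> kone \<epsilon>" using nn out card wq by (simp add: core_cone_def e_def)
  then show ?thesis using eq by blast
qed

end

section \<open>Pushing a sublevel set onto the lower one and the core\<close>

text \<open>\<open>F\<close> differs from \<open>f\<close> only inside a ball, so the band is a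
  closed part of a compact band of \<open>f\<close> enlarged by this ball.\<close>

lemma compact_level_band:
  assumes proper: "\<And>K :: real set. compact K \<Longrightarrow> compact (f -` K \<inter> sparse_vectors s)"
    and F: "continuous_on UNIV F" and eq: "\<And>x. norm (x - x0) > \<rho> \<Longrightarrow> F x = f x"
  shows "compact (level_band s F u v)"
proof -
  have "level_band s F u v = ((f -` {u..v} \<inter> sparse_vectors s) \<union> cball x0 \<rho>) \<inter> (sparse_vectors s \<inter> F -` {u..v})"
    using eq by (force simp: level_band_def dist_norm norm_minus_commute)
  moreover have "closed (sparse_vectors s \<inter> F -` {u..v})"
    using F by (intro closed_Int closed_sparse_vectors closed_vimage) auto
  moreover have "compact ((f -` {u..v} \<inter> sparse_vectors s) \<union> cball x0 \<rho>)"
    by (intro compact_Un proper) auto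
  ultimately show ?thesis by (simp add: compact_Int_closed)
qed

text \<open>Points at distance at least \<open>\<delta> / 3\<close> from \<open>x0\<close> are low
  already or drop by at least \<open>2 * \<epsilon>\<close> in the Euler step. The others stay where
  the model is valid, and the collapse takes those that remain above the lower level into the core.
  Neither motion increases \<open>F\<close>, and both fix the core.\<close>

lemma (in nondegenerate_point) local_collapse:
  assumes FG: "has_gradient F G" and \<delta>: "\<delta> > 0"
    and Fm: "\<And>x. norm (x - x0) \<le> \<delta> \<Longrightarrow> F x = local_model f x0 x"
    and nz: "\<And>x i. norm (x - x0) \<le> \<delta> \<Longrightarrow> i \<in> I1 x0 \<Longrightarrow> x $ i \<noteq> 0"
    and ab: "a < f x0" "f x0 < b" and band: "compact (level_band s F a b)"
    and nonstat: "\<And>x. x \<in> level_band s F a b \<Longrightarrow> x \<noteq> x0 \<Longrightarrow> \<exists>i. x $ i \<noteq> 0 \<and> G x $ i \<noteq> 0"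
  obtains \<epsilon> H where "0 < \<epsilon>" "a < f x0 - \<epsilon>" "f x0 + \<epsilon> < b"
    "\<And>z. z \<in> kone \<epsilon> \<Longrightarrow> \<kappa> z \<in> lower_level s F (f x0 - \<epsilon>) \<longleftrightarrow> core_height q z = \<epsilon>"
    "weak_deformation (top_of_set (lower_level s F (f x0 + \<epsilon>))) (lower_level s F (f x0 - \<epsilon>) \<union> \<kappa> ` kone \<epsilon>) H"
proof -
  let ?c = "f x0" and ?V = "descent_field G"
  define c' where "c' = (a + ?c) / 2"
  have c': "a < c'" "c' < ?c" using ab by (auto simp: c'_def)
  \<comment> \<open>The step sets in between the radii \<open>\<delta> / 6\<close> and
    \<open>\<delta> / 3\<close>, hence off the core, and between the values \<open>a\<close> and
    \<open>c'\<close>. The collapse is complete within \<open>\<delta> / 2\<close>, which leaves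
    room for points within \<open>\<delta> / 3\<close> that have moved by
    \<open>\<delta> / 6\<close>.\<close>
  define \<alpha> where "\<alpha> x = max 0 (min 1 (norm (x - x0) * 6 / \<delta> - 1))" for x
  define lc where "lc x = max 0 (min 1 ((F x - a) / (c' - a)))" for x
  define bc where "bc x = max 0 (min 1 (2 - 2 * norm (x - x0) / \<delta>))" for x
  have range: "0 \<le> \<alpha> x" "\<alpha> x \<le> 1" "0 \<le> lc x" "lc x \<le> 1" "0 \<le> bc x" "bc x \<le> 1" for x
    by (auto simp: \<alpha>_def lc_def bc_def)
  define Kc where "Kc = level_band s F a b \<inter> {x. \<delta> / 6 \<le> norm (x - x0)}"
  have "compact Kc" unfolding Kc_def
    by (intro compact_Int_closed band closed_Collect_le continuous_intros)
  moreover have "\<exists>i. x $ i \<noteq> 0 \<and> G x $ i \<noteq> 0" if "x \<in> Kc" for x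
    using that \<delta> by (intro nonstat) (auto simp: Kc_def)
  ultimately obtain \<tau> \<eta> M where \<tau>: "\<tau> > 0" and \<eta>: "\<eta> > 0" and M: "M > 0"
    and VM: "\<And>x. x \<in> Kc \<Longrightarrow> norm (?V x) \<le> M"
    and desc: "\<And>x t. x \<in> Kc \<Longrightarrow> 0 \<le> t \<Longrightarrow> t \<le> \<tau> \<Longrightarrow> F (x + t *\<^sub>R ?V x) \<le> F x - \<eta> * t"
    using uniform_descent[OF FG] by metis
  \<comment> \<open>The second bound limits the displacement in a step to
    \<open>\<delta> / 6\<close>.\<close>
  define T where "T = min \<tau> (\<delta> / (6 * M))"
  have T: "0 < T" "T \<le> \<tau>" "T * M \<le> \<delta> / 6"
  proof -
    show "0 < T" "T \<le> \<tau>" using \<tau> \<delta> M by (auto simp: T_def)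
    have "T * M \<le> \<delta> / (6 * M) * M" using M by (intro mult_right_mono) (auto simp: T_def)
    then show "T * M \<le> \<delta> / 6" using M by simp
  qed
  \<comment> \<open>In order: the hypothesis of \<open>norm_\<kappa>\<close>; a full step leads from
    \<open>f x0 + \<epsilon>\<close> to at most \<open>f x0 - \<epsilon>\<close>; the lower level is
    at least \<open>c'\<close>, above which the value cutoff is 1; the upper level is below
    \<open>b\<close>; the core lies within radius \<open>\<delta> / 6\<close>.\<close>
  define \<epsilon> where "\<epsilon> = Min {1, \<eta> * T / 2, (?c - a) / 2, (b - ?c) / 2, (\<delta> / 6)\<^sup>2 / (size_bound + 1)}"
  have \<epsilon>0: "0 < \<epsilon>" unfolding \<epsilon>_def using \<eta> T ab \<delta> size_bound_nonneg by simp
  have \<epsilon>: "\<epsilon> \<le> 1" "\<epsilon> \<le> \<eta> * T / 2" "\<epsilon> \<le> (?c - a) / 2" "\<epsilon> \<le> (b - ?c) / 2" "\<epsilon> \<le> (\<delta> / 6)\<^sup>2 / (size_bound + 1)"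
    unfolding \<epsilon>_def by (intro Min_le; simp)+
  have \<epsilon>a: "a < ?c - \<epsilon>" "?c + \<epsilon> < b" "c' \<le> ?c - \<epsilon>" using \<epsilon>(3,4) ab by (auto simp: c'_def field_simps)
  define E where "E p = snd p + (fst p * T * (\<alpha> (snd p) * lc (snd p))) *\<^sub>R ?V (snd p)" for p
  define C where "C p = snd p + (fst p * bc (snd p)) *\<^sub>R (R (snd p) - snd p)" for p
  have cF: "continuous_on S F" for S by (rule has_gradient_continuous[OF FG])
  have compc: "continuous_on S (\<lambda>p. g (snd p))" if "continuous_on UNIV g" for g :: "real ^ 'n \<Rightarrow> 'z::topological_space" and S :: "(real \<times> (real ^ 'n)) set"
    by (rule continuous_on_compose2[OF that continuous_on_snd[OF continuous_on_id]]) auto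
  have cE: "continuous_on S E" for S
  proof -
    have "continuous_on UNIV \<alpha>" unfolding \<alpha>_def using \<delta> by (intro continuous_intros) auto
    moreover have "continuous_on UNIV lc" unfolding lc_def using c' by (intro continuous_intros cF) auto
    ultimately show ?thesis unfolding E_def
      by (intro continuous_intros compc continuous_on_descent_field[OF FG])
  qed
  have cC: "continuous_on S C" for S
  proof -
    have "continuous_on UNIV bc" unfolding bc_def using \<delta> by (intro continuous_intros) auto
    then show ?thesis unfolding C_def by (intro continuous_intros compc continuous_on_R)
  qed
  have E_sparse: "E (t, x) \<in> sparse_vectors s" if "x \<in> sparse_vectors s" for t x
    using sparse_descent_field[OF that] by (simp add: E_def)
  have E_step: "F (E (t, x)) \<le> F x - \<eta> * (t * T * (\<alpha> x * lc x)) \<and> norm (E (t, x) - x) \<le> \<delta> / 6"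
    if x: "x \<in> sparse_vectors s" "F x \<le> b" and t: "t \<in> {0..1}" for t x
  \<comment> \<open>Where a cutoff vanishes nothing moves; elsewhere the point belongs to
    \<open>Kc\<close>, where the descent estimate is available.\<close>
  proof (cases "\<alpha> x = 0 \<or> lc x = 0")
    case True
    then show ?thesis using \<delta> by (auto simp: E_def)
  next
    case False
    have "\<delta> / 6 \<le> norm (x - x0)"
    proof (rule ccontr)
      assume "\<not> \<delta> / 6 \<le> norm (x - x0)"
      then have "norm (x - x0) * 6 / \<delta> \<le> 1" using \<delta> by (simp add: field_simps)
      then show False using False by (simp add: \<alpha>_def)
    qed
    moreover have "a \<le> F x"
    proof (rule ccontr)
      assume "\<not> a \<le> F x"
      then have "(F x - a) / (c' - a) \<le> 0" using c' by (simp add: divide_le_0_iff)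
      then show False using False by (simp add: lc_def)
    qed
    ultimately have K: "x \<in> Kc" using x by (simp add: Kc_def level_band_def)
    let ?t = "t * T * (\<alpha> x * lc x)"
    have "\<alpha> x * lc x \<le> 1 * 1" using range by (intro mult_mono) auto
    then have "?t \<le> 1 * T * 1" using t T range by (intro mult_mono) auto
    then have t1: "0 \<le> ?t" "?t \<le> T" using t T range by auto
    have "norm (E (t, x) - x) = ?t * norm (?V x)" using t1 by (simp add: E_def)
    also have "\<dots> \<le> T * M" using t1 VM[OF K] T by (intro mult_mono) auto
    also have "\<dots> \<le> \<delta> / 6" by (rule T)
    finally show ?thesis using desc[OF K t1(1)] t1(2) T by (simp add: E_def)
  qed
  have E_fix: "E (t, x) = x" if "norm (x - x0) \<le> \<delta> / 6" for t x
  proof -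
    have "norm (x - x0) * 6 / \<delta> \<le> 1" using that \<delta> by (simp add: field_simps)
    then have "\<alpha> x = 0" by (simp add: \<alpha>_def)
    then show ?thesis by (simp add: E_def)
  qed
  have C_step: "C (t, x) \<in> sparse_vectors s \<and> F (C (t, x)) \<le> F x"
    if x: "x \<in> sparse_vectors s" and t: "t \<in> {0..1}" for t x
  proof (cases "bc x = 0")
    case True
    then show ?thesis using x by (simp add: C_def)
  next
    case False
    have n: "norm (x - x0) \<le> \<delta>"
    proof (rule ccontr)
      assume "\<not> norm (x - x0) \<le> \<delta>"
      then have "2 \<le> 2 * norm (x - x0) / \<delta>" using \<delta> by (simp add: field_simps)
      then show False using False by (simp add: bc_def)
    qed
    let ?m = "t * bc x"
    have m: "0 \<le> ?m" "?m \<le> 1" using t range[of x] mult_mono[of t 1 "bc x" 1] by auto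
    have nC: "norm (C (t, x) - x0) \<le> \<delta>" using norm_collapse[OF m, of x] n by (simp add: C_def)
    have "C (t, x) \<in> sparse_vectors s" unfolding C_def fst_conv snd_conv
      by (rule collapse_support[OF x]) (rule nz[OF n])
    moreover have "local_model f x0 (x + ?m *\<^sub>R (R x - x)) \<le> local_model f x0 x"
      by (rule local_model_collapse[OF x nz[OF n] nz m]) (use nC in \<open>auto simp: C_def\<close>)
    then have "F (C (t, x)) \<le> F x" using Fm[OF n] Fm[OF nC] by (simp add: C_def)
    ultimately show ?thesis by blast
  qed
  have C1: "C (1, x) = R x" if "norm (x - x0) \<le> \<delta> / 2" for x
  proof -
    have "2 * norm (x - x0) / \<delta> \<le> 1" using that \<delta> by (simp add: field_simps)
    then have "bc x = 1" by (simp add: bc_def)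
    then show ?thesis by (simp add: C_def)
  qed
  have core_small: "norm (\<kappa> z - x0) \<le> \<delta> / 6" if z: "z \<in> kone \<epsilon>" for z
  proof -
    have "(norm (\<kappa> z - x0))\<^sup>2 \<le> size_bound * \<epsilon>" by (rule norm_\<kappa>[OF z \<epsilon>0 \<epsilon>(1)])
    also have "\<dots> \<le> (size_bound + 1) * \<epsilon>" using \<epsilon>0 by (simp add: distrib_right)
    also have "\<dots> \<le> (size_bound + 1) * ((\<delta> / 6)\<^sup>2 / (size_bound + 1))" using \<epsilon>(5) size_bound_nonneg by (intro mult_left_mono) auto
    also have "\<dots> = (\<delta> / 6)\<^sup>2" using size_bound_nonneg by simp
    finally show ?thesis by (rule power2_le_imp_le) (use \<delta> in simp)
  qed
  have F\<kappa>: "F (\<kappa> z) = ?c - core_height q z" if z: "z \<in> kone \<epsilon>" for z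
  proof -
    have n: "norm (\<kappa> z - x0) \<le> \<delta>" using core_small[OF z] \<delta> by simp
    show ?thesis unfolding Fm[OF n] by (rule local_model_\<kappa>[OF z]) (rule nz[OF n])
  qed
  have h0: "0 \<le> core_height q z" "core_height q z \<le> \<epsilon>" if "z \<in> kone \<epsilon>" for z
    using coneD(1,4)[OF that] by (auto simp: core_height_def intro!: add_nonneg_nonneg sum_nonneg)
  let ?Y = "lower_level s F (?c - \<epsilon>)" and ?D = "\<kappa> ` kone \<epsilon>" and ?X = "lower_level s F (?c + \<epsilon>)"
  \<comment> \<open>The Euler step fills the first half of the time, the collapse the
    second.\<close>
  define H where "H p = C (max 0 (2 * fst p - 1), E (min 1 (2 * fst p), snd p))" for p
  have H_pres: "H (t, x) \<in> lower_level s F v" if "x \<in> lower_level s F v" "v \<le> b" "t \<in> {0..1}" for t x v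
  proof -
    have x: "x \<in> sparse_vectors s" "F x \<le> v" "F x \<le> b" using that by (auto simp: lower_level_def)
    have t: "min 1 (2 * t) \<in> {0..1}" "max 0 (2 * t - 1) \<in> {0..1}" using that by auto
    have "0 \<le> \<eta> * (min 1 (2 * t) * T * (\<alpha> x * lc x))" using \<eta> t T range by (intro mult_nonneg_nonneg) auto
    then have "F (E (min 1 (2 * t), x)) \<le> F x" using E_step[OF x(1,3) t(1)] by linarith
    moreover have "C (max 0 (2 * t - 1), E (min 1 (2 * t), x)) \<in> sparse_vectors s"
      "F (C (max 0 (2 * t - 1), E (min 1 (2 * t), x))) \<le> F (E (min 1 (2 * t), x))"
      using C_step[OF E_sparse[OF x(1)] t(2), of "min 1 (2 * t)"] by auto
    ultimately show ?thesis using x by (simp add: H_def lower_level_def)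
  qed
  have H_fix: "H (t, x) = x" if "x \<in> ?D" for t x
    using that core_small E_fix R_\<kappa> by (auto simp: H_def C_def)
  have H1: "H (1, x) \<in> ?Y \<union> ?D" if xX: "x \<in> ?X" for x
  proof -
    have x: "x \<in> sparse_vectors s" "F x \<le> ?c + \<epsilon>" "F x \<le> b" using xX \<epsilon>a by (auto simp: lower_level_def)
    define e where "e = E (1, x)"
    have e: "e \<in> sparse_vectors s" "F e \<le> F x - \<eta> * (T * (\<alpha> x * lc x))" "norm (e - x) \<le> \<delta> / 6"
      using E_sparse[OF x(1)] E_step[OF x(1,3), of 1] by (auto simp: e_def)
    have Hx: "H (1, x) = C (1, e)" by (simp add: H_def e_def)
    have Ce: "C (1, e) \<in> sparse_vectors s" "F (C (1, e)) \<le> F e" using C_step[OF e(1), of 1] by auto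
    show ?thesis
    proof (cases "F (C (1, e)) \<le> ?c - \<epsilon>")
      case True
      then show ?thesis using Hx Ce by (simp add: lower_level_def)
    next
      case False
      have "0 \<le> \<eta> * (T * (\<alpha> x * lc x))" using \<eta> T range by simp
      then have "c' \<le> F x" using False Ce e \<epsilon>a by linarith
      then have "1 \<le> (F x - a) / (c' - a)" using c' by (simp add: le_divide_eq)
      then have lc1: "lc x = 1" by (simp add: lc_def)
      \<comment> \<open>Farther away both cutoffs equal 1, and the full step would already have
        reached the lower level.\<close>
      have "norm (x - x0) < \<delta> / 3"
      proof (rule ccontr)
        assume "\<not> norm (x - x0) < \<delta> / 3"
        then have "2 \<le> norm (x - x0) * 6 / \<delta>" using \<delta> by (simp add: le_divide_eq)
        then have "\<alpha> x = 1" by (simp add: \<alpha>_def)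
        then have "F e \<le> F x - \<eta> * T" using e lc1 by simp
        then show False using False Ce x \<epsilon>(2) by linarith
      qed
      moreover have "norm (e - x0) \<le> norm (e - x) + norm (x - x0)" using norm_triangle_ineq[of "e - x" "x - x0"] by simp
      ultimately have ne: "norm (e - x0) \<le> \<delta> / 2" using e(3) by linarith
      then have Re: "C (1, e) = R e" by (rule C1)
      have nR: "norm (R e - x0) \<le> \<delta>" using norm_R[of e] ne \<delta> by linarith
      have "R e \<in> ?D"
      proof (rule R_in_core)
        show "R e \<in> sparse_vectors s" using Ce Re by simp
        show "\<And>i. i \<in> I1 x0 \<Longrightarrow> R e $ i \<noteq> 0" using nz[OF nR] .
        show "f x0 - local_model f x0 (R e) \<le> \<epsilon>" using False Fm[OF nR] Re by simp
      qed
      then show ?thesis using Hx Re by simp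
    qed
  qed
  show ?thesis
  proof (rule that[of \<epsilon> H])
    show "\<kappa> z \<in> ?Y \<longleftrightarrow> core_height q z = \<epsilon>" if "z \<in> kone \<epsilon>" for z
      using F\<kappa>[OF that] h0[OF that] \<kappa>_sparse[OF that] by (auto simp: lower_level_def)
    show "weak_deformation (top_of_set ?X) (?Y \<union> ?D) H"
      unfolding weak_deformation_def
    proof (intro conjI ballI)
      show "?Y \<union> ?D \<subseteq> topspace (top_of_set ?X)"
        using \<epsilon>0 F\<kappa> h0 \<kappa>_sparse by (fastforce simp: lower_level_def)
      have "continuous_on ({0..1} \<times> ?X) (\<lambda>p. E (min 1 (2 * fst p), snd p))"
        by (rule continuous_on_compose2[OF cE[of UNIV]]) (intro continuous_intros, auto)
      then have "continuous_on ({0..1} \<times> ?X) H" unfolding H_def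
        by (intro continuous_on_compose2[OF cC[of UNIV]] continuous_intros) auto
      then show "continuous_map (prod_topology (top_of_set {0..1}) (top_of_set ?X)) (top_of_set ?X) H"
        using H_pres \<epsilon>a by (auto simp: continuous_map_in_subtopology)
      show "H (0, x) = x" for x by (simp add: H_def C_def E_def)
      show "H (1, x) \<in> ?Y \<union> ?D" if "x \<in> topspace (top_of_set ?X)" for x using H1 that by simp
      show "H (t, x) \<in> ?Y \<union> ?D" if "t \<in> {0..1}" "x \<in> ?Y \<union> ?D" for t x
        using that H_pres[of x "?c - \<epsilon>" t] H_fix[of x t] \<epsilon>a ab \<epsilon>0 by auto
    qed
  qed (use \<epsilon>0 \<epsilon>a in auto)
qed

section \<open>The theorem\<close>

text \<open>Removing \<open>p\<close> leaves the \<open>r\<close>-element subsets of the remaining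
  indices.\<close>

lemma card_subsets_containing:
  assumes "finite I" "p \<in> I"
  shows "card {J. J \<subseteq> I \<and> p \<in> J \<and> card J = r + 1} = (card I - 1) choose r"
proof -
  have "{J. J \<subseteq> I \<and> p \<in> J \<and> card J = r + 1} = insert p ` {J. J \<subseteq> I - {p} \<and> card J = r}"
  proof (intro subset_antisym subsetI)
    fix J assume J: "J \<in> {J. J \<subseteq> I \<and> p \<in> J \<and> card J = r + 1}"
    then have "J = insert p (J - {p})" "J - {p} \<in> {J. J \<subseteq> I - {p} \<and> card J = r}"
      using assms finite_subset by (auto simp: card_Diff_singleton)
    then show "J \<in> insert p ` {J. J \<subseteq> I - {p} \<and> card J = r}" by blast
  next
    fix J assume "J \<in> insert p ` {J. J \<subseteq> I - {p} \<and> card J = r}"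
    then obtain J' where J': "J = insert p J'" "J' \<subseteq> I - {p}" "card J' = r" by auto
    then have "finite J'" "p \<notin> J'" using assms finite_subset by auto
    then show "J \<in> {J. J \<subseteq> I \<and> p \<in> J \<and> card J = r + 1}" using J' assms by auto
  qed
  moreover have "inj_on (insert p) {J. J \<subseteq> I - {p} \<and> card J = r}"
    by (rule inj_onI) (metis (no_types, lifting) Diff_insert_absorb mem_Collect_eq subset_Diff_insert)
  ultimately have "card {J. J \<subseteq> I \<and> p \<in> J \<and> card J = r + 1} = card {J. J \<subseteq> I - {p} \<and> card J = r}"
    by (simp add: card_image)
  also have "\<dots> = card (I - {p}) choose r" using assms by (intro n_subsets) auto
  finally show ?thesis using assms by simp
qed

lemma closedin_lower_level:
  assumes "continuous_on UNIV F" "u \<le> v"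
  shows "closedin (top_of_set (lower_level s F v)) (lower_level s F u)"
proof -
  have "closed {x. F x \<le> u}" using assms(1) by (intro closed_Collect_le continuous_intros)
  then have "closedin (top_of_set (lower_level s F v)) (lower_level s F v \<inter> {x. F x \<le> u})"
    by (rule closedin_closed_Int)
  moreover have "lower_level s F v \<inter> {x. F x \<le> u} = lower_level s F u"
    using assms(2) by (auto simp: lower_level_def)
  ultimately show ?thesis by simp
qed

text \<open>The last step down to \<open>a\<close> needs regularity slightly below \<open>a\<close>.
  The stationary points of the larger band form a compact set with values below \<open>a\<close>, so
  their largest value, if there are any, is below \<open>a\<close> as well, and \<open>a1\<close>
  fits in between.\<close>

lemma regular_below:
  assumes FG: "has_gradient F G" and compact: "compact (level_band s F (a - 1) v)"
    and nonstat: "\<And>x. x \<in> level_band s F a v \<Longrightarrow> \<exists>i. x $ i \<noteq> 0 \<and> G x $ i \<noteq> 0"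
  obtains a1 where "a1 < a" "\<And>x. x \<in> level_band s F a1 v \<Longrightarrow> \<exists>i. x $ i \<noteq> 0 \<and> G x $ i \<noteq> 0"
    "compact (level_band s F a1 v)"
proof -
  have cF: "continuous_on S F" and cG: "continuous_on S G" for S
    using FG has_gradient_continuous[OF FG] by (auto simp: has_gradient_def intro: continuous_on_subset)
  let ?S = "level_band s F (a - 1) v \<inter> (\<Inter>i. {x. x $ i * G x $ i = 0})"
  have "compact ?S"
    by (intro compact_Int_closed compact closed_INT ballI closed_Collect_eq continuous_intros cG)
  then have cS: "compact (F ` ?S)" by (intro compact_continuous_image cF)
  have below: "t < a" if t: "t \<in> F ` ?S" for t
  proof (rule ccontr)
    assume "\<not> t < a"
    then obtain x where x: "x \<in> ?S" "a \<le> F x" using t by auto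
    then have "x \<in> level_band s F a v" by (auto simp: level_band_def)
    then obtain i where "x $ i \<noteq> 0" "G x $ i \<noteq> 0" using nonstat by blast
    moreover have "x $ i * G x $ i = 0" using x(1) by blast
    ultimately show False by simp
  qed
  have "\<exists>a1. a - 1 \<le> a1 \<and> a1 < a \<and> (\<forall>t\<in>F ` ?S. t < a1)"
  proof (cases "?S = {}")
    case True
    then show ?thesis by (intro exI[of _ "a - 1"]) auto
  next
    case False
    then have "F ` ?S \<noteq> {}" by (simp only: image_is_empty not_False_eq_True)
    from compact_attains_sup[OF cS this]
    obtain m where m: "m \<in> F ` ?S" "\<And>t. t \<in> F ` ?S \<Longrightarrow> t \<le> m"
      by (elim bexE) (simp only: Ball_def)
    have "a - 1 \<le> m" using m(1) by (auto simp: level_band_def)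
    have "t < (m + a) / 2" if t: "t \<in> F ` ?S" for t
      using below[OF m(1)] m(2)[OF t] by simp
    then show ?thesis using \<open>a - 1 \<le> m\<close> below[OF m(1)]
      by (intro exI[of _ "(m + a) / 2"]) simp
  qed
  then obtain a1 where a1: "a - 1 \<le> a1" "a1 < a" "\<And>t. t \<in> F ` ?S \<Longrightarrow> t < a1" by blast
  show ?thesis
  proof (rule that[OF a1(2)])
    fix x assume x: "x \<in> level_band s F a1 v"
    then have "x \<in> level_band s F (a - 1) v" "\<not> F x < a1" using a1 by (auto simp: level_band_def)
    then show "\<exists>i. x $ i \<noteq> 0 \<and> G x $ i \<noteq> 0" using a1(3)[of "F x"] by auto
  next
    have "closed {x. a1 \<le> F x}" by (intro closed_Collect_le continuous_intros cF)
    moreover have "level_band s F a1 v = level_band s F (a - 1) v \<inter> {x. a1 \<le> F x}"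
      using a1 by (auto simp: level_band_def)
    ultimately show "compact (level_band s F a1 v)" using compact by (simp add: compact_Int_closed)
  qed
qed

text \<open>\<open>f\<close> is exchanged for a function with the same sublevel sets at
  \<open>a\<close> and \<open>b\<close>. The level descends from \<open>b\<close> to just above the
  critical value, the core is exchanged for cells, and these are carried along down to
  \<open>a\<close>. The index \<open>p\<close> stands for the coordinate 1 of the chosen
  ordering.\<close>

theorem theorem5:
  fixes f :: "real ^ 'n::finite \<Rightarrow> real"
    and s k QI :: nat
    and a b :: real
    and xbar :: "real ^ 'n"
    and p :: 'n
  assumes "s < CARD('n)"
    and "C2 f"
    and "\<And>K :: real set. compact K \<Longrightarrow> compact (f -` K \<inter> sparse_vectors s)"
    and "a < b"
    and "{x \<in> level_band s f a b. M_stationary s f x} = {xbar}"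
    and "nondegenerate s f xbar"
    and "norm0 xbar = k"
    and "quadratic_index f xbar = QI"
    and "a < f xbar" and "f xbar < b"
    and "p \<in> I0 xbar"
  shows "M_index s f xbar = s - k + QI \<and>
    (let Js = {J. J \<subseteq> I0 xbar \<and> p \<in> J \<and> card J = s - k + 1};
         Ma = top_of_set (lower_level s f a);
         Mb = top_of_set (lower_level s f b);
         C = simplex_cube QI;
         B = simplex_cube_boundary QI
     in card Js = (CARD('n) - k - 1) choose (s - k) \<and>
        (\<forall>J\<in>Js. closed_cell (s - k + QI) (C J) (B J)) \<and>
        (\<exists>\<phi>. (\<forall>J\<in>Js. continuous_map (subtopology (C J) (B J)) Ma (\<phi> J)) \<and>
              Mb homotopy_equivalent_space glued_space Ma Js C B \<phi>))"
proof -
  have stat: "M_stationary s f xbar" using assms(5) by blast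
  have ks: "k \<le> s" using stat assms(7) by (simp add: M_stationary_def sparse_vectors_def)
  have I01: "I1 xbar = - I0 xbar" by (auto simp: I0_def I1_def)
  have cI1: "card (I1 xbar) = k" using assms(7) by (simp add: norm0_def I1_def)
  have "card (I0 xbar) + card (I1 xbar) = CARD('n)"
    unfolding I01 Compl_eq_Diff_UNIV by (simp add: card_Diff_subset card_mono)
  then have cI0: "card (I0 xbar) = CARD('n) - k" using cI1 by simp
  have rI: "s - k + 1 \<le> card (I0 xbar)" using cI0 assms(1) ks by simp
  define h where "h i j = partial i (partial j f) xbar" for i j
  have bij: "bij_betw (from_nat_into (I1 xbar)) {..<k} (I1 xbar)"
    using bij_betw_from_nat_into_finite[of "I1 xbar"] cI1 by simp
  have A: "reduced_hessian f xbar = Matrix.mat k k (\<lambda>(p, q). h (from_nat_into (I1 xbar) p) (from_nat_into (I1 xbar) q))"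
    by (simp add: reduced_hessian_def h_def assms(7))
  have sym: "h i j = h j i" for i j unfolding h_def by (rule partial_commute[OF assms(2)])
  have inv: "invertible_mat (Matrix.mat k k (\<lambda>(p, q). h (from_nat_into (I1 xbar) p) (from_nat_into (I1 xbar) q)))"
    using assms(6) A by (simp add: nondegenerate_def)
  have QI: "negative_eigenvalue_count (Matrix.mat k k (\<lambda>(p, q). h (from_nat_into (I1 xbar) p) (from_nat_into (I1 xbar) q))) = QI"
    using assms(8) A by (simp add: quadratic_index_def)
  have nd1: "norm0 xbar < s \<Longrightarrow> \<forall>i\<in>I0 xbar. partial i f xbar \<noteq> 0"
    using assms(6) by (simp add: nondegenerate_def)
  have "\<exists>\<beta> d. nondegenerate_point f xbar s k QI \<beta> d"
  proof (rule diagonalize_principal_submatrix[OF sym bij inv, unfolded QI])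
    fix \<beta> :: "nat \<Rightarrow> real ^ 'n" and d
    assume 1: "\<And>l i. l < k \<Longrightarrow> i \<notin> I1 xbar \<Longrightarrow> \<beta> l $ i = 0"
      and 2: "\<And>l m. l < k \<Longrightarrow> m < k \<Longrightarrow> \<beta> l \<bullet> \<beta> m = (if l = m then 1 else 0)"
      and 3: "\<And>l. l < k \<Longrightarrow> d l \<noteq> 0" "\<And>l. l < k \<Longrightarrow> d l < 0 \<longleftrightarrow> l < QI" and 4: "QI \<le> k"
      and 5: "\<And>l i. l < k \<Longrightarrow> i \<in> I1 xbar \<Longrightarrow> (\<Sum>j\<in>I1 xbar. h i j * \<beta> l $ j) = d l * \<beta> l $ i"
      and 6: "\<And>x. (\<And>i. i \<notin> I1 xbar \<Longrightarrow> x $ i = 0) \<Longrightarrow> x = (\<Sum>l<k. (x \<bullet> \<beta> l) *\<^sub>R \<beta> l)"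
    have "nondegenerate_point f xbar s k QI \<beta> d"
      by (unfold_locales; (rule stat nd1 assms(7) 1 2 3 4 5[unfolded h_def] 6; assumption?))
    then show ?thesis by blast
  qed
  then obtain \<beta> d where "nondegenerate_point f xbar s k QI \<beta> d" by blast
  then interpret nondegenerate_point f xbar s k QI \<beta> d .
  \<comment> \<open>In the eigenbasis the Hessian is diagonal with nonzero entries, hence injective
    along the stratum.\<close>
  have nd2: "w = 0" if w: "\<forall>i. i \<notin> I1 xbar \<longrightarrow> w $ i = 0" and Tw: "core_hessian f xbar w = 0" for w
  proof -
    have "w \<bullet> \<beta> l = 0" if l: "l < k" for l
    proof -
      have "core_hessian f xbar (\<beta> l) = d l *\<^sub>R \<beta> l"
        using eig[OF l] \<beta>0[OF l] by (auto simp: core_hessian_def Finite_Cartesian_Product.vec_eq_iff)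
      then have "d l * (w \<bullet> \<beta> l) = 0"
        using core_hessian_selfadjoint[OF assms(2), of xbar w "\<beta> l"] Tw by simp
      then show ?thesis using d0[OF l] by simp
    qed
    moreover have "w = (\<Sum>l<k. (w \<bullet> \<beta> l) *\<^sub>R \<beta> l)" using expand w by blast
    ultimately show ?thesis by simp
  qed
  obtain F G \<delta> where \<delta>: "\<delta> > 0" and FG: "has_gradient F G"
    and far: "\<And>x. norm (x - xbar) > 2 * \<delta> \<Longrightarrow> F x = f x \<and> G x = gradient f x"
    and model: "\<And>x. norm (x - xbar) \<le> \<delta> \<Longrightarrow> F x = local_model f xbar x"
    and near: "\<And>x. norm (x - xbar) \<le> 2 * \<delta> \<Longrightarrow> a < f x \<and> f x < b \<and> a < F x \<and> F x < b"
    and nz: "\<And>x i. norm (x - xbar) \<le> 2 * \<delta> \<Longrightarrow> i \<in> I1 xbar \<Longrightarrow> x $ i \<noteq> 0"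
    and near_nonstat: "\<And>x. x \<in> sparse_vectors s \<Longrightarrow> norm (x - xbar) \<le> 2 * \<delta> \<Longrightarrow> x \<noteq> xbar \<Longrightarrow> \<exists>i. x $ i \<noteq> 0 \<and> G x $ i \<noteq> 0"
    by (rule flatten_near_nondegenerate[OF assms(2) stat nd1 nd2 assms(9,10)]) (assumption | rule that, assumption, assumption, blast+)+
  have cF: "continuous_on S F" for S by (rule has_gradient_continuous[OF FG])
  have Fx: "F xbar = f xbar" using model[of xbar] \<delta> by (simp add: local_model_def)
  have band: "compact (level_band s F u v)" for u v
    by (rule compact_level_band[OF assms(3) cF, where ?x0.0 = xbar and \<rho> = "2 * \<delta>"]) (use far in auto)
  have nonstat: "\<exists>i. x $ i \<noteq> 0 \<and> G x $ i \<noteq> 0" if x: "x \<in> level_band s F a b" "x \<noteq> xbar" for x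
  proof (cases "norm (x - xbar) \<le> 2 * \<delta>")
    case True
    then show ?thesis using near_nonstat x by (auto simp: level_band_def)
  next
    case False
    then have "F x = f x" "G x = gradient f x" using far[of x] by auto
    then have "x \<in> level_band s f a b" using x(1) by (simp add: level_band_def)
    then have "\<not> M_stationary s f x" using assms(5) x(2) by blast
    then show ?thesis using x(1) \<open>G x = gradient f x\<close>
      by (auto simp: M_stationary_def level_band_def I1_def gradient_component)
  qed
  \<comment> \<open>Inside the ball both functions lie strictly between \<open>a\<close> and
    \<open>b\<close>, and outside they agree; so these two sublevel sets do not change.\<close>
  have Mb: "lower_level s F b = lower_level s f b"
  proof -
    have "F x \<le> b \<longleftrightarrow> f x \<le> b" for x using near[of x] far[of x] by (cases "norm (x - xbar) \<le> 2 * \<delta>") auto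
    then show ?thesis by (simp add: lower_level_def)
  qed
  have Ma: "lower_level s F a = lower_level s f a"
  proof -
    have "F x \<le> a \<longleftrightarrow> f x \<le> a" for x using near[of x] far[of x] by (cases "norm (x - xbar) \<le> 2 * \<delta>") auto
    then show ?thesis by (simp add: lower_level_def)
  qed
  have nz1: "x $ i \<noteq> 0" if "norm (x - xbar) \<le> \<delta>" "i \<in> I1 xbar" for x i
    using nz[of x i] that \<delta> by simp
  obtain \<epsilon> H where \<epsilon>: "0 < \<epsilon>" "a < f xbar - \<epsilon>" "f xbar + \<epsilon> < b"
    and \<kappa>Y: "\<And>z. z \<in> kone \<epsilon> \<Longrightarrow> \<kappa> z \<in> lower_level s F (f xbar - \<epsilon>) \<longleftrightarrow> core_height QI z = \<epsilon>"
    and H: "weak_deformation (top_of_set (lower_level s F (f xbar + \<epsilon>))) (lower_level s F (f xbar - \<epsilon>) \<union> \<kappa> ` kone \<epsilon>) H"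
    by (rule local_collapse[OF FG \<delta> model nz1 assms(9,10) band nonstat]) (assumption | rule that, assumption, assumption, assumption, blast+)+
  let ?C = "simplex_cube QI :: 'n set \<Rightarrow> _" and ?B = "simplex_cube_boundary QI :: 'n set \<Rightarrow> _"
  let ?Js = "{J. J \<subseteq> I0 xbar \<and> p \<in> J \<and> card J = s - k + 1}"
  let ?L = "\<lambda>v. top_of_set (lower_level s F v)"
  have cells: "closed_cell (s - k + QI) (?C J) (?B J)" if "J \<in> ?Js" for J
    using that by (intro closed_cell_simplex_cube) simp
  have sub: "subtopology (top_of_set X) Z = top_of_set Z" if "Z \<subseteq> X" for X Z :: "(real ^ 'n) set"
    using that by (simp add: subtopology_subtopology Int_absorb1)
  have 1: "?L b homotopy_equivalent_space ?L (f xbar + \<epsilon>)"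
  proof -
    \<comment> \<open>Half of \<open>\<epsilon>\<close> leaves a margin for fading out the step
      below \<open>f xbar + \<epsilon>\<close>, and still keeps \<open>xbar\<close> out of the
      band.\<close>
    have ns: "\<exists>i. x $ i \<noteq> 0 \<and> G x $ i \<noteq> 0" if "x \<in> level_band s F (f xbar + \<epsilon> / 2) b" for x
      using that assms(9) \<epsilon> Fx by (intro nonstat) (auto simp: level_band_def)
    have lt: "f xbar + \<epsilon> / 2 < f xbar + \<epsilon>" using \<epsilon> by simp
    obtain \<sigma> where \<sigma>: "\<sigma> > 0" "\<And>v v'. f xbar + \<epsilon> \<le> v' \<Longrightarrow> v' \<le> v \<Longrightarrow> v \<le> b \<Longrightarrow> v - v' \<le> \<sigma> \<Longrightarrow>
       \<exists>H. weak_deformation (?L v) (lower_level s F v') H"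
      using regular_interval_step[OF FG lt band ns] by blast
    show ?thesis
    proof (rule descending_chain[OF \<sigma>(1)])
      show "f xbar + \<epsilon> \<le> b" using \<epsilon> by simp
      show "?L b homotopy_equivalent_space ?L b" by (rule homotopy_equivalent_space_refl)
      fix v v' assume v: "f xbar + \<epsilon> \<le> v'" "v' \<le> v" "v \<le> b" "v - v' \<le> \<sigma>" and P: "?L b homotopy_equivalent_space ?L v"
      obtain H' where "weak_deformation (?L v) (lower_level s F v') H'" using \<sigma>(2)[OF v] by blast
      moreover have "subtopology (?L v) (lower_level s F v') = ?L v'"
        using v by (intro sub) (auto simp: lower_level_def)
      ultimately have "?L v' homotopy_equivalent_space ?L v"
        using homotopy_equivalent_weak_deformation by metis
      then show "?L b homotopy_equivalent_space ?L v'"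
        using P homotopy_eqv_trans homotopy_equivalent_space_sym by blast
    qed
  qed
  let ?Y = "lower_level s F (f xbar - \<epsilon>)" and ?D = "\<kappa> ` kone \<epsilon>"
  have XL: "?Y \<union> ?D \<subseteq> lower_level s F (f xbar + \<epsilon>)" using H by (simp add: weak_deformation_def)
  have 2: "?L (f xbar + \<epsilon>) homotopy_equivalent_space top_of_set (?Y \<union> ?D)"
    using homotopy_equivalent_weak_deformation[OF H] sub[OF XL] homotopy_equivalent_space_sym by metis
  have "closedin (top_of_set (?Y \<union> ?D)) ?Y"
  proof -
    have "closedin (?L (f xbar + \<epsilon>)) ?Y" using \<epsilon> by (intro closedin_lower_level cF) simp
    then show ?thesis by (rule closedin_subset_trans) (use XL in auto)
  qed
  from attach_core[OF \<epsilon>(1) assms(11) rI this continuous_on_\<kappa> inj_\<kappa> refl \<kappa>Y]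
  obtain \<phi> where \<phi>: "\<And>J. J \<in> ?Js \<Longrightarrow> continuous_map (subtopology (?C J) (?B J)) (top_of_set ?Y) (\<phi> J)"
    and 3: "top_of_set (?Y \<union> ?D) homotopy_equivalent_space glued_space (top_of_set ?Y) ?Js ?C ?B \<phi>"
    by blast
  \<comment> \<open>The attaching maps are quantified inside \<open>Q\<close>, because each step
    down replaces them.\<close>
  define Q where "Q v \<longleftrightarrow> (\<exists>\<phi>. (\<forall>J\<in>?Js. continuous_map (subtopology (?C J) (?B J)) (?L v) (\<phi> J)) \<and>
      ?L b homotopy_equivalent_space glued_space (?L v) ?Js ?C ?B \<phi>)" for v
  have Q0: "Q (f xbar - \<epsilon>)"
    unfolding Q_def using \<phi> homotopy_eqv_trans[OF 1 homotopy_eqv_trans[OF 2 3]] by blast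
  have ns: "\<exists>i. x $ i \<noteq> 0 \<and> G x $ i \<noteq> 0" if "x \<in> level_band s F a (f xbar - \<epsilon>)" for x
    using that assms(10) \<epsilon> Fx by (intro nonstat) (auto simp: level_band_def)
  obtain a1 where a1: "a1 < a" "\<And>x. x \<in> level_band s F a1 (f xbar - \<epsilon>) \<Longrightarrow> \<exists>i. x $ i \<noteq> 0 \<and> G x $ i \<noteq> 0"
    using regular_below[OF FG band ns] by metis
  obtain \<sigma> where \<sigma>: "\<sigma> > 0" "\<And>v v'. a \<le> v' \<Longrightarrow> v' \<le> v \<Longrightarrow> v \<le> f xbar - \<epsilon> \<Longrightarrow> v - v' \<le> \<sigma> \<Longrightarrow>
       \<exists>H. weak_deformation (?L v) (lower_level s F v') H"
    using regular_interval_step[OF FG a1(1) band a1(2)] by blast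
  have "Q a"
  proof (rule descending_chain[where P = Q, OF \<sigma>(1) _ Q0])
    show "a \<le> f xbar - \<epsilon>" using \<epsilon> by simp
    fix v v' assume v: "a \<le> v'" "v' \<le> v" "v \<le> f xbar - \<epsilon>" "v - v' \<le> \<sigma>" and "Q v"
    then obtain \<phi> where \<phi>: "\<And>J. J \<in> ?Js \<Longrightarrow> continuous_map (subtopology (?C J) (?B J)) (?L v) (\<phi> J)"
      and e: "?L b homotopy_equivalent_space glued_space (?L v) ?Js ?C ?B \<phi>"
      by (auto simp: Q_def)
    obtain H' where H': "weak_deformation (?L v) (lower_level s F v') H'" using \<sigma>(2)[OF v] by blast
    have cl: "closedin (?L v) (lower_level s F v')" by (rule closedin_lower_level[OF cF v(2)])
    have s': "subtopology (?L v) (lower_level s F v') = ?L v'"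
      using v by (intro sub) (auto simp: lower_level_def)
    note push = glued_space_push[where J="?Js" and C="?C" and B="?B" and \<phi>=\<phi>, OF cells H' cl \<phi>, unfolded s']
    show "Q v'"
      unfolding Q_def
    proof (intro exI[of _ "\<lambda>J c. H' (1, \<phi> J c)"] conjI ballI)
      show "continuous_map (subtopology (?C J) (?B J)) (?L v') (\<lambda>c. H' (1, \<phi> J c))" if "J \<in> ?Js" for J
        by (rule push(2)) (assumption | rule that)+
      show "?L b homotopy_equivalent_space glued_space (?L v') ?Js ?C ?B (\<lambda>J c. H' (1, \<phi> J c))"
        by (rule homotopy_eqv_trans[OF e], rule push(1)) assumption+
    qed
  qed
  then have "\<exists>\<phi>. (\<forall>J\<in>?Js. continuous_map (subtopology (?C J) (?B J)) (top_of_set (lower_level s f a)) (\<phi> J)) \<and>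
      top_of_set (lower_level s f b) homotopy_equivalent_space glued_space (top_of_set (lower_level s f a)) ?Js ?C ?B \<phi>"
    unfolding Q_def Ma Mb .
  moreover have "card ?Js = (CARD('n) - k - 1) choose (s - k)"
    using card_subsets_containing[of "I0 xbar" p "s - k"] assms(11) cI0 by simp
  moreover have "M_index s f xbar = s - k + QI" by (simp add: M_index_def assms(7,8))
  ultimately show ?thesis unfolding Let_def by (intro conjI ballI cells)
qed

end
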